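(* Let $T$ be the staircase transformation of $(X,\mu)$ determined by an integer $h_1$ and a cut sequence $(r_j)_{j\ge 1}$. Suppose that $r_j\to\infty$ as $j\to\infty$ and that $\mu(X)=1$. Then $T$ is mixing, i.e. for all measurable sets $A,B\subset X$, $$\mu(A\cap T^{m}B)\to \mu(A)\mu(B)\quad\text{as } m\to\infty .$$
   Context: Staircase transformation (rank one construction with spacers $s_j(i)=i-1$). Fix an integer $h_1\ge 0$ and a sequence of integers $r_j\ge 2$, $j\ge1$. At stage $j$ one has a $j$-tower: pairwise disjoint intervals of equal length (Lebesgue measure $\mu$) $$E_j, TE_j, T^2E_j,\dots,T^{h_j}E_j$$ (so the tower has $h_j+1$ levels), where $T$ maps each level except the top one $T^{h_j}E_j$ onto the next by translation. To pass to stage $j+1$: - Cutting: cut $E_j$ into $r_j$ consecutive subintervals of equal measure, $E_j=E_j^1\sqcup E_j^2\sqcup\dots\sqcup E_j^{r_j}$. This divides the tower into $r_j$ columns $E_j^i,TE_j^i,\dots,T^{h_j}E_j^i$. - Adding spacers: over the $i$-th column, $i=1,\dots,r_j$, add $i-1$ new disjoint intervals (spacers) of the same length as $E_j^i$, disjoint from everything constructed so far. The $i$-th column becomes $E_j^i,TE_j^i,\dots,T^{h_j+i-1}E_j^i$, with $T$ mapping each level to the next by translation. - Stacking: for all $i<r_j$ set $T^{h_j+i}E_j^i=E_j^{i+1}$, that is, $T$ maps the top level of the $i$-th column by translation onto the bottom level of the $(i+1)$-th column. This yields the $(j+1)$-tower $E_{j+1},TE_{j+1},\dots,T^{h_{j+1}}E_{j+1}$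 with $$E_{j+1}=E_j^1,\qquad h_{j+1}+1=(h_j+1)r_j+\sum_{i=1}^{r_j-1} i .$$ The space $X$ is the union of all $j$-towers, $j\ge1$, with Lebesgue measure $\mu$. The map $T$, defined by all the stages, is an invertible $\mu$-preserving transformation of $X$ (defined up to null sets). The measure $\mu(X)$ may be finite or infinite; when it is finite, the length of $E_1$ can be chosen so that $\mu(X)=1$. *)

theory Defs
  imports "HOL-Analysis.Analysis"
begin

text \<open>
  A rank one map is only determined up to null sets and up to the choice of the intervals used as
  spacers. All intervals are taken half-open, so that cutting is an exact partition, and
  \<open>staircase\<close> below holds of every map arising from some choice of spacers in the real line.
  Stages are numbered from 1, as are the columns of a stage; \<open>r 0\<close> is irrelevant.
\<close>

definition translates_on :: "(real \<Rightarrow> real) \<Rightarrow> real set \<Rightarrow> bool" where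
  "translates_on T S \<longleftrightarrow> (\<exists>c. \<forall>x\<in>S. T x = x + c)"

text \<open>The \<open>j\<close>-tower has \<open>stair_height h1 r j + 1\<close> levels; the value at \<open>j = 0\<close> is a dummy.\<close>

fun stair_height :: "nat \<Rightarrow> (nat \<Rightarrow> nat) \<Rightarrow> nat \<Rightarrow> nat" where
  "stair_height h1 r 0 = h1"
| "stair_height h1 r (Suc 0) = h1"
| "stair_height h1 r (Suc (Suc j)) =
     (stair_height h1 r (Suc j) + 1) * r (Suc j) + (\<Sum>i = 1..r (Suc j) - 1. i) - 1"

definition stair_width :: "(nat \<Rightarrow> nat) \<Rightarrow> real \<Rightarrow> nat \<Rightarrow> real" where
  "stair_width r w j = w / (\<Prod>i = 1..<j. real (r i))"

text \<open>
  \<open>stair_base r a w j\<close> is $E_j$ and \<open>stair_cut r a w j i\<close> is $E_j^i$, where $E_1 = [a, a + w)$.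
  Since $E_{j+1} = E_j^1$, all the $E_j$ have the same left endpoint.
\<close>

definition stair_base :: "(nat \<Rightarrow> nat) \<Rightarrow> real \<Rightarrow> real \<Rightarrow> nat \<Rightarrow> real set" where
  "stair_base r a w j = {a ..< a + stair_width r w j}"

definition stair_cut :: "(nat \<Rightarrow> nat) \<Rightarrow> real \<Rightarrow> real \<Rightarrow> nat \<Rightarrow> nat \<Rightarrow> real set" where
  "stair_cut r a w j i =
     {a + (real i - 1) * stair_width r w (Suc j) ..< a + real i * stair_width r w (Suc j)}"

text \<open>
  In \<open>columns_disjoint\<close> the levels \<open>k \<le> stair_height h1 r j\<close> of the columns make up the
  \<open>j\<close>-tower, which contains all intervals used before, and the remaining ones are the spacers added
  at stage \<open>j\<close>: the new spacers are disjoint from each other and from everything constructed so far.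
\<close>

locale staircase =
  fixes h1 :: nat and r :: "nat \<Rightarrow> nat" and a w :: real and T :: "real \<Rightarrow> real"
  assumes cuts: "\<And>j. j \<ge> 1 \<Longrightarrow> r j \<ge> 2"
    and width_pos: "w > 0"
    and tower_disjoint: "\<And>j. j \<ge> 1 \<Longrightarrow>
      disjoint_family_on (\<lambda>k. (T ^^ k) ` stair_base r a w j) {0..stair_height h1 r j}"
    and tower_translates: "\<And>j k. j \<ge> 1 \<Longrightarrow> k < stair_height h1 r j \<Longrightarrow>
      translates_on T ((T ^^ k) ` stair_base r a w j)"
    and columns_disjoint: "\<And>j. j \<ge> 1 \<Longrightarrow>
      disjoint_family_on (\<lambda>(i, k). (T ^^ k) ` stair_cut r a w j i)
        (SIGMA i:{1..r j}. {0..stair_height h1 r j + i - 1})"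
    and columns_translate: "\<And>j i k. j \<ge> 1 \<Longrightarrow> i \<in> {1..r j} \<Longrightarrow> k < stair_height h1 r j + i - 1 \<Longrightarrow>
      translates_on T ((T ^^ k) ` stair_cut r a w j i)"
    and stack_translates: "\<And>j i. j \<ge> 1 \<Longrightarrow> 1 \<le> i \<Longrightarrow> i < r j \<Longrightarrow>
      translates_on T ((T ^^ (stair_height h1 r j + i - 1)) ` stair_cut r a w j i)"
    and stack_onto: "\<And>j i. j \<ge> 1 \<Longrightarrow> 1 \<le> i \<Longrightarrow> i < r j \<Longrightarrow>
      (T ^^ (stair_height h1 r j + i)) ` stair_cut r a w j i = stair_cut r a w j (i + 1)"

definition stair_space ::
  "nat \<Rightarrow> (nat \<Rightarrow> nat) \<Rightarrow> real \<Rightarrow> real \<Rightarrow> (real \<Rightarrow> real) \<Rightarrow> real set" where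
  "stair_space h1 r a w T =
     (\<Union>j\<in>{1..}. \<Union>k\<in>{0..stair_height h1 r j}. (T ^^ k) ` stair_base r a w j)"

definition mixing :: "'a measure \<Rightarrow> ('a \<Rightarrow> 'a) \<Rightarrow> bool" where
  "mixing M T \<longleftrightarrow> (\<forall>A\<in>sets M. \<forall>B\<in>sets M.
     (\<lambda>m. measure M (A \<inter> (T ^^ m) ` B)) \<longlonglongrightarrow> measure M A * measure M B)"

end

theory Submission
  imports Defs "HOL-Probability.Probability_Measure" "HOL-Real_Asymp.Real_Asymp"
begin

text \<open>
  Let $H_j = h_j + 1$ be the number of levels of the $j$-tower and let $p_i$ be the height, in the
  next tower, at which column $i = 0, 1, \ldots$ of stage $j$ starts. If a point in column $i$ is carried by
  $T^m$ from level $s$ to level $z$ of column $i + k$, then a point at level $s$ of column $i + x$ is carried to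
  level $z - k x$ of column $i + x + k$. Averaging over the columns therefore turns
  correlations at time $m$ into ergodic averages along multiples of the column displacement
  $k \approx m / H_j$.

  Ergodicity of $T$ yields mixing along $H_j, \ldots, H_j + h$ for each fixed $h$ (here $k = 1$). By van der
  Corput's inequality this gives convergence of the averages of $T^d$ for every $d$, hence mixing along
  $H_j \le m \le C H_j$ and, replacing the step $k$ by a multiple between $H_{p+1}$ and $2 H_{p+1}$
  when $H_p \le k < H_{p+1}$, smallness of the averages $N^{-1} \sum_{x<N} T^{k x}$ uniformly in
  $1 \le k \le C N$. This settles the times $m$ with $m r_j \le K H_j^2$, for which the displacement
  is constant along stretches of length comparable to $r_j$. Otherwise the displacement takes many
  different values while the column varies; the contributions of columns with displacements $k' < k$ are nearly
  orthogonal, since shifting both columns by $x$ produces averages of $T^{(k - k') x}$ with $k - k'$ bounded.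
  Finiteness of $\mu(X)$ enters through $r_j / H_j \to 0$.
\<close>

text \<open>Sliding works only while \<open>k * x\<close> is small against \<open>H j\<close>;
  beyond that the level runs through the bottom of its column and the displacement changes. With
  \<open>k\<close> about \<open>m / H j\<close> and stretches of length about \<open>r j\<close>,
  this is the origin of the threshold \<open>m * r j\<close> against \<open>(H j)^2\<close>. Past
  it, moving by about \<open>4 * (H j)^2 / m\<close> columns slides by at least a full tower height,
  which forces two different displacements. Below the threshold the stretch is
  \<open>r j div Q\<close> while \<open>k\<close> may come close to \<open>4 * r j\<close>, so
  averages are needed whose step grows linearly with their length; convergence for each fixed step
  does not suffice. The second factor of a correlation takes the same value in all columns at a
  given level, so it is bounded by 1 outside the sum over columns. What remains is an L1 estimate
  for column sums of a single function of mean zero. Spacers are the recurring error: a column of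
  stage \<open>j\<close> has fewer than \<open>r j\<close> of them above its \<open>H j\<close>
  tower levels. The geometry of the line enters only at the end; the estimates are proved for an
  abstract measure-preserving system with towers.\<close>

section \<open>Columns and levels\<close>

text \<open>The level of the next tower at which column \<open>i\<close>, counted from 0, of a tower with \<open>h\<close> levels starts.\<close>

definition offset :: "nat \<Rightarrow> nat \<Rightarrow> nat" where
  "offset h i = (\<Sum>l<i. h + l)"

lemma offset_0 [simp]: "offset h 0 = 0"
  by (simp add: offset_def)

lemma offset_Suc: "offset h (Suc i) = offset h i + h + i"
  by (simp add: offset_def)

text \<open>\<open>offset h\<close> is quadratic with second difference 1, because each column
  carries one spacer more than its predecessor. Hence the distance between two columns
  \<open>k\<close> apart grows by \<open>k\<close> per step when both move on; all sliding rests on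
  this identity.\<close>

lemma offset_add: "offset h (i + k + x) + offset h i = offset h (i + x) + offset h (i + k) + k * x"
  by (induction x) (simp_all add: offset_Suc)

lemma offset_add_ge: "offset h i + k * h \<le> offset h (i + k)"
  by (induction k) (simp_all add: offset_Suc)

lemma offset_add_le: "i + k \<le> n \<Longrightarrow> offset h (i + k) \<le> offset h i + k * (h + n)"
  by (induction k) (simp_all add: offset_Suc)

lemma offset_mono: "i \<le> i' \<Longrightarrow> offset h i \<le> offset h i'"
  using offset_add_ge[of h i "i' - i"] by simp

text \<open>The spacers on top of a column count as part of it, so for \<open>h > 0\<close> the
  columns partition all natural numbers, including those beyond the actual tower. That a column lies
  below the number of cuts has to be secured separately.\<close>

definition column_of :: "nat \<Rightarrow> nat \<Rightarrow> nat" where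
  "column_of h v = (LEAST c. v < offset h (Suc c))"

lemma
  assumes "h > 0"
  shows column_less: "v < offset h (Suc (column_of h v))"
    and column_le: "offset h (column_of h v) \<le> v"
proof -
  have "v < offset h (Suc v)"
    using assms by (simp add: offset_Suc)
  then show 1: "v < offset h (Suc (column_of h v))"
    unfolding column_of_def by (rule LeastI)
  show "offset h (column_of h v) \<le> v"
  proof (cases "column_of h v")
    case (Suc c)
    then have "\<not> v < offset h (Suc c)"
      unfolding column_of_def by (metis lessI not_less_Least)
    then show ?thesis using Suc by simp
  qed simp
qed

lemma column_unique:
  assumes "offset h c \<le> v" "v < offset h (Suc c)"
  shows "column_of h v = c"
  unfolding column_of_def
proof (rule Least_equality)
  fix c' assume "v < offset h (Suc c')"
  then show "c \<le> c'"
    using assms offset_mono[of "Suc c'" c h] by (meson leD le_trans not_less_eq_eq)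
qed (use assms in auto)

text \<open>An axiomatic rank one system: \<open>L j y\<close> is level \<open>y\<close> of tower
  \<open>j\<close>, \<open>H j\<close> the number of its levels, \<open>w j\<close> the measure of
  each, all numbered from 0. Only forward facts about \<open>T\<close> appear, no invertibility.
  \<open>L_refine\<close> fixes where the columns sit in the next tower; the levels it leaves out
  are the spacers.\<close>

locale stair_system = prob_space M for M :: "'a measure" +
  fixes T :: "'a \<Rightarrow> 'a" and L :: "nat \<Rightarrow> nat \<Rightarrow> 'a set" and r H :: "nat \<Rightarrow> nat" and w :: "nat \<Rightarrow> real"
  assumes T_measurable [measurable]: "T \<in> M \<rightarrow>\<^sub>M M"
    and T_preserves: "distr M M T = M"
    and L_sets: "\<And>j y. y < H j \<Longrightarrow> L j y \<in> sets M"
    and L_disjoint: "\<And>j y y'. y < H j \<Longrightarrow> y' < H j \<Longrightarrow> y \<noteq> y' \<Longrightarrow> L j y \<inter> L j y' = {}"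
    and L_measure: "\<And>j y. y < H j \<Longrightarrow> measure M (L j y) = w j"
    and L_step: "\<And>j y x. Suc y < H j \<Longrightarrow> x \<in> L j y \<Longrightarrow> T x \<in> L j (Suc y)"
    and L_refine: "\<And>j y. y < H j \<Longrightarrow> L j y = (\<Union>i<r j. L (Suc j) (offset (H j) i + y))"
    and H_Suc: "\<And>j. H (Suc j) = offset (H j) (r j)"
    and H0_pos: "H 0 > 0"
    and w_Suc: "\<And>j. w j = real (r j) * w (Suc j)"
    and w_pos: "\<And>j. w j > 0"
    and r_ge: "\<And>j. r j \<ge> 2"
    and r_top: "filterlim r at_top sequentially"
    and towers_full: "(\<lambda>j. real (H j) * w j) \<longlonglongrightarrow> 1"
begin

lemma r_pos: "r j > 0"
  using r_ge[of j] by simp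

lemma H_Suc_ge: "H (Suc j) \<ge> r j * H j"
  using offset_add_ge[of "H j" 0 "r j"] by (simp add: H_Suc)

lemma H_pos: "H j > 0"
proof (induction j)
  case (Suc j)
  then have "r j * H j > 0" using r_pos by simp
  then show ?case using H_Suc_ge[of j] by linarith
qed (rule H0_pos)

lemma H_Suc_ge2: "H (Suc j) \<ge> 2 * H j"
  using H_Suc_ge[of j] r_ge[of j] by (meson le_trans mult_le_mono1)

lemma H_strict_mono: "strict_mono H"
proof (rule strict_monoI_Suc)
  fix j show "H j < H (Suc j)" using H_Suc_ge2[of j] H_pos[of j] by linarith
qed

lemma H_ge: "j \<le> H j"
  using H_strict_mono by (rule strict_mono_imp_increasing)

lemma H_top: "filterlim H at_top sequentially"
  using H_strict_mono by (rule filterlim_subseq)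

lemma offset_less:
  assumes "i < r j" "y < H j"
  shows "offset (H j) i + y < H (Suc j)"
  using offset_mono[of "Suc i" "r j" "H j"] assms by (simp add: offset_Suc H_Suc)

lemma L_subset_space: "y < H j \<Longrightarrow> L j y \<subseteq> space M"
  using L_sets sets.sets_into_space by blast

lemma L_nonempty: "y < H j \<Longrightarrow> L j y \<noteq> {}"
  using L_measure[of y j] w_pos[of j] by auto

lemma L_refine_subset: "y < H j \<Longrightarrow> i < r j \<Longrightarrow> L (Suc j) (offset (H j) i + y) \<subseteq> L j y"
  using L_refine[of y j] by auto

section \<open>Invariant integrals and sums over levels\<close>

lemma L_funpow: "y + m < H j \<Longrightarrow> x \<in> L j y \<Longrightarrow> (T ^^ m) x \<in> L j (y + m)"
  by (induction m) (auto intro: L_step)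

lemma Tn_measurable [measurable]: "(T ^^ n) \<in> M \<rightarrow>\<^sub>M M"
proof (induction n)
  case (Suc n)
  then show ?case using measurable_comp[OF Suc T_measurable] by simp
qed (simp add: id_def)

lemma Tn_preserves: "distr M M (T ^^ n) = M"
proof (induction n)
  case 0
  then show ?case by (simp add: id_def distr_id)
next
  case (Suc n)
  have "distr M M (T ^^ Suc n) = distr (distr M M (T ^^ n)) M T"
    by (subst distr_distr) auto
  then show ?case unfolding Suc T_preserves .
qed

lemma integral_Tn:
  fixes u :: "'a \<Rightarrow> real"
  assumes [measurable]: "u \<in> borel_measurable M"
  shows "(\<integral>x. u ((T ^^ n) x) \<partial>M) = (\<integral>x. u x \<partial>M)"
  by (subst integral_distr[symmetric, of _ _ M]) (auto simp: Tn_preserves)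

lemma integrable_bounded:
  fixes u :: "'a \<Rightarrow> real"
  assumes "u \<in> borel_measurable M" "\<And>x. \<bar>u x\<bar> \<le> c"
  shows "integrable M u"
  by (rule integrable_const_bound[of _ c]) (use assms in auto)

lemma levels_union_measure:
  assumes "Y \<subseteq> {..<H j}"
  shows "(\<Union>y\<in>Y. L j y) \<in> sets M" "measure M (\<Union>y\<in>Y. L j y) = real (card Y) * w j"
proof -
  have fin: "finite Y" using assms finite_subset by blast
  show "(\<Union>y\<in>Y. L j y) \<in> sets M"
    using assms fin L_sets by (intro sets.finite_UN) auto
  have "measure M (\<Union>y\<in>Y. L j y) = (\<Sum>y\<in>Y. measure M (L j y))"
    using assms fin L_sets L_disjoint
    by (intro finite_measure_finite_Union) (auto simp: disjoint_family_on_def subset_iff)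
  also have "\<dots> = (\<Sum>y\<in>Y. w j)"
    using assms L_measure by (intro sum.cong) auto
  finally show "measure M (\<Union>y\<in>Y. L j y) = real (card Y) * w j" by simp
qed

lemma Hw_le_1: "real (H j) * w j \<le> 1"
  using levels_union_measure(2)[of "{..<H j}" j] prob_le_1[of "\<Union>y\<in>{..<H j}. L j y"] by simp

lemma w_le: "w j \<le> 1 / real (H j)"
  using Hw_le_1[of j] H_pos[of j] by (simp add: field_simps)

lemma integral_levels:
  fixes u :: "'a \<Rightarrow> real"
  assumes "Y \<subseteq> {..<H j}" "\<And>y x. y \<in> Y \<Longrightarrow> x \<in> L j y \<Longrightarrow> u x = c y" "u \<in> borel_measurable M"
  shows "(\<integral>x. u x * indicator (\<Union>y\<in>Y. L j y) x \<partial>M) = w j * (\<Sum>y\<in>Y. c y)"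
proof -
  have fin: "finite Y" using assms finite_subset by blast
  have *: "u x * indicator (\<Union>y\<in>Y. L j y) x = (\<Sum>y\<in>Y. c y * indicator (L j y) x)" for x
  proof (cases "x \<in> (\<Union>y\<in>Y. L j y)")
    case True
    then obtain y where y: "y \<in> Y" "x \<in> L j y" by auto
    have "(\<Sum>y\<in>Y. c y * indicator (L j y) x) = c y"
    proof -
      have "(\<Sum>y'\<in>Y. c y' * indicator (L j y') x) = (\<Sum>y'\<in>{y}. c y' * indicator (L j y') x)"
        using y fin assms(1) L_disjoint[of y j]
        by (intro sum.mono_neutral_right) (auto simp: indicator_def subset_iff disjoint_iff)
      then show ?thesis using y by simp
    qed
    then show ?thesis using True y assms(2) by simp
  next
    case False
    then have "(\<Sum>y\<in>Y. c y * indicator (L j y) x) = 0" by (intro sum.neutral) auto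
    then show ?thesis using False by simp
  qed
  have L: "y \<in> Y \<Longrightarrow> L j y \<in> sets M" for y using assms L_sets by auto
  have "(\<integral>x. u x * indicator (\<Union>y\<in>Y. L j y) x \<partial>M) = (\<integral>x. (\<Sum>y\<in>Y. c y * indicator (L j y) x) \<partial>M)"
    by (simp only: *)
  also have "\<dots> = (\<Sum>y\<in>Y. c y * measure M (L j y))"
    using L sets.sets_into_space by (subst Bochner_Integration.integral_sum) (auto simp: Int_absorb2 less_top[symmetric])
  also have "\<dots> = w j * (\<Sum>y\<in>Y. c y)"
    unfolding sum_distrib_left using assms L_measure by (intro sum.cong) auto
  finally show ?thesis .
qed

text \<open>The bridge from values on single levels to L1 norms, by which sums over levels are later
  bounded by ergodic averages.\<close>

lemma sum_levels_le_integral: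
  fixes u :: "'a \<Rightarrow> real"
  assumes "Y \<subseteq> {..<H j}" "\<And>y x. y \<in> Y \<Longrightarrow> x \<in> L j y \<Longrightarrow> u x = c y"
    and [measurable]: "integrable M u"
  shows "w j * (\<Sum>y\<in>Y. \<bar>c y\<bar>) \<le> (\<integral>x. \<bar>u x\<bar> \<partial>M)"
proof -
  have [measurable]: "(\<Union>y\<in>Y. L j y) \<in> sets M" using levels_union_measure assms(1) by blast
  have "w j * (\<Sum>y\<in>Y. \<bar>c y\<bar>) = (\<integral>x. \<bar>u x\<bar> * indicator (\<Union>y\<in>Y. L j y) x \<partial>M)"
    by (rule integral_levels[symmetric]) (use assms in auto)
  also have "\<dots> \<le> (\<integral>x. \<bar>u x\<bar> \<partial>M)"
    using assms(3) by (intro integral_mono integrable_real_mult_indicator integrable_abs) (auto simp: indicator_def)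
  finally show ?thesis .
qed

text \<open>Off the chosen levels only the bound by 1 is known, so the error is the measure of the
  complement.\<close>

lemma integral_approx_levels:
  fixes u :: "'a \<Rightarrow> real"
  assumes Y: "Y \<subseteq> {..<H j}" and c: "\<And>y x. y \<in> Y \<Longrightarrow> x \<in> L j y \<Longrightarrow> u x = c y"
    and [measurable]: "u \<in> borel_measurable M" and b: "\<And>x. \<bar>u x\<bar> \<le> 1"
  shows "\<bar>(\<integral>x. u x \<partial>M) - w j * (\<Sum>y\<in>Y. c y)\<bar> \<le> 1 - real (card Y) * w j"
proof -
  let ?U = "\<Union>y\<in>Y. L j y"
  have U [measurable]: "?U \<in> sets M" using levels_union_measure assms(1) by blast
  have iu: "integrable M u" using b by (intro integrable_bounded[of _ 1]) auto
  have "(\<integral>x. u x \<partial>M) = (\<integral>x. u x * indicator ?U x + u x * indicator (space M - ?U) x \<partial>M)"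
    by (intro Bochner_Integration.integral_cong) (auto simp: indicator_def)
  also have "\<dots> = (\<integral>x. u x * indicator ?U x \<partial>M) + (\<integral>x. u x * indicator (space M - ?U) x \<partial>M)"
    using iu by (intro Bochner_Integration.integral_add integrable_real_mult_indicator) auto
  also have "(\<integral>x. u x * indicator ?U x \<partial>M) = w j * (\<Sum>y\<in>Y. c y)"
    by (rule integral_levels) (use assms in auto)
  finally have 1: "\<bar>(\<integral>x. u x \<partial>M) - w j * (\<Sum>y\<in>Y. c y)\<bar> = \<bar>\<integral>x. u x * indicator (space M - ?U) x \<partial>M\<bar>"
    by simp
  have "\<bar>\<integral>x. u x * indicator (space M - ?U) x \<partial>M\<bar> \<le> (\<integral>x. \<bar>u x * indicator (space M - ?U) x\<bar> \<partial>M)"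
    by (rule integral_abs_bound)
  also have "\<dots> \<le> (\<integral>x. indicator (space M - ?U) x \<partial>M)"
  proof (rule integral_mono)
    show "integrable M (\<lambda>x. \<bar>u x * indicator (space M - ?U) x\<bar>)"
      using iu by (intro integrable_abs integrable_real_mult_indicator) auto
    show "integrable M (indicator (space M - ?U) :: 'a \<Rightarrow> real)"
      by (rule integrable_bounded[of _ 1]) auto
  qed (use b in \<open>auto simp: indicator_def\<close>)
  also have "\<dots> = 1 - measure M ?U"
    using U by (simp add: prob_compl Int_absorb2)
  also have "\<dots> = 1 - real (card Y) * w j"
    using levels_union_measure(2)[OF Y] by simp
  finally show ?thesis using 1 by simp
qed

text \<open>Stage \<open>j\<close> adds spacers of total measure \<open>w j * (r j - 1) / 2\<close>.
  This is the increment of a convergent sequence, hence tends to 0, and \<open>w j\<close> is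
  comparable to \<open>1 / H j\<close>.\<close>

lemma r_over_H: "(\<lambda>j. real (r j) / real (H j)) \<longlonglongrightarrow> 0"
proof -
  have gauss: "2 * (\<Sum>l<n. l) + n = n * n" for n :: nat by (induction n) auto
  have eq: "real (H (Suc j)) * w (Suc j) - real (H j) * w j = w j * (real (r j) - 1) / 2" for j
  proof -
    have "2 * real (H (Suc j)) = 2 * real (r j) * real (H j) + real (r j) * real (r j) - real (r j)"
    proof -
      have "2 * H (Suc j) + r j = 2 * r j * H j + r j * r j"
        using gauss[of "r j"] by (simp add: H_Suc offset_def sum.distrib)
      then have "real (2 * H (Suc j) + r j) = real (2 * r j * H j + r j * r j)"
        by (rule arg_cong)
      then show ?thesis by simp
    qed
    then have "2 * real (H (Suc j)) * w (Suc j) =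
        (2 * real (r j) * real (H j) + real (r j) * real (r j) - real (r j)) * w (Suc j)"
      by simp
    also have "\<dots> = 2 * real (H j) * (real (r j) * w (Suc j)) + (real (r j) * w (Suc j)) * (real (r j) - 1)"
      by (simp add: algebra_simps)
    finally have "2 * real (H (Suc j)) * w (Suc j) = \<dots>" .
    then show ?thesis unfolding w_Suc[of j, symmetric] by (simp add: algebra_simps)
  qed
  have "(\<lambda>j. real (H (Suc j)) * w (Suc j) - real (H j) * w j) \<longlonglongrightarrow> 1 - 1"
    by (intro tendsto_diff towers_full LIMSEQ_Suc[OF towers_full])
  \<comment> \<open>The factor 8 is \<open>2 * 2 * 2\<close>: eventually
    \<open>1 / H j \<le> 2 * w j\<close>, always \<open>r j \<le> 2 * (r j - 1)\<close>, and the
    denominator 2.\<close>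
  then have l: "(\<lambda>j. 8 * (w j * (real (r j) - 1) / 2)) \<longlonglongrightarrow> 0"
    unfolding eq by (auto intro: tendsto_mult_right_zero)
  have ev: "eventually (\<lambda>j. real (H j) * w j > 1/2) sequentially"
    using order_tendstoD(1)[OF towers_full, of "1/2"] by simp
  show ?thesis
  proof (rule tendsto_sandwich[OF _ _ tendsto_const l])
    show "\<forall>\<^sub>F j in sequentially. real (r j) / real (H j) \<le> 8 * (w j * (real (r j) - 1) / 2)"
      using ev
    proof eventually_elim
      case (elim j)
      have "1 / real (H j) \<le> 2 * w j" using elim H_pos[of j] by (simp add: field_simps)
      then have "real (r j) / real (H j) \<le> 2 * w j * real (r j)"
        by (metis mult_right_mono of_nat_0_le_iff times_divide_eq_left mult_1)
      also have "\<dots> \<le> 2 * w j * (2 * (real (r j) - 1))"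
        using r_ge[of j] w_pos[of j] by (intro mult_left_mono) auto
      also have "\<dots> = 8 * (w j * (real (r j) - 1) / 2)" by simp
      finally show ?case .
    qed
  qed auto
qed

section \<open>Level functions and ergodic averages\<close>

definition level_val :: "('a \<Rightarrow> real) \<Rightarrow> nat \<Rightarrow> nat \<Rightarrow> real" where
  "level_val f j y = f (SOME x. x \<in> L j y)"

text \<open>Constancy is demanded at every stage from \<open>n\<close> on, because spacers added
  later are new levels, on which it would not follow from stage \<open>n\<close>. The bound holds at
  all points, which makes integrability immediate.\<close>

definition level_fun :: "nat \<Rightarrow> ('a \<Rightarrow> real) \<Rightarrow> bool" where
  "level_fun n f \<longleftrightarrow> f \<in> borel_measurable M \<and> (\<forall>x. \<bar>f x\<bar> \<le> 1) \<and>
     (\<forall>j\<ge>n. \<forall>y<H j. \<forall>x\<in>L j y. \<forall>x'\<in>L j y. f x = f x')"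

lemma level_funD:
  assumes "level_fun n f"
  shows "f \<in> borel_measurable M" "\<bar>f x\<bar> \<le> 1" "\<bar>level_val f j y\<bar> \<le> 1"
    "j \<ge> n \<Longrightarrow> y < H j \<Longrightarrow> x \<in> L j y \<Longrightarrow> f x = level_val f j y"
proof -
  show "f \<in> borel_measurable M" "\<bar>f x\<bar> \<le> 1" "\<bar>level_val f j y\<bar> \<le> 1"
    using assms by (simp_all add: level_fun_def level_val_def)
  assume "j \<ge> n" "y < H j" and x: "x \<in> L j y"
  then show "f x = level_val f j y"
    using assms someI[of "\<lambda>x. x \<in> L j y", OF x] unfolding level_fun_def level_val_def by blast
qed

lemma level_val_refine:
  assumes "level_fun n f" "j \<ge> n" "y < H j" "i < r j"
  shows "level_val f (Suc j) (offset (H j) i + y) = level_val f j y"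
proof -
  obtain x where x: "x \<in> L (Suc j) (offset (H j) i + y)"
    using L_nonempty[OF offset_less[OF assms(4,3)]] by blast
  then have "x \<in> L j y" using L_refine_subset assms by blast
  then show ?thesis using x level_funD(4)[OF assms(1)] assms offset_less by (metis le_Suc_eq)
qed

lemma level_val_funpow:
  assumes "level_fun n f" "j \<ge> n" "y + m < H j" "x \<in> L j y"
  shows "f ((T ^^ m) x) = level_val f j (y + m)"
  using level_funD(4)[OF assms(1,2,3) L_funpow[OF assms(3,4)]] .

text \<open>The L1 norm of an ergodic average of the power \<open>T ^^ k\<close>; L1 because it is
  compared with sums of absolute values over levels.\<close>

definition avg :: "('a \<Rightarrow> real) \<Rightarrow> nat \<Rightarrow> nat \<Rightarrow> real" where
  "avg f k N = (\<integral>x. \<bar>\<Sum>i<N. f ((T ^^ (k * i)) x)\<bar> \<partial>M) / real N"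

lemma avg_nonneg: "avg f k N \<ge> 0"
  unfolding avg_def by (intro divide_nonneg_nonneg integral_nonneg) auto

text \<open>As long as the whole progression stays inside the tower, the level values along it are
  the values of \<open>f\<close> along an orbit.\<close>

lemma sum_level_val_le_avg:
  assumes f: "level_fun n f" and j: "j \<ge> n" and Y: "\<And>y. y \<in> Y \<Longrightarrow> y + k * (N - 1) < H j" and N: "N > 0"
  shows "w j * (\<Sum>y\<in>Y. \<bar>\<Sum>x<N. level_val f j (y + k * x)\<bar>) \<le> real N * avg f k N"
proof -
  note [measurable] = level_funD(1)[OF f]
  have "w j * (\<Sum>y\<in>Y. \<bar>\<Sum>x<N. level_val f j (y + k * x)\<bar>) \<le> (\<integral>x. \<bar>\<Sum>i<N. f ((T ^^ (k * i)) x)\<bar> \<partial>M)"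
  proof (rule sum_levels_le_integral)
    show "Y \<subseteq> {..<H j}" using Y by (meson add_lessD1 lessThan_iff subsetI)
    show "integrable M (\<lambda>x. \<Sum>i<N. f ((T ^^ (k * i)) x))"
      using level_funD(2)[OF f] by (intro Bochner_Integration.integrable_sum integrable_bounded[of _ 1]) auto
    fix y x assume yx: "y \<in> Y" "x \<in> L j y"
    show "(\<Sum>i<N. f ((T ^^ (k * i)) x)) = (\<Sum>x<N. level_val f j (y + k * x))"
    proof (intro sum.cong refl level_val_funpow[OF f j _ yx(2)])
      fix i assume "i \<in> {..<N}"
      then have "k * i \<le> k * (N - 1)" by (intro mult_le_mono2) auto
      then show "y + k * i < H j" using Y[OF yx(1)] by linarith
    qed
  qed
  then show ?thesis using N by (simp add: avg_def)
qed

text \<open>Sliding lowers levels, so the progressions met later descend; reading each one upwards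
  from its lowest term \<open>z - k * (N - 1)\<close> reduces them to ascending ones.\<close>

lemma sum_level_val_down_le_avg:
  assumes f: "level_fun n f" and j: "j \<ge> n" and Z: "\<And>z. z \<in> Z \<Longrightarrow> k * (N - 1) \<le> z \<and> z < H j" and N: "N > 0"
  shows "w j * (\<Sum>z\<in>Z. \<bar>\<Sum>x<N. level_val f j (z - k * x)\<bar>) \<le> real N * avg f k N"
proof -
  have inj: "inj_on (\<lambda>z. z - k * (N - 1)) Z" using Z by (auto simp: inj_on_def) (metis le_add_diff_inverse2)
  have "(\<Sum>z\<in>Z. \<bar>\<Sum>x<N. level_val f j (z - k * x)\<bar>) =
      (\<Sum>z\<in>Z. \<bar>\<Sum>x<N. level_val f j ((z - k * (N - 1)) + k * x)\<bar>)"
  proof (rule sum.cong[OF refl], rule arg_cong[of _ _ abs])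
    fix z assume z: "z \<in> Z"
    have "(\<Sum>x<N. level_val f j (z - k * x)) = (\<Sum>x<N. level_val f j (z - k * (N - Suc x)))"
      by (rule sum.nat_diff_reindex[symmetric])
    also have "\<dots> = (\<Sum>x<N. level_val f j ((z - k * (N - 1)) + k * x))"
    proof (intro sum.cong refl arg_cong[of _ _ "level_val f j"])
      fix x assume "x \<in> {..<N}"
      then have "k * (N - 1) = k * (N - Suc x) + k * x" by (simp add: add_mult_distrib2[symmetric])
      then show "z - k * (N - Suc x) = z - k * (N - 1) + k * x" using Z[OF z] by linarith
    qed
    finally show "(\<Sum>x<N. level_val f j (z - k * x)) = (\<Sum>x<N. level_val f j ((z - k * (N - 1)) + k * x))" .
  qed
  also have "\<dots> = (\<Sum>y\<in>(\<lambda>z. z - k * (N - 1)) ` Z. \<bar>\<Sum>x<N. level_val f j (y + k * x)\<bar>)"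
    using inj by (simp add: sum.reindex)
  finally show ?thesis using Z N by (auto intro!: sum_level_val_le_avg[OF f j] simp: less_diff_conv2)
qed

end

section \<open>Correlations and averages\<close>

lemma sum_shift_diff:
  fixes u :: "nat \<Rightarrow> real"
  assumes "\<And>i. \<bar>u i\<bar> \<le> 1"
  shows "\<bar>(\<Sum>i<N. u i) - (\<Sum>i<N. u (i + l))\<bar> \<le> 2 * real l"
proof (induction l)
  case (Suc l)
  have "(\<Sum>i<N. u (i + l)) - (\<Sum>i<N. u (i + Suc l)) = u l - u (N + l)"
    by (induction N) auto
  then show ?case using Suc assms[of l] assms[of "N + l"] by (simp add: abs_if split: if_splits)
qed simp

lemma sum_abs_le_card:
  fixes u :: "'b \<Rightarrow> real"
  assumes "\<And>i. i \<in> A \<Longrightarrow> \<bar>u i\<bar> \<le> c"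
  shows "\<bar>\<Sum>i\<in>A. u i\<bar> \<le> real (card A) * c"
  using order_trans[OF sum_abs sum_bounded_above[of A "\<lambda>i. \<bar>u i\<bar>" c]] assms by simp

context stair_system
begin

section \<open>Correlations and van der Corput's inequality\<close>

definition corr :: "('a \<Rightarrow> real) \<Rightarrow> ('a \<Rightarrow> real) \<Rightarrow> nat \<Rightarrow> real" where
  "corr f g m = (\<integral>x. f ((T ^^ m) x) * g x \<partial>M)"

lemma abs_mult_le_1: "\<bar>x\<bar> \<le> 1 \<Longrightarrow> \<bar>y\<bar> \<le> 1 \<Longrightarrow> \<bar>x * y\<bar> \<le> (1::real)"
  by (simp add: abs_mult mult_le_one)

lemma corr_eq:
  assumes f: "f \<in> borel_measurable M" and g: "g \<in> borel_measurable M" and "b \<le> a"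
  shows "(\<integral>x. f ((T ^^ a) x) * g ((T ^^ b) x) \<partial>M) = corr f g (a - b)"
proof -
  note [measurable] = f g
  have "(\<integral>x. f ((T ^^ a) x) * g ((T ^^ b) x) \<partial>M) = (\<integral>x. (\<lambda>z. f ((T ^^ (a - b)) z) * g z) ((T ^^ b) x) \<partial>M)"
    using assms(3) by (simp add: funpow_add[symmetric, THEN fun_cong, unfolded comp_def])
  also have "\<dots> = corr f g (a - b)"
    unfolding corr_def by (rule integral_Tn) measurable
  finally show ?thesis .
qed

lemma square_integral_le:
  fixes u :: "'a \<Rightarrow> real"
  assumes "u \<in> borel_measurable M" "\<And>x. \<bar>u x\<bar> \<le> c"
  shows "(\<integral>x. \<bar>u x\<bar> \<partial>M)\<^sup>2 \<le> (\<integral>x. (u x)\<^sup>2 \<partial>M)"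
proof -
  note [measurable] = assms(1)
  have 1: "integrable M (\<lambda>x. \<bar>u x\<bar>)" using assms by (intro integrable_bounded[of _ c]) auto
  have "\<bar>(u x)\<^sup>2\<bar> \<le> c\<^sup>2" for x using assms(2)[of x] by (simp add: abs_le_square_iff[symmetric])
  then have 2: "integrable M (\<lambda>x. \<bar>u x\<bar>\<^sup>2)" by (intro integrable_bounded[of _ "c\<^sup>2"]) auto
  have "0 \<le> variance (\<lambda>x. \<bar>u x\<bar>)" by (rule variance_positive)
  also have "\<dots> = (\<integral>x. (u x)\<^sup>2 \<partial>M) - (\<integral>x. \<bar>u x\<bar> \<partial>M)\<^sup>2"
    using variance_eq[OF 1 2] by simp
  finally show ?thesis by simp
qed

text \<open>The L1 norm is below the L2 norm. Expanding the square leaves \<open>card S\<close>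
  diagonal terms of size at most 1 and off-diagonal terms of size at most
  \<open>\<eta>\<close>.\<close>

lemma integral_sum_le_van_der_Corput:
  assumes f: "f \<in> borel_measurable M" "\<And>x. \<bar>f x\<bar> \<le> 1" and S: "finite S" "S \<noteq> {}"
    and \<eta>: "\<And>l l'. l \<in> S \<Longrightarrow> l' \<in> S \<Longrightarrow> l' < l \<Longrightarrow> \<bar>corr f f (k * (l - l'))\<bar> \<le> \<eta>" and "\<eta> \<ge> 0"
  shows "(\<integral>x. \<bar>\<Sum>l\<in>S. f ((T ^^ (k * l)) x)\<bar> \<partial>M) \<le> real (card S) * sqrt (1 / real (card S) + \<eta>)"
proof -
  note [measurable] = f(1)
  define c where "c = real (card S)"
  have c: "c > 0" using S by (auto simp: c_def card_gt_0_iff)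
  let ?F = "\<lambda>l x. f ((T ^^ (k * l)) x)"
  have int: "integrable M (\<lambda>x. ?F l x * ?F l' x)" for l l'
    using f abs_mult_le_1 by (intro integrable_bounded[of _ 1]) auto
  have off: "\<bar>\<integral>x. ?F l x * ?F l' x \<partial>M\<bar> \<le> \<eta>" if "l \<in> S" "l' \<in> S" "l \<noteq> l'" for l l'
  proof (cases "l' < l")
    case True
    then show ?thesis using \<eta>[of l l'] that corr_eq[OF f(1,1), of "k * l'" "k * l"]
      by (simp add: diff_mult_distrib2)
  next
    case False
    then show ?thesis using \<eta>[of l' l] that corr_eq[OF f(1,1), of "k * l" "k * l'"]
      by (simp add: diff_mult_distrib2 mult.commute)
  qed
  have entry: "(\<integral>x. ?F l x * ?F l' x \<partial>M) \<le> \<eta> + (if l' = l then 1 else 0)" if "l \<in> S" "l' \<in> S" for l l'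
  proof (cases "l' = l")
    case True
    have "(\<integral>x. ?F l x * ?F l x \<partial>M) \<le> (\<integral>x. 1 \<partial>M)"
      using int[of l l] f(2) by (intro integral_mono) (auto intro: order_trans[OF abs_ge_self abs_mult_le_1])
    then show ?thesis using True \<open>\<eta> \<ge> 0\<close> by (simp add: prob_space)
  qed (use off[OF that] in auto)
  have "(\<integral>x. \<bar>\<Sum>l\<in>S. ?F l x\<bar> \<partial>M)\<^sup>2 \<le> (\<integral>x. (\<Sum>l\<in>S. ?F l x)\<^sup>2 \<partial>M)"
    using f(2) by (intro square_integral_le[of _ "real (card S) * 1"] sum_abs_le_card) auto
  also have "\<dots> = (\<integral>x. (\<Sum>l\<in>S. \<Sum>l'\<in>S. ?F l x * ?F l' x) \<partial>M)"
    by (simp add: power2_eq_square sum_product)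
  also have "\<dots> = (\<Sum>l\<in>S. \<Sum>l'\<in>S. (\<integral>x. ?F l x * ?F l' x \<partial>M))"
    using int by (simp add: Bochner_Integration.integral_sum)
  also have "\<dots> \<le> (\<Sum>l\<in>S. \<Sum>l'\<in>S. \<eta> + (if l' = l then 1 else 0))"
    by (intro sum_mono entry)
  also have "\<dots> = c * (c * \<eta>) + c"
    using S by (simp add: sum.distrib c_def distrib_left)
  also have "\<dots> = (c * sqrt (1 / c + \<eta>))\<^sup>2"
    using c \<open>\<eta> \<ge> 0\<close> by (simp add: power_mult_distrib power2_eq_square[of c] field_simps)
  finally show ?thesis
    unfolding c_def[symmetric] by (rule power2_le_imp_le) (use c \<open>\<eta> \<ge> 0\<close> in auto)
qed

text \<open>Shifting an ergodic sum by \<open>l \<in> S\<close> changes it by at most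
  \<open>2 * K\<close>; averaging over these shifts brings the sum over \<open>S\<close> inside.
  \<open>S\<close> is an arbitrary finite set rather than an interval because the shifts used later
  are widely spaced.\<close>

lemma avg_le_van_der_Corput:
  assumes f: "f \<in> borel_measurable M" "\<And>x. \<bar>f x\<bar> \<le> 1" and S: "finite S" "S \<noteq> {}" "\<And>l. l \<in> S \<Longrightarrow> l \<le> K" and N: "N > 0"
    and \<eta>: "\<And>l l'. l \<in> S \<Longrightarrow> l' \<in> S \<Longrightarrow> l' < l \<Longrightarrow> \<bar>corr f f (k * (l - l'))\<bar> \<le> \<eta>" "\<eta> \<ge> 0"
  shows "avg f k N \<le> sqrt (1 / real (card S) + \<eta>) + 2 * real K / real N"
proof -
  note [measurable] = f(1)
  define c where "c = real (card S)"
  have c: "c > 0" using S by (auto simp: c_def card_gt_0_iff)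
  let ?F = "\<lambda>l x. f ((T ^^ (k * l)) x)"
  let ?G = "\<lambda>x. \<bar>\<Sum>l\<in>S. ?F l x\<bar>"
  have intG: "integrable M ?G"
    using f(2) by (intro integrable_bounded[of _ "real (card S) * 1"]) (auto intro!: sum_abs_le_card[where c = 1, simplified])
  have intGn: "integrable M (\<lambda>x. ?G ((T ^^ n) x))" for n
    using f(2) by (intro integrable_bounded[of _ "real (card S) * 1"]) (auto intro!: sum_abs_le_card[where c = 1, simplified])
  have point: "c * \<bar>\<Sum>i<N. ?F i x\<bar> \<le> (\<Sum>i<N. ?G ((T ^^ (k * i)) x)) + c * (2 * real K)" for x
  proof -
    have "c * (\<Sum>i<N. ?F i x) = (\<Sum>l\<in>S. \<Sum>i<N. ?F (i + l) x) + (\<Sum>l\<in>S. (\<Sum>i<N. ?F i x) - (\<Sum>i<N. ?F (i + l) x))"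
      by (simp add: sum_subtractf c_def)
    also have "(\<Sum>l\<in>S. \<Sum>i<N. ?F (i + l) x) = (\<Sum>i<N. \<Sum>l\<in>S. ?F (i + l) x)"
      by (rule sum.swap)
    also have "\<dots> = (\<Sum>i<N. \<Sum>l\<in>S. ?F l ((T ^^ (k * i)) x))"
      by (simp add: distrib_left funpow_add[symmetric, THEN fun_cong, unfolded comp_def] add.commute)
    finally have "\<bar>c * (\<Sum>i<N. ?F i x)\<bar> \<le> \<bar>\<Sum>i<N. \<Sum>l\<in>S. ?F l ((T ^^ (k * i)) x)\<bar> +
        \<bar>\<Sum>l\<in>S. (\<Sum>i<N. ?F i x) - (\<Sum>i<N. ?F (i + l) x)\<bar>"
      by simp
    moreover have "\<bar>\<Sum>l\<in>S. (\<Sum>i<N. ?F i x) - (\<Sum>i<N. ?F (i + l) x)\<bar> \<le> c * (2 * real K)"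
      unfolding c_def
    proof (rule sum_abs_le_card)
      fix l assume "l \<in> S"
      then show "\<bar>(\<Sum>i<N. ?F i x) - (\<Sum>i<N. ?F (i + l) x)\<bar> \<le> 2 * real K"
        using sum_shift_diff[of "\<lambda>i. ?F i x" N l] f(2) S(3)[of l] by simp
    qed
    moreover have "\<bar>c * (\<Sum>i<N. ?F i x)\<bar> = c * \<bar>\<Sum>i<N. ?F i x\<bar>"
      using c by (simp add: abs_mult)
    ultimately show ?thesis using sum_abs[of "\<lambda>i. \<Sum>l\<in>S. ?F l ((T ^^ (k * i)) x)" "{..<N}"]
      by linarith
  qed
  have "c * (\<integral>x. \<bar>\<Sum>i<N. ?F i x\<bar> \<partial>M) = (\<integral>x. c * \<bar>\<Sum>i<N. ?F i x\<bar> \<partial>M)" by simp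
  also have "\<dots> \<le> (\<integral>x. (\<Sum>i<N. ?G ((T ^^ (k * i)) x)) + c * (2 * real K) \<partial>M)"
  proof (rule integral_mono)
    show "integrable M (\<lambda>x. c * \<bar>\<Sum>i<N. ?F i x\<bar>)"
      using f(2) by (intro integrable_mult_right integrable_abs Bochner_Integration.integrable_sum integrable_bounded[of _ 1]) auto
    show "integrable M (\<lambda>x. (\<Sum>i<N. ?G ((T ^^ (k * i)) x)) + c * (2 * real K))"
      using intGn by (intro Bochner_Integration.integrable_add Bochner_Integration.integrable_sum) auto
  qed (rule point)
  also have "\<dots> = (\<Sum>i<N. \<integral>x. ?G ((T ^^ (k * i)) x) \<partial>M) + c * (2 * real K)"
    using intGn by (subst Bochner_Integration.integral_add)
      (auto simp: prob_space Bochner_Integration.integral_sum intro!: Bochner_Integration.integrable_sum)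
  also have "(\<Sum>i<N. \<integral>x. ?G ((T ^^ (k * i)) x) \<partial>M) = real N * (\<integral>x. ?G x \<partial>M)"
    by (subst integral_Tn) simp_all
  also have "real N * (\<integral>x. ?G x \<partial>M) + c * (2 * real K) \<le> real N * (c * sqrt (1 / c + \<eta>)) + c * (2 * real K)"
    unfolding c_def
    by (intro add_mono mult_left_mono integral_sum_le_van_der_Corput order_refl) (use assms in auto)
  finally have "c * (\<integral>x. \<bar>\<Sum>i<N. ?F i x\<bar> \<partial>M) \<le> c * (real N * sqrt (1 / c + \<eta>) + 2 * real K)"
    by (simp add: algebra_simps)
  then have "(\<integral>x. \<bar>\<Sum>i<N. ?F i x\<bar> \<partial>M) \<le> real N * sqrt (1 / c + \<eta>) + 2 * real K"
    using c by (simp only: mult_le_cancel_left_pos)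
  then show ?thesis
    using N by (simp add: avg_def c_def field_simps)
qed

text \<open>Ergodicity in quantitative form, for one fixed tower. Visits to level \<open>y\<close>
  and to level 0 agree up to a time shift by \<open>y\<close>, so the ergodic sum of
  \<open>f\<close> is close to the sum of all level values times the number of visits to level 0,
  and that sum of values is small since \<open>f\<close> has integral 0. The complement of the tower
  is paid for twice, once in the integral of \<open>f\<close> and once along the orbit.\<close>

lemma avg_1_le:
  assumes f: "level_fun n f" and j: "j \<ge> n" and f0: "(\<integral>x. f x \<partial>M) = 0" and N: "N > 0"
  shows "avg f 1 N \<le> 2 * (1 - real (H j) * w j) + 2 * (real (H j))\<^sup>2 / real N"
proof -
  note [measurable] = level_funD(1)[OF f]
  define \<phi> where "\<phi> = level_val f j"
  define U where "U y = (indicator (L j y) :: 'a \<Rightarrow> real)" for y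
  define tower where "tower = (\<Union>y<H j. L j y)"
  define g where "g x = \<bar>f x\<bar> * indicator (space M - tower) x" for x
  define \<epsilon> where "\<epsilon> = 1 - real (H j) * w j"
  have L [measurable]: "y < H j \<Longrightarrow> L j y \<in> sets M" for y by (rule L_sets)
  have tower [measurable]: "tower \<in> sets M" and tower_measure: "measure M tower = real (H j) * w j"
    using levels_union_measure[of "{..<H j}" j] by (auto simp: tower_def)
  have U_meas [measurable]: "y < H j \<Longrightarrow> U y \<in> borel_measurable M" for y by (simp add: U_def)
  have U_1: "\<bar>U y x\<bar> \<le> 1" for y x by (simp add: U_def)
  have intU: "y < H j \<Longrightarrow> integrable M (\<lambda>x. U y ((T ^^ i) x))" for y i
    using U_1 by (intro integrable_bounded[of _ 1]) auto
  have g_meas [measurable]: "g \<in> borel_measurable M" unfolding g_def by measurable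
  have g1: "0 \<le> g x" "g x \<le> indicator (space M - tower) x" for x
    using level_funD(2)[OF f, of x] by (auto simp: g_def indicator_def)
  have intg: "integrable M (\<lambda>x. g ((T ^^ i) x))" for i
    using level_funD(2)[OF f] by (intro integrable_bounded[of _ 1]) (auto simp: g_def indicator_def)
  have gint: "(\<integral>x. g x \<partial>M) \<le> \<epsilon>"
  proof -
    have "(\<integral>x. g x \<partial>M) \<le> (\<integral>x. indicator (space M - tower) x \<partial>M)"
    proof (rule integral_mono)
      show "integrable M (indicator (space M - tower) :: 'a \<Rightarrow> real)"
        by (rule integrable_bounded[of _ 1]) auto
    qed (use intg[of 0] g1 in auto)
    also have "\<dots> = \<epsilon>" using tower by (simp add: prob_compl Int_absorb2 tower_measure \<epsilon>_def)
    finally show ?thesis .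
  qed
  have sum_small: "w j * \<bar>\<Sum>y<H j. \<phi> y\<bar> \<le> \<epsilon>"
    using integral_approx_levels[of "{..<H j}" j f \<phi>] level_funD[OF f] j f0 w_pos[of j]
    by (simp add: \<phi>_def \<epsilon>_def abs_mult)
  have shift: "(\<integral>x. \<bar>(\<Sum>i<N. U y ((T ^^ i) x)) - (\<Sum>i<N. U 0 ((T ^^ i) x))\<bar> \<partial>M) \<le> 2 * real (H j)"
    if y: "y < H j" for y
  proof -
    have zero: "(\<integral>x. \<bar>U y ((T ^^ y) x) - U 0 x\<bar> \<partial>M) = 0"
    proof -
      \<comment> \<open>Only the inclusion of level 0 in the preimage of level \<open>y\<close> is
        at hand. It fixes the sign of the difference, and equality of the two measures then makes
        the integral vanish.\<close>
      have "\<bar>U y ((T ^^ y) x) - U 0 x\<bar> = U y ((T ^^ y) x) - U 0 x" for x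
        using L_funpow[of 0 y j x] y by (auto simp: U_def indicator_def)
      then have "(\<integral>x. \<bar>U y ((T ^^ y) x) - U 0 x\<bar> \<partial>M) = (\<integral>x. U y ((T ^^ y) x) - U 0 x \<partial>M)" by simp
      also have "\<dots> = (\<integral>x. U y ((T ^^ y) x) \<partial>M) - (\<integral>x. U 0 x \<partial>M)"
        using intU[OF y, of y] intU[of 0 0] H_pos[of j] by (intro Bochner_Integration.integral_diff) auto
      also have "(\<integral>x. U y ((T ^^ y) x) \<partial>M) = (\<integral>x. U y x \<partial>M)" using y by (intro integral_Tn) auto
      also have "(\<integral>x. U y x \<partial>M) - (\<integral>x. U 0 x \<partial>M) = 0"
        using y H_pos[of j] L_measure L_subset_space by (simp add: U_def Int_absorb2)
      finally show ?thesis .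
    qed
    have "(\<integral>x. \<bar>(\<Sum>i<N. U y ((T ^^ i) x)) - (\<Sum>i<N. U 0 ((T ^^ i) x))\<bar> \<partial>M)
        \<le> (\<integral>x. 2 * real y + (\<Sum>i<N. \<bar>U y ((T ^^ y) ((T ^^ i) x)) - U 0 ((T ^^ i) x)\<bar>) \<partial>M)"
    proof (rule integral_mono)
      show "integrable M (\<lambda>x. \<bar>(\<Sum>i<N. U y ((T ^^ i) x)) - (\<Sum>i<N. U 0 ((T ^^ i) x))\<bar>)"
        using intU y H_pos[of j]
        by (intro integrable_abs Bochner_Integration.integrable_diff Bochner_Integration.integrable_sum) auto
      show "integrable M (\<lambda>x. 2 * real y + (\<Sum>i<N. \<bar>U y ((T ^^ y) ((T ^^ i) x)) - U 0 ((T ^^ i) x)\<bar>))"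
        using intU[OF y, of "y + _"] intU[of 0] y H_pos[of j]
        by (intro Bochner_Integration.integrable_add Bochner_Integration.integrable_sum integrable_abs
            Bochner_Integration.integrable_diff) (auto simp: funpow_add)
      fix x
      have "\<bar>(\<Sum>i<N. U y ((T ^^ i) x)) - (\<Sum>i<N. U y ((T ^^ (i + y)) x))\<bar> \<le> 2 * real y"
        by (rule sum_shift_diff) (rule U_1)
      moreover have "\<bar>(\<Sum>i<N. U y ((T ^^ (i + y)) x)) - (\<Sum>i<N. U 0 ((T ^^ i) x))\<bar>
          \<le> (\<Sum>i<N. \<bar>U y ((T ^^ y) ((T ^^ i) x)) - U 0 ((T ^^ i) x)\<bar>)"
        unfolding sum_subtractf[symmetric]
        by (rule order_trans[OF sum_abs]) (simp add: add.commute[of _ y] funpow_add)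
      ultimately show "\<bar>(\<Sum>i<N. U y ((T ^^ i) x)) - (\<Sum>i<N. U 0 ((T ^^ i) x))\<bar>
          \<le> 2 * real y + (\<Sum>i<N. \<bar>U y ((T ^^ y) ((T ^^ i) x)) - U 0 ((T ^^ i) x)\<bar>)"
        by linarith
    qed
    also have "\<dots> = 2 * real y + (\<Sum>i<N. \<integral>x. \<bar>U y ((T ^^ y) ((T ^^ i) x)) - U 0 ((T ^^ i) x)\<bar> \<partial>M)"
    proof -
      have "integrable M (\<lambda>x. \<bar>U y ((T ^^ y) ((T ^^ i) x)) - U 0 ((T ^^ i) x)\<bar>)" for i
        using intU[OF y, of "y + i"] intU[of 0 i] H_pos[of j] by (simp add: funpow_add)
      then show ?thesis
        by (subst Bochner_Integration.integral_add)
          (auto simp: prob_space Bochner_Integration.integral_sum intro!: Bochner_Integration.integrable_sum)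
    qed
    also have "(\<Sum>i<N. \<integral>x. \<bar>U y ((T ^^ y) ((T ^^ i) x)) - U 0 ((T ^^ i) x)\<bar> \<partial>M) = 0"
    proof (rule sum.neutral, rule ballI)
      fix i
      have "(\<integral>x. (\<lambda>z. \<bar>U y ((T ^^ y) z) - U 0 z\<bar>) ((T ^^ i) x) \<partial>M) = 0"
        using y H_pos[of j] by (subst integral_Tn) (use zero in auto)
      then show "(\<integral>x. \<bar>U y ((T ^^ y) ((T ^^ i) x)) - U 0 ((T ^^ i) x)\<bar> \<partial>M) = 0" by simp
    qed
    finally show ?thesis using y by simp
  qed
  have decomp: "\<bar>f x - (\<Sum>y<H j. \<phi> y * U y x)\<bar> \<le> g x" if "x \<in> space M" for x
  proof (cases "x \<in> tower")
    case True
    then obtain y where y: "y < H j" "x \<in> L j y" by (auto simp: tower_def)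
    have "(\<Sum>y<H j. \<phi> y * U y x) = (\<Sum>y\<in>{y}. \<phi> y * U y x)"
      using y L_disjoint[of y j] by (intro sum.mono_neutral_right) (auto simp: U_def indicator_def disjoint_iff)
    also have "\<dots> = f x" using level_funD(4)[OF f j y] y by (simp add: U_def \<phi>_def)
    finally show ?thesis using g1[of x] by simp
  next
    case False
    then have "(\<Sum>y<H j. \<phi> y * U y x) = 0" by (intro sum.neutral) (auto simp: U_def tower_def)
    then show ?thesis using False that by (simp add: g_def)
  qed
  let ?S = "\<lambda>y x. \<Sum>i<N. U y ((T ^^ i) x)"
  let ?D = "\<lambda>x. \<Sum>y<H j. \<bar>?S y x - ?S 0 x\<bar>"
  have point: "\<bar>\<Sum>i<N. f ((T ^^ i) x)\<bar> \<le> ?D x + \<bar>\<Sum>y<H j. \<phi> y\<bar> * ?S 0 x + (\<Sum>i<N. g ((T ^^ i) x))"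
    if x: "x \<in> space M" for x
  proof -
    have Tx: "(T ^^ i) x \<in> space M" for i using measurable_space[OF Tn_measurable x] .
    have "\<bar>(\<Sum>i<N. f ((T ^^ i) x)) - (\<Sum>i<N. \<Sum>y<H j. \<phi> y * U y ((T ^^ i) x))\<bar> \<le> (\<Sum>i<N. g ((T ^^ i) x))"
      unfolding sum_subtractf[symmetric] by (rule order_trans[OF sum_abs sum_mono]) (use decomp Tx in auto)
    moreover have "(\<Sum>i<N. \<Sum>y<H j. \<phi> y * U y ((T ^^ i) x)) = (\<Sum>y<H j. \<phi> y * (?S y x - ?S 0 x)) + (\<Sum>y<H j. \<phi> y) * ?S 0 x"
      by (subst sum.swap) (simp add: sum_distrib_left[symmetric] right_diff_distrib sum_subtractf sum_distrib_right[symmetric])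
    moreover have "\<bar>\<Sum>y<H j. \<phi> y * (?S y x - ?S 0 x)\<bar> \<le> ?D x"
      using level_funD(3)[OF f] by (intro order_trans[OF sum_abs sum_mono])
        (auto simp: abs_mult \<phi>_def intro!: mult_left_le_one_le)
    moreover have "\<bar>(\<Sum>y<H j. \<phi> y) * ?S 0 x\<bar> = \<bar>\<Sum>y<H j. \<phi> y\<bar> * ?S 0 x"
      by (simp add: abs_mult U_def sum_nonneg)
    ultimately show ?thesis by linarith
  qed
  have intS: "y < H j \<Longrightarrow> integrable M (?S y)" for y
    using intU by (intro Bochner_Integration.integrable_sum) auto
  have intD: "integrable M ?D"
    using intS H_pos[of j]
    by (rule_tac Bochner_Integration.integrable_sum, rule_tac integrable_abs, rule_tac Bochner_Integration.integrable_diff) auto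
  have intG: "integrable M (\<lambda>x. \<Sum>i<N. g ((T ^^ i) x))"
    using intg by (intro Bochner_Integration.integrable_sum)
  have "(\<integral>x. \<bar>\<Sum>i<N. f ((T ^^ i) x)\<bar> \<partial>M) \<le>
      (\<integral>x. ?D x + \<bar>\<Sum>y<H j. \<phi> y\<bar> * ?S 0 x + (\<Sum>i<N. g ((T ^^ i) x)) \<partial>M)"
  proof (rule integral_mono)
    show "integrable M (\<lambda>x. \<bar>\<Sum>i<N. f ((T ^^ i) x)\<bar>)"
      using level_funD(2)[OF f] by (intro integrable_abs Bochner_Integration.integrable_sum integrable_bounded[of _ 1]) auto
    show "integrable M (\<lambda>x. ?D x + \<bar>\<Sum>y<H j. \<phi> y\<bar> * ?S 0 x + (\<Sum>i<N. g ((T ^^ i) x)))"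
      using intD intG intS[of 0] H_pos[of j] by (intro Bochner_Integration.integrable_add) auto
  qed (rule point)
  also have "\<dots> = (\<integral>x. ?D x \<partial>M) + \<bar>\<Sum>y<H j. \<phi> y\<bar> * (\<integral>x. ?S 0 x \<partial>M) + (\<integral>x. (\<Sum>i<N. g ((T ^^ i) x)) \<partial>M)"
    using intD intG intS[of 0] H_pos[of j]
    by (subst Bochner_Integration.integral_add, simp, simp)+ simp
  also have "(\<integral>x. ?D x \<partial>M) \<le> (\<Sum>y<H j. 2 * real (H j))"
  proof -
    have "(\<integral>x. ?D x \<partial>M) = (\<Sum>y<H j. \<integral>x. \<bar>?S y x - ?S 0 x\<bar> \<partial>M)"
      using intS H_pos[of j] by (intro Bochner_Integration.integral_sum integrable_abs Bochner_Integration.integrable_diff) auto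
    also have "\<dots> \<le> (\<Sum>y<H j. 2 * real (H j))" by (intro sum_mono shift) auto
    finally show ?thesis .
  qed
  also have "(\<integral>x. ?S 0 x \<partial>M) = real N * w j"
  proof -
    have "(\<integral>x. U 0 x \<partial>M) = w j"
      using H_pos[of j] L_measure L_subset_space by (simp add: U_def Int_absorb2)
    then have "(\<integral>x. U 0 ((T ^^ i) x) \<partial>M) = w j" for i
      using H_pos[of j] by (subst integral_Tn) auto
    then show ?thesis using intU H_pos[of j] by (subst Bochner_Integration.integral_sum) auto
  qed
  also have "(\<integral>x. (\<Sum>i<N. g ((T ^^ i) x)) \<partial>M) \<le> real N * \<epsilon>"
    using intg gint by (subst Bochner_Integration.integral_sum) (auto simp: integral_Tn mult_left_mono)
  finally have "(\<integral>x. \<bar>\<Sum>i<N. f ((T ^^ i) x)\<bar> \<partial>M) \<le>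
      2 * (real (H j))\<^sup>2 + real N * (w j * \<bar>\<Sum>y<H j. \<phi> y\<bar>) + real N * \<epsilon>"
    by (simp add: power2_eq_square mult.commute mult.left_commute)
  also have "\<dots> \<le> 2 * (real (H j))\<^sup>2 + real N * \<epsilon> + real N * \<epsilon>"
    using sum_small by (intro add_mono mult_left_mono) auto
  finally show ?thesis using N by (simp add: avg_def \<epsilon>_def field_simps)
qed

lemma avg_1_tendsto:
  assumes f: "level_fun n f" and f0: "(\<integral>x. f x \<partial>M) = 0"
  shows "avg f 1 \<longlonglongrightarrow> 0"
proof (rule tendstoI)
  fix e :: real assume e: "e > 0"
  have "\<forall>\<^sub>F j in sequentially. real (H j) * w j > 1 - e / 8 \<and> j \<ge> n"
    using order_tendstoD(1)[OF towers_full, of "1 - e / 8"] e eventually_ge_at_top[of n] by (simp add: eventually_conj_iff)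
  then obtain j where j: "real (H j) * w j > 1 - e / 8" "j \<ge> n"
    using eventually_happens'[OF sequentially_bot] by blast
  have "(\<lambda>N. 2 * (real (H j))\<^sup>2 / real N) \<longlonglongrightarrow> 0" by real_asymp
  then have "\<forall>\<^sub>F N in sequentially. 2 * (real (H j))\<^sup>2 / real N < e / 2"
    using e by (auto dest: order_tendstoD(2)[of _ _ _ "e / 2"])
  then show "\<forall>\<^sub>F N in sequentially. dist (avg f 1 N) 0 < e"
    using eventually_gt_at_top[of 0]
  proof eventually_elim
    case (elim N)
    then show ?case using avg_1_le[OF f j(2) f0, of N] avg_nonneg[of f 1 N] j(1) by (simp add: dist_real_def)
  qed
qed

end

section \<open>Correlations as sums over columns\<close>

context stair_system
begin

lemma offset_inj:
  assumes "y < H j" "y' < H j" "offset (H j) i + y = offset (H j) i' + y'"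
  shows "i = i' \<and> y = y'"
proof -
  have "column_of (H j) (offset (H j) i + y) = i" "column_of (H j) (offset (H j) i' + y') = i'"
    using assms(1,2) by (auto intro!: column_unique simp: offset_Suc)
  then show ?thesis using assms(3) by auto
qed

text \<open>Absolute values are taken only after summing over the columns, since cancellation among
  columns is what produces the decay. Columns that leave the next tower within time \<open>m\<close>
  are dropped.\<close>

definition column_sum :: "('a \<Rightarrow> real) \<Rightarrow> nat \<Rightarrow> nat \<Rightarrow> real" where
  "column_sum f j m = w (Suc j) * (\<Sum>s<H j. \<bar>\<Sum>i | i < r j \<and> offset (H j) i + s + m < H (Suc j).
     level_val f (Suc j) (offset (H j) i + s + m)\<bar>)"

text \<open>For \<open>m < H j\<close> a point of the tower either stays in its column, which leaves
  the sum over \<open>y < H j - m\<close>, or passes into the next one. Column \<open>i\<close>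
  carries \<open>i\<close> spacers, so in the second case the landing level is lower by
  \<open>i\<close>, and the sum over \<open>i\<close> becomes an average with step 1, which
  ergodicity controls.\<close>

lemma corr_le_stage:
  assumes f: "level_fun n f" and g: "level_fun n g" and j: "j \<ge> n" and m: "m < H j"
  shows "\<bar>corr f g m\<bar> \<le> (1 - real (H j) * w j) + 1 / real (r j) + avg f 1 (r j - 1) + real (r j) / real (H j) +
    w j * \<bar>\<Sum>y<H j - m. level_val f j (y + m) * level_val g j y\<bar>"
proof -
  note [measurable] = level_funD(1)[OF f] level_funD(1)[OF g]
  note f1 = level_funD(2,3)[OF f] and g1 = level_funD(2,3)[OF g]
  \<comment> \<open>The last column is left out so that column \<open>i + 1\<close> always exists;
    its share is the error \<open>1 / r j\<close>.\<close>
  define R where "R = r j - 1"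
  have R: "R < r j" "R > 0" "r j = Suc R" using r_ge[of j] by (auto simp: R_def)
  define P where "P = offset (H j)"
  define A where "A i y = level_val f (Suc j) (P i + y + m)" for i y
  define Y where "Y = (\<lambda>(i, y). P i + y) ` ({..<R} \<times> {..<H j})"
  have inj: "inj_on (\<lambda>(i, y). P i + y) ({..<R} \<times> {..<H j})"
  proof (rule inj_onI, clarsimp)
    fix i y i' y' assume "y < H j" "y' < H j" "P i + y = P i' + y'"
    then show "i = i' \<and> y = y'" using offset_inj[of y j y' i i'] by (simp add: P_def)
  qed
  have cardY: "card Y = R * H j" using inj by (simp add: Y_def card_image)
  have Ym: "v + m < H (Suc j)" if "v \<in> Y" for v
  proof -
    obtain i y where v: "v = P i + y" "i < R" "y < H j" using \<open>v \<in> Y\<close> by (auto simp: Y_def)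
    then have "offset (H j) (i + 2) \<le> H (Suc j)"
      unfolding H_Suc using R by (intro offset_mono) auto
    then show ?thesis using v m offset_add_ge[of "H j" i 2] by (simp add: P_def)
  qed
  have "\<bar>corr f g m - w (Suc j) * (\<Sum>v\<in>Y. level_val f (Suc j) (v + m) * level_val g (Suc j) v)\<bar>
      \<le> 1 - real (card Y) * w (Suc j)"
    unfolding corr_def
  proof (rule integral_approx_levels)
    show "Y \<subseteq> {..<H (Suc j)}" by (rule subsetI) (use Ym in fastforce)
    show "\<bar>f ((T ^^ m) x) * g x\<bar> \<le> 1" for x using f1 g1 by (intro abs_mult_le_1)
    fix v x assume v: "v \<in> Y" "x \<in> L (Suc j) v"
    then have "v < H (Suc j)" using Ym[of v] by simp
    then show "f ((T ^^ m) x) * g x = level_val f (Suc j) (v + m) * level_val g (Suc j) v"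
      using v Ym[of v] level_val_funpow[OF f, of "Suc j" v m x] level_funD(4)[OF g, of "Suc j" v x] j by simp
  qed measurable
  also have "1 - real (card Y) * w (Suc j) \<le> (1 - real (H j) * w j) + 1 / real (r j)"
  proof -
    have "real (card Y) * w (Suc j) = real (H j) * w j - real (H j) * w (Suc j)"
      by (simp add: cardY w_Suc[of j] R algebra_simps)
    moreover have "real (H j) * w (Suc j) \<le> 1 / real (r j)"
      using Hw_le_1[of j] r_pos[of j] by (simp add: w_Suc[of j] field_simps)
    ultimately show ?thesis by simp
  qed
  finally have 1: "\<bar>corr f g m\<bar> \<le> (1 - real (H j) * w j) + 1 / real (r j) +
     \<bar>w (Suc j) * (\<Sum>v\<in>Y. level_val f (Suc j) (v + m) * level_val g (Suc j) v)\<bar>"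
    by linarith
  have "(\<Sum>v\<in>Y. level_val f (Suc j) (v + m) * level_val g (Suc j) v) =
      (\<Sum>(i, y)\<in>{..<R} \<times> {..<H j}. A i y * level_val g j y)"
    unfolding Y_def sum.reindex[OF inj] A_def
    using level_val_refine[OF g j] R by (intro sum.cong) (auto simp: P_def)
  also have "\<dots> = (\<Sum>y<H j. (\<Sum>i<R. A i y) * level_val g j y)"
    by (subst sum.cartesian_product[symmetric], subst sum.swap) (simp add: sum_distrib_right)
  also have "\<dots> = (\<Sum>y\<in>{..<H j - m}. (\<Sum>i<R. A i y) * level_val g j y) + (\<Sum>y\<in>{H j - m..<H j}. (\<Sum>i<R. A i y) * level_val g j y)"
    by (subst sum.union_disjoint[symmetric]) (auto intro!: sum.cong)
  also have "(\<Sum>y\<in>{..<H j - m}. (\<Sum>i<R. A i y) * level_val g j y) =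
      real R * (\<Sum>y<H j - m. level_val f j (y + m) * level_val g j y)"
    unfolding sum_distrib_left
  proof (rule sum.cong[OF refl])
    fix y assume "y \<in> {..<H j - m}"
    then have "A i y = level_val f j (y + m)" if "i < R" for i
      using that R level_val_refine[OF f j, of "y + m" i] by (simp add: A_def P_def add.assoc)
    then show "(\<Sum>i<R. A i y) * level_val g j y = real R * (level_val f j (y + m) * level_val g j y)" by simp
  qed
  finally have 2: "\<bar>w (Suc j) * (\<Sum>v\<in>Y. level_val f (Suc j) (v + m) * level_val g (Suc j) v)\<bar>
    \<le> \<bar>w (Suc j) * (real R * (\<Sum>y<H j - m. level_val f j (y + m) * level_val g j y))\<bar>
      + \<bar>w (Suc j) * (\<Sum>y\<in>{H j - m..<H j}. (\<Sum>i<R. A i y) * level_val g j y)\<bar>"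
    by (simp only: distrib_left abs_triangle_ineq)
  have low: "\<bar>w (Suc j) * (real R * (\<Sum>y<H j - m. level_val f j (y + m) * level_val g j y))\<bar>
      \<le> w j * \<bar>\<Sum>y<H j - m. level_val f j (y + m) * level_val g j y\<bar>"
  proof -
    have "w (Suc j) * real R \<le> w j" using w_pos[of "Suc j"] by (simp add: w_Suc[of j] R)
    then show ?thesis
      using w_pos[of "Suc j"] mult_right_mono[of "w (Suc j) * real R" "w j"] by (simp add: abs_mult mult.assoc[symmetric])
  qed
  define B where "B z = (\<Sum>i<R. A i (z + (H j - m)))" for z
  have "\<bar>\<Sum>y\<in>{H j - m..<H j}. (\<Sum>i<R. A i y) * level_val g j y\<bar> \<le> (\<Sum>y\<in>{H j - m..<H j}. \<bar>\<Sum>i<R. A i y\<bar>)"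
    using g1 by (intro order_trans[OF sum_abs sum_mono]) (auto simp: abs_mult intro!: mult_right_le_one_le)
  also have "\<dots> = (\<Sum>z<m. \<bar>B z\<bar>)"
    unfolding B_def using m
    by (intro sum.reindex_bij_witness[of _ "\<lambda>z. z + (H j - m)" "\<lambda>y. y - (H j - m)"]) auto
  \<comment> \<open>For \<open>z < r j\<close> the landing place may be a spacer. These
    \<open>r j\<close> levels are bounded trivially, which costs \<open>r j / H j\<close> in the
    end.\<close>
  also have "\<dots> \<le> (\<Sum>z\<in>{..<r j} \<union> {r j..<m}. \<bar>B z\<bar>)"
    by (intro sum_mono2) auto
  also have "\<dots> = (\<Sum>z\<in>{..<r j}. \<bar>B z\<bar>) + (\<Sum>z\<in>{r j..<m}. \<bar>B z\<bar>)"
    by (intro sum.union_disjoint) auto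
  finally have 3: "\<bar>\<Sum>y\<in>{H j - m..<H j}. (\<Sum>i<R. A i y) * level_val g j y\<bar> \<le> \<dots>" .
  have "\<bar>B z\<bar> \<le> real (r j)" for z
    unfolding B_def using f1(2) R by (intro order_trans[OF sum_abs_le_card[of _ _ 1]]) (auto simp: A_def)
  then have 4: "(\<Sum>z\<in>{..<r j}. \<bar>B z\<bar>) \<le> real (r j) * real (r j)"
    using sum_bounded_above[of "{..<r j}" "\<lambda>z. \<bar>B z\<bar>" "real (r j)"] by simp
  have B: "B z = (\<Sum>i<R. level_val f j (z - 1 * i))" if "z \<in> {r j..<m}" for z
    unfolding B_def
  proof (rule sum.cong[OF refl])
    fix i assume i: "i \<in> {..<R}"
    then have "P i + (z + (H j - m)) + m = P (Suc i) + (z - i)"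
      using that m R by (simp add: P_def offset_Suc)
    moreover have "level_val f (Suc j) (P (Suc i) + (z - i)) = level_val f j (z - i)"
      unfolding P_def using i that m R by (intro level_val_refine[OF f j]) auto
    ultimately show "A i (z + (H j - m)) = level_val f j (z - 1 * i)" by (simp add: A_def)
  qed
  have 5: "w j * (\<Sum>z\<in>{r j..<m}. \<bar>B z\<bar>) \<le> real R * avg f 1 R"
  proof -
    have "w j * (\<Sum>z\<in>{r j..<m}. \<bar>\<Sum>i<R. level_val f j (z - 1 * i)\<bar>) \<le> real R * avg f 1 R"
      by (rule sum_level_val_down_le_avg[OF f j]) (use R m in auto)
    then show ?thesis using B by simp
  qed
  have "\<bar>w (Suc j) * (\<Sum>y\<in>{H j - m..<H j}. (\<Sum>i<R. A i y) * level_val g j y)\<bar>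
      \<le> w (Suc j) * (real (r j) * real (r j) + (\<Sum>z\<in>{r j..<m}. \<bar>B z\<bar>))"
    using 3 4 w_pos[of "Suc j"] by (simp add: abs_mult)
  also have "\<dots> = real (r j) * w j + w j * (\<Sum>z\<in>{r j..<m}. \<bar>B z\<bar>) / real (r j)"
    using r_pos[of j] by (simp add: w_Suc[of j] field_simps)
  also have "\<dots> \<le> real (r j) / real (H j) + avg f 1 R"
  proof (rule add_mono)
    show "real (r j) * w j \<le> real (r j) / real (H j)"
      using mult_left_mono[OF w_le[of j], of "real (r j)"] by simp
    have "w j * (\<Sum>z\<in>{r j..<m}. \<bar>B z\<bar>) / real (r j) \<le> real R * avg f 1 R / real (r j)"
      using 5 by (intro divide_right_mono) auto
    also have "\<dots> \<le> avg f 1 R"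
      using R avg_nonneg[of f 1 R] by (simp add: field_simps)
    finally show "w j * (\<Sum>z\<in>{r j..<m}. \<bar>B z\<bar>) / real (r j) \<le> avg f 1 R" .
  qed
  finally show ?thesis using 1 2 low by (simp add: R_def)
qed

text \<open>Writing a level of the next tower as level \<open>s\<close> of column \<open>i\<close>,
  the value of \<open>g\<close> depends on \<open>s\<close> only and is bounded by 1 outside the sum
  over \<open>i\<close>. The remaining levels are spacers, of total measure at most
  \<open>1 - H j * w j\<close>.\<close>

lemma sum_correlated_levels_le:
  assumes f: "level_fun n f" and g: "level_fun n g" and j: "j \<ge> n"
  shows "w (Suc j) * \<bar>\<Sum>y<H (Suc j) - m. level_val f (Suc j) (y + m) * level_val g (Suc j) y\<bar>
     \<le> (1 - real (H j) * w j) + column_sum f j m"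
proof -
  note f1 = level_funD(2,3)[OF f] and g1 = level_funD(2,3)[OF g]
  define P where "P = offset (H j)"
  define I where "I = {..<H j} \<times> {..<r j}"
  define Y where "Y = (\<lambda>(s, i). P i + s) ` I"
  let ?h = "\<lambda>y. level_val f (Suc j) (y + m) * level_val g (Suc j) y"
  have inj: "inj_on (\<lambda>(s, i). P i + s) I"
    unfolding I_def
  proof (rule inj_onI, clarsimp)
    fix i y i' y' assume "y < H j" "y' < H j" "P i + y = P i' + y'"
    then show "y = y' \<and> i = i'" using offset_inj[of y j y' i i'] by (simp add: P_def)
  qed
  have cardY: "card Y = H j * r j" using inj by (simp add: Y_def card_image I_def)
  have Ysub: "Y \<subseteq> {..<H (Suc j)}" using offset_less by (auto simp: Y_def P_def I_def)
  then have finY: "finite Y" using finite_subset by blast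
  have "(\<Sum>y<H (Suc j) - m. ?h y) = (\<Sum>y\<in>{..<H (Suc j) - m} \<inter> Y. ?h y) + (\<Sum>y\<in>{..<H (Suc j) - m} - Y. ?h y)"
    by (rule sum.Int_Diff) simp
  moreover have "\<bar>\<Sum>y\<in>{..<H (Suc j) - m} - Y. ?h y\<bar> \<le> real (H (Suc j)) - real (H j * r j)"
  proof -
    have "\<bar>\<Sum>y\<in>{..<H (Suc j) - m} - Y. ?h y\<bar> \<le> real (card ({..<H (Suc j) - m} - Y)) * 1"
      using f1 g1 by (intro sum_abs_le_card abs_mult_le_1)
    also have "card ({..<H (Suc j) - m} - Y) \<le> card ({..<H (Suc j)} - Y)"
      by (intro card_mono) auto
    also have "card ({..<H (Suc j)} - Y) = H (Suc j) - H j * r j"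
      using Ysub finY by (simp add: card_Diff_subset cardY)
    finally show ?thesis
      using card_mono[OF _ Ysub] cardY by (simp add: of_nat_diff)
  qed
  moreover have "\<bar>\<Sum>y\<in>{..<H (Suc j) - m} \<inter> Y. ?h y\<bar> \<le> (\<Sum>s<H j. \<bar>\<Sum>i | i < r j \<and> P i + s + m < H (Suc j).
     level_val f (Suc j) (P i + s + m)\<bar>)"
  proof -
    have "{..<H (Suc j) - m} \<inter> Y = (\<lambda>(s, i). P i + s) ` {(s, i) \<in> I. P i + s + m < H (Suc j)}"
      by (auto simp: Y_def)
    then have "(\<Sum>y\<in>{..<H (Suc j) - m} \<inter> Y. ?h y) = (\<Sum>(s, i) \<in> {(s, i) \<in> I. P i + s + m < H (Suc j)}. ?h (P i + s))"
      using inj_on_subset[OF inj, of "{(s, i) \<in> I. P i + s + m < H (Suc j)}"]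
      by (simp add: sum.reindex split_def subset_iff)
    also have "{(s, i) \<in> I. P i + s + m < H (Suc j)} = Sigma {..<H j} (\<lambda>s. {i. i < r j \<and> P i + s + m < H (Suc j)})"
      by (auto simp: I_def)
    also have "(\<Sum>(s, i)\<in>\<dots>. ?h (P i + s)) = (\<Sum>s<H j. \<Sum>i | i < r j \<and> P i + s + m < H (Suc j). ?h (P i + s))"
      by (rule sum.Sigma[symmetric]) auto
    also have "\<dots> = (\<Sum>s<H j. (\<Sum>i | i < r j \<and> P i + s + m < H (Suc j). level_val f (Suc j) (P i + s + m)) * level_val g j s)"
      unfolding sum_distrib_right using level_val_refine[OF g j]
      by (intro sum.cong) (auto simp: P_def)
    finally have eq: "(\<Sum>y\<in>{..<H (Suc j) - m} \<inter> Y. ?h y) =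
      (\<Sum>s<H j. (\<Sum>i | i < r j \<and> P i + s + m < H (Suc j). level_val f (Suc j) (P i + s + m)) * level_val g j s)" .
    show "\<bar>\<Sum>y\<in>{..<H (Suc j) - m} \<inter> Y. ?h y\<bar> \<le> (\<Sum>s<H j. \<bar>\<Sum>i | i < r j \<and> P i + s + m < H (Suc j). level_val f (Suc j) (P i + s + m)\<bar>)"
      unfolding eq using g1
      by (intro order_trans[OF sum_abs sum_mono]) (auto simp: abs_mult intro!: mult_right_le_one_le)
  qed
  ultimately have "\<bar>\<Sum>y<H (Suc j) - m. ?h y\<bar> \<le> (real (H (Suc j)) - real (H j * r j)) +
     (\<Sum>s<H j. \<bar>\<Sum>i | i < r j \<and> P i + s + m < H (Suc j). level_val f (Suc j) (P i + s + m)\<bar>)"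
    by linarith
  then have "w (Suc j) * \<bar>\<Sum>y<H (Suc j) - m. ?h y\<bar> \<le> w (Suc j) * (real (H (Suc j)) - real (H j * r j)) + column_sum f j m"
    using w_pos[of "Suc j"] by (simp add: column_sum_def P_def distrib_left[symmetric])
  also have "w (Suc j) * (real (H (Suc j)) - real (H j * r j)) \<le> 1 - real (H j) * w j"
    using Hw_le_1[of "Suc j"] by (simp add: w_Suc[of j] algebra_simps)
  finally show ?thesis by simp
qed

text \<open>Everything lost between a correlation at time \<open>m < H (Suc j)\<close> and the
  column sum of stage \<open>j\<close>. The reduction for short times is applied one tower higher,
  hence the terms with \<open>Suc j\<close>.\<close>

definition stage_error :: "('a \<Rightarrow> real) \<Rightarrow> nat \<Rightarrow> real" where
  "stage_error f j = (1 - real (H j) * w j) + (1 - real (H (Suc j)) * w (Suc j)) + 1 / real (r (Suc j)) +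
     avg f 1 (r (Suc j) - 1) + real (r (Suc j)) / real (H (Suc j))"

lemma corr_le_column_sum:
  assumes f: "level_fun n f" and g: "level_fun n g" and j: "j \<ge> n" and m: "m < H (Suc j)"
  shows "\<bar>corr f g m\<bar> \<le> stage_error f j + column_sum f j m"
proof -
  have "n \<le> Suc j" using j by simp
  from corr_le_stage[OF f g this m] sum_correlated_levels_le[OF f g j, of m]
  show ?thesis by (simp add: stage_error_def)
qed

lemma stage_error_tendsto:
  assumes f: "level_fun n f" and f0: "(\<integral>x. f x \<partial>M) = 0"
  shows "stage_error f \<longlonglongrightarrow> 0"
proof -
  have r': "filterlim (\<lambda>j. r j - 1) at_top sequentially"
    by (rule filterlim_compose[OF _ r_top]) real_asymp
  have "(\<lambda>j. avg f 1 (r j - 1)) \<longlonglongrightarrow> 0"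
    by (rule filterlim_compose[OF avg_1_tendsto[OF f f0] r'])
  moreover have "(\<lambda>j. 1 / real (r j)) \<longlonglongrightarrow> 0"
    by (rule filterlim_compose[OF _ r_top]) real_asymp
  ultimately have "stage_error f \<longlonglongrightarrow> (1 - 1) + (1 - 1) + 0 + 0 + 0"
    unfolding stage_error_def
    by (intro tendsto_intros towers_full LIMSEQ_Suc[OF towers_full] r_over_H[THEN LIMSEQ_Suc]) (auto dest: LIMSEQ_Suc)
  then show ?thesis by simp
qed

end

section \<open>Constant displacement\<close>

lemma sum_windows:
  fixes u :: "nat \<Rightarrow> real"
  assumes u: "\<And>i. \<bar>u i\<bar> \<le> 1" and "b > 0"
  shows "\<bar>\<Sum>i<N. u i\<bar> \<le> (\<Sum>q<N div b. \<bar>\<Sum>x<b. u (q * b + x)\<bar>) + real b"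
proof -
  have "{..<N} = {..<N div b * b} \<union> {N div b * b..<N}"
    by (auto simp: ivl_disj_un)
  then have "(\<Sum>i<N. u i) = (\<Sum>i<N div b * b. u i) + (\<Sum>i\<in>{N div b * b..<N}. u i)"
    by (simp add: sum.union_disjoint ivl_disj_int)
  moreover have "(\<Sum>i<N div b * b. u i) = (\<Sum>q<N div b. \<Sum>x<b. u (q * b + x))"
  proof -
    have "(\<Sum>i<N div b * b. u i) = (\<Sum>q<N div b. sum u {q * b..<q * b + b})"
      by (rule sum.nat_group[symmetric])
    also have "\<dots> = (\<Sum>q<N div b. \<Sum>x<b. u (q * b + x))"
      by (rule sum.cong[OF refl]) (simp add: sum.atLeastLessThan_shift_0[of u] atLeast0LessThan)
    finally show ?thesis .
  qed
  moreover have "\<bar>\<Sum>i\<in>{N div b * b..<N}. u i\<bar> \<le> real b"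
  proof -
    have "\<bar>\<Sum>i\<in>{N div b * b..<N}. u i\<bar> \<le> real (card {N div b * b..<N}) * 1"
      by (rule sum_abs_le_card) (rule u)
    also have "card {N div b * b..<N} = N mod b" by (simp add: minus_div_mult_eq_mod)
    also have "real (N mod b) * 1 \<le> real b" using \<open>b > 0\<close> by (simp add: less_imp_le)
    finally show ?thesis .
  qed
  moreover have "\<bar>\<Sum>q<N div b. \<Sum>x<b. u (q * b + x)\<bar> \<le> (\<Sum>q<N div b. \<bar>\<Sum>x<b. u (q * b + x)\<bar>)"
    by (rule sum_abs)
  ultimately show ?thesis by linarith
qed

context stair_system
begin

section \<open>Sliding along columns\<close>

lemma offset_less_H_Suc: "offset (H j) c < H (Suc j) \<Longrightarrow> c < r j"
  using offset_mono[of "r j" c "H j"] by (fastforce simp: H_Suc not_less[symmetric])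

text \<open>By \<open>offset_add\<close>, the time that carries column \<open>i\<close> to column
  \<open>c\<close> carries column \<open>i + x\<close> to column \<open>c + x\<close>, lower by
  \<open>c - i\<close> for each unit of \<open>x\<close>. The side conditions keep the level inside
  the column and below its spacers, and the last one makes column \<open>c + x\<close>
  exist.\<close>

lemma level_val_slide:
  assumes f: "level_fun n f" and j: "j \<ge> n" and c: "i \<le> c" "offset (H j) c \<le> offset (H j) i + t"
    and z: "z = offset (H j) i + t - offset (H j) c" "(c - i) * x \<le> z" "z < H j"
    and top: "offset (H j) (i + x) + t < H (Suc j)"
  shows "level_val f (Suc j) (offset (H j) (i + x) + t) = level_val f j (z - (c - i) * x)"
proof -
  have eq: "offset (H j) (i + x) + t = offset (H j) (c + x) + (z - (c - i) * x)"
    using offset_add[of "H j" i "c - i" x] c z by simp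
  then have "offset (H j) (c + x) < H (Suc j)" using top by linarith
  then have "c + x < r j" by (rule offset_less_H_Suc)
  then show ?thesis unfolding eq using z by (intro level_val_refine[OF f j]) auto
qed

lemma column_ge: "offset (H j) i \<le> v \<Longrightarrow> i \<le> column_of (H j) v"
  using column_less[OF H_pos, of v j] offset_mono[of "Suc (column_of (H j) v)" i "H j"] by (meson leD le_trans not_less_eq_eq)

text \<open>A column has at least \<open>H j\<close> levels, so fewer than \<open>H j\<close>
  further steps cross at most one boundary. This is the source of the factors 2, and 4 for pairs of
  columns, in the estimates below.\<close>

lemma column_near:
  assumes "s < H j"
  shows "column_of (H j) (u + s) = column_of (H j) u \<or> column_of (H j) (u + s) = Suc (column_of (H j) u)"
proof -
  define c where "c = column_of (H j) u"
  have 1: "u < offset (H j) (Suc c)" "offset (H j) c \<le> u"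
    unfolding c_def using column_less column_le H_pos by auto
  show ?thesis
  proof (cases "u + s < offset (H j) (Suc c)")
    case True
    then show ?thesis using 1 column_unique[of "H j" c "u + s"] by (simp add: c_def)
  next
    case False
    moreover have "u + s < offset (H j) (Suc (Suc c))" using 1 assms by (simp add: offset_Suc)
    ultimately show ?thesis using column_unique[of "H j" "Suc c" "u + s"] by (simp add: c_def)
  qed
qed

abbreviation shifted_val :: "('a \<Rightarrow> real) \<Rightarrow> nat \<Rightarrow> nat \<Rightarrow> nat \<Rightarrow> nat \<Rightarrow> real" where
  "shifted_val f j m i s \<equiv> level_val f (Suc j) (offset (H j) i + (s + m))"

text \<open>The set of admissible columns depends on \<open>s\<close>. Since columns are at least
  \<open>H j\<close> apart, it differs from a common initial segment by at most one column, and one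
  column weighs \<open>w (Suc j) * H j \<le> 1 / r j\<close>.\<close>

lemma column_sum_split:
  assumes f: "level_fun n f"
  obtains N where "N \<le> r j" "\<And>i. i < N \<Longrightarrow> offset (H j) i + H j + m \<le> H (Suc j)"
    "column_sum f j m \<le> 1 / real (r j) + w (Suc j) * (\<Sum>s<H j. \<bar>\<Sum>i<N. shifted_val f j m i s\<bar>)"
proof -
  note f1 = level_funD(3)[OF f]
  define N where "N = (LEAST N. N \<ge> r j \<or> offset (H j) N + H j + m > H (Suc j))"
  have N: "N \<ge> r j \<or> offset (H j) N + H j + m > H (Suc j)"
    unfolding N_def by (rule LeastI[of _ "r j"]) simp
  have N_le: "N \<le> r j" unfolding N_def by (rule Least_le) simp
  have below: "i < r j \<and> offset (H j) i + H j + m \<le> H (Suc j)" if "i < N" for i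
    using not_less_Least[of i, OF that[unfolded N_def]] by auto
  have above: "i \<le> N" if "i < r j" "offset (H j) i + s + m < H (Suc j)" for i s
  proof (rule ccontr)
    assume "\<not> i \<le> N"
    then have "offset (H j) (Suc N) \<le> offset (H j) i" by (intro offset_mono) auto
    then show False using N \<open>\<not> i \<le> N\<close> that by (auto simp: offset_Suc)
  qed
  have "\<bar>\<Sum>i | i < r j \<and> offset (H j) i + s + m < H (Suc j). level_val f (Suc j) (offset (H j) i + s + m)\<bar>
      \<le> \<bar>\<Sum>i<N. shifted_val f j m i s\<bar> + 1" if s: "s < H j" for s
  proof -
    let ?I = "{i. i < r j \<and> offset (H j) i + s + m < H (Suc j)}"
    have sub: "{..<N} \<subseteq> ?I" using below s by fastforce
    have "(\<Sum>i\<in>?I. shifted_val f j m i s) = (\<Sum>i\<in>?I - {..<N}. shifted_val f j m i s) + (\<Sum>i<N. shifted_val f j m i s)"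
      using sub by (intro sum.subset_diff) auto
    moreover have "\<bar>\<Sum>i\<in>?I - {..<N}. shifted_val f j m i s\<bar> \<le> real (card (?I - {..<N})) * 1"
      by (rule sum_abs_le_card) (rule f1)
    moreover have "card (?I - {..<N}) \<le> card {N}"
      using above[of _ s] by (intro card_mono) fastforce+
    ultimately show ?thesis by (simp add: add.assoc)
  qed
  then have "column_sum f j m \<le> w (Suc j) * (\<Sum>s<H j. \<bar>\<Sum>i<N. shifted_val f j m i s\<bar> + 1)"
    unfolding column_sum_def using w_pos[of "Suc j"] by (intro mult_left_mono sum_mono) auto
  also have "\<dots> = w (Suc j) * real (H j) + w (Suc j) * (\<Sum>s<H j. \<bar>\<Sum>i<N. shifted_val f j m i s\<bar>)"
    by (simp add: sum.distrib distrib_left)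
  also have "w (Suc j) * real (H j) \<le> 1 / real (r j)"
    using Hw_le_1[of j] r_pos[of j] by (simp add: w_Suc[of j] field_simps)
  finally show ?thesis using below N_le that by simp
qed

text \<open>Two kinds of levels are lost: the lowest \<open>B\<close> of column \<open>c\<close>,
  from which sliding would run out of the column, and its \<open>c < r j\<close> spacers.\<close>

lemma card_off_column:
  assumes "c < r j"
  shows "card {s. s < H j \<and> column_of (H j) (v + s) = c \<and>
      \<not> (B \<le> v + s - offset (H j) c \<and> v + s - offset (H j) c < H j)} \<le> B + r j"
proof -
  let ?S = "{s. s < H j \<and> column_of (H j) (v + s) = c \<and> \<not> (B \<le> v + s - offset (H j) c \<and> v + s - offset (H j) c < H j)}"
  let ?z = "\<lambda>s. v + s - offset (H j) c"
  have col: "offset (H j) c \<le> v + s" "v + s < offset (H j) c + H j + c" if "s \<in> ?S" for s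
    using that column_le[OF H_pos, of j "v + s"] column_less[OF H_pos, of "v + s" j] by (auto simp: offset_Suc)
  have inj: "inj_on ?z ?S"
  proof (rule inj_onI)
    fix s s' assume "s \<in> ?S" "s' \<in> ?S" "?z s = ?z s'"
    then show "s = s'" using col(1)[of s] col(1)[of s'] by linarith
  qed
  have "?z s \<in> {..<B} \<union> {H j..<H j + r j}" if "s \<in> ?S" for s
  proof -
    have "?z s < H j + r j" using col[OF that] assms by linarith
    then show ?thesis using that by auto
  qed
  then have "?z ` ?S \<subseteq> {..<B} \<union> {H j..<H j + r j}" by blast
  then have "card (?z ` ?S) \<le> card ({..<B} \<union> {H j..<H j + r j})" by (intro card_mono) auto
  also have "\<dots> \<le> B + r j" by (rule order_trans[OF card_Un_le]) simp
  finally show ?thesis using inj by (simp add: card_image)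
qed

text \<open>Starting levels are sorted by the column they reach from column \<open>i\<close>; on
  each of the two classes the displacement is constant throughout the window. The parameter
  \<open>h\<close> discards the top \<open>h\<close> starting levels. If
  \<open>m \<le> H j + h\<close>, these include all that would reach displacement 2, so that a bound
  on \<open>avg f 1\<close> suffices; larger times are treated with \<open>h = 0\<close>.\<close>

lemma window_le:
  assumes f: "level_fun n f" and j: "j \<ge> n" and m: "H j \<le> m" and b: "b > 0"
    and top: "\<And>x. x < b \<Longrightarrow> offset (H j) (i + x) + H j + m \<le> H (Suc j)"
    and A: "A \<ge> 0" "\<And>k. k \<ge> 1 \<Longrightarrow> k * H j + h < H j + m \<Longrightarrow> avg f k b \<le> A"
  shows "w j * (\<Sum>s<H j. \<bar>\<Sum>x<b. shifted_val f j m (i + x) s\<bar>)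
    \<le> real b * (w j * real h + 2 * (A + w j * (2 * real m * real b / real (H j) + real (r j))))"
proof -
  note f1 = level_funD(3)[OF f]
  define P where "P = offset (H j)"
  define W where "W s = \<bar>\<Sum>x<b. shifted_val f j m (i + x) s\<bar>" for s
  define c1 where "c1 = column_of (H j) (P i + m)"
  define S where "S c = {s. s < H j - h \<and> column_of (H j) (P i + (s + m)) = c}" for c
  define E where "E = A + w j * (2 * real m * real b / real (H j) + real (r j))"
  have W_le: "W s \<le> real b" for s
    using sum_abs_le_card[of "{..<b}" "\<lambda>x. shifted_val f j m (i + x) s" 1] f1 by (simp add: W_def)
  have in_column: "w j * (\<Sum>s\<in>S c. W s) \<le> real b * E" for c
  proof (cases "S c = {}")
    case True
    then show ?thesis using A w_pos[of j] by (simp add: E_def less_imp_le)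
  next
    case False
    define k where "k = c - i"
    define z where "z s = P i + (s + m) - P c" for s
    have Pc: "P c \<le> P i + (s + m)" "P i + (s + m) < P (Suc c)" if "s \<in> S c" for s
      using that column_le[OF H_pos, of j "P i + (s + m)"] column_less[OF H_pos, of "P i + (s + m)" j]
      by (auto simp: S_def P_def)
    have ic: "i \<le> c"
      using False column_ge[of j i "P i + (_ + m)"] by (auto simp: S_def P_def)
    have Pk: "P i + k * H j \<le> P c" using offset_add_ge[of "H j" i k] ic by (simp add: k_def P_def)
    have kH: "k * H j \<le> s + m" if "s \<in> S c" for s using Pk Pc[OF that] by linarith
    have cr: "c < r j"
    proof -
      obtain s where s: "s \<in> S c" using False by blast
      then have "s < H j - h" by (simp add: S_def)
      then have "s < H j" by linarith
      then have "P c < H (Suc j)" using Pc(1)[OF s] top[OF b] by (simp add: P_def)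
      then show ?thesis unfolding P_def by (rule offset_less_H_Suc)
    qed
    have inj: "inj_on z (S c)" using Pc(1) by (auto simp: inj_on_def z_def) (metis Pc(1) add_diff_inverse_nat add_right_cancel leD add_left_cancel)
    define G where "G = {s \<in> S c. k * b \<le> z s \<and> z s < H j}"
    have finS: "finite (S c)" by (simp add: S_def)
    \<comment> \<open>From \<open>k * H j \<le> s + m\<close> and \<open>s < H j \<le> m\<close>
      follows \<open>k \<le> 2 * m / H j\<close>.\<close>
    have kb: "real (k * b) \<le> 2 * real m * real b / real (H j)"
    proof -
      obtain s where s: "s \<in> S c" using False by blast
      then have "s < H j - h" by (simp add: S_def)
      then have "k * H j \<le> 2 * m" using kH[OF s] m by linarith
      then have "real k * real (H j) \<le> 2 * real m" by (metis of_nat_le_iff of_nat_mult of_nat_numeral)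
      then show ?thesis using H_pos[of j] mult_right_mono[of "real k * real (H j)" "2 * real m" "real b"]
        by (simp add: field_simps)
    qed
    have "S c - G \<subseteq> {s. s < H j \<and> column_of (H j) (P i + m + s) = c \<and>
        \<not> (k * b \<le> P i + m + s - offset (H j) c \<and> P i + m + s - offset (H j) c < H j)}"
      by (auto simp: S_def G_def z_def P_def ac_simps)
    then have "card (S c - G) \<le> k * b + r j"
      using card_off_column[OF cr] by (rule order_trans[OF card_mono, rotated]) simp
    then have bad: "(\<Sum>s\<in>S c - G. W s) \<le> real b * (real (k * b) + real (r j))"
    proof -
      assume *: "card (S c - G) \<le> k * b + r j"
      have "(\<Sum>s\<in>S c - G. W s) \<le> real (card (S c - G)) * real b" by (rule sum_bounded_above) (rule W_le)
      also have "\<dots> \<le> real (k * b + r j) * real b" using * by (intro mult_right_mono) (simp_all only: of_nat_le_iff of_nat_0_le_iff)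
      finally show ?thesis by (simp add: mult.commute)
    qed
    have good: "w j * (\<Sum>s\<in>G. W s) \<le> real b * A"
    proof (cases "G = {}")
      case True
      then show ?thesis using A by simp
    next
      case False
      then obtain s where s: "s \<in> G" by blast
      \<comment> \<open>A point still in column \<open>i\<close> would sit at height
        \<open>s + m \<ge> H j\<close> there, hence among the spacers, which \<open>G\<close>
        excludes.\<close>
      have k1: "k \<ge> 1"
      proof (rule ccontr)
        assume "\<not> k \<ge> 1"
        then have "c = i" using ic by (simp add: k_def)
        then show False using s m by (simp add: G_def z_def)
      qed
      have "k * H j + h < H j + m" using kH[of s] s by (auto simp: G_def S_def)
      note Ak = A(2)[OF k1 this]
      have "(\<Sum>s\<in>G. W s) = (\<Sum>s\<in>G. \<bar>\<Sum>x<b. level_val f j (z s - k * x)\<bar>)"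
      proof (rule sum.cong[OF refl])
        fix s assume s: "s \<in> G"
        then have sc: "s \<in> S c" "k * b \<le> z s" "z s < H j" by (auto simp: G_def)
        have "shifted_val f j m (i + x) s = level_val f j (z s - k * x)" if x: "x < b" for x
          unfolding k_def
        proof (rule level_val_slide[OF f j ic])
          show "offset (H j) c \<le> offset (H j) i + (s + m)" using Pc(1)[OF sc(1)] by (simp add: P_def)
          have "k * x \<le> k * b" using x by simp
          then show "(c - i) * x \<le> z s" using sc(2) unfolding k_def by linarith
          have "s < H j - h" using sc(1) by (simp add: S_def)
          then show "offset (H j) (i + x) + (s + m) < H (Suc j)" using top[OF x] by linarith
        qed (use sc(3) in \<open>auto simp: z_def P_def\<close>)
        then show "W s = \<bar>\<Sum>x<b. level_val f j (z s - k * x)\<bar>" by (simp add: W_def)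
      qed
      also have "\<dots> = (\<Sum>z\<in>z ` G. \<bar>\<Sum>x<b. level_val f j (z - k * x)\<bar>)"
        using inj_on_subset[OF inj, of G] by (simp add: sum.reindex G_def)
      also have "w j * \<dots> \<le> real b * avg f k b"
      proof (rule sum_level_val_down_le_avg[OF f j _ b])
        fix v assume "v \<in> z ` G"
        then have "k * b \<le> v" "v < H j" by (auto simp: G_def)
        moreover have "k * (b - 1) \<le> k * b" by simp
        ultimately show "k * (b - 1) \<le> v \<and> v < H j" by linarith
      qed
      finally have "w j * (\<Sum>s\<in>G. W s) \<le> real b * avg f k b" .
      also have "\<dots> \<le> real b * A" using Ak by (intro mult_left_mono) auto
      finally show ?thesis .
    qed
    have "(\<Sum>s\<in>S c. W s) = (\<Sum>s\<in>S c - G. W s) + (\<Sum>s\<in>G. W s)"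
      using finS by (intro sum.subset_diff) (auto simp: G_def)
    then have "w j * (\<Sum>s\<in>S c. W s) \<le> w j * (real b * (real (k * b) + real (r j))) + real b * A"
      using good mult_left_mono[OF bad, of "w j"] w_pos[of j] by (simp add: distrib_left)
    also have "\<dots> \<le> w j * (real b * (2 * real m * real b / real (H j) + real (r j))) + real b * A"
      using kb w_pos[of j] by (intro add_right_mono mult_left_mono) auto
    also have "\<dots> = real b * E" by (simp add: E_def algebra_simps)
    finally show ?thesis .
  qed
  have sub: "{..<H j} \<subseteq> {H j - h..<H j} \<union> S c1 \<union> S (Suc c1)"
  proof
    fix s assume "s \<in> {..<H j}"
    then show "s \<in> {H j - h..<H j} \<union> S c1 \<union> S (Suc c1)"
      using column_near[of s j "P i + m"] by (auto simp: S_def c1_def ac_simps)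
  qed
  have W0: "W s \<ge> 0" for s by (simp add: W_def)
  have fin: "finite (S c)" for c by (simp add: S_def)
  have "(\<Sum>s<H j. W s) \<le> (\<Sum>s\<in>{H j - h..<H j} \<union> S c1 \<union> S (Suc c1). W s)"
    using W0 fin sub by (intro sum_mono2) auto
  also have "\<dots> \<le> (\<Sum>s\<in>{H j - h..<H j}. W s) + (\<Sum>s\<in>S c1. W s) + (\<Sum>s\<in>S (Suc c1). W s)"
  proof -
    have "sum W (A \<union> B) \<le> sum W A + sum W B" if "finite A" "finite B" for A B
      using that W0 by (simp add: sum_Un sum_nonneg)
    then show ?thesis using fin by (meson add_right_mono finite_Un finite_atLeastLessThan order_trans)
  qed
  also have "(\<Sum>s\<in>{H j - h..<H j}. W s) \<le> real h * real b"
  proof -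
    have "(\<Sum>s\<in>{H j - h..<H j}. W s) \<le> real (card {H j - h..<H j}) * real b"
      by (rule sum_bounded_above) (rule W_le)
    also have "\<dots> \<le> real h * real b" by (intro mult_right_mono) auto
    finally show ?thesis .
  qed
  finally have "w j * (\<Sum>s<H j. W s) \<le> w j * (real h * real b) + w j * (\<Sum>s\<in>S c1. W s) + w j * (\<Sum>s\<in>S (Suc c1). W s)"
    using w_pos[of j] by (simp add: distrib_left[symmetric])
  also have "\<dots> \<le> w j * (real h * real b) + real b * E + real b * E"
    by (intro add_mono in_column order_refl)
  also have "\<dots> = real b * (w j * real h + 2 * E)" by (simp add: algebra_simps)
  finally show ?thesis by (simp add: W_def E_def)
qed

text \<open>Windows of length \<open>b\<close> cover all but fewer than \<open>b\<close> columns,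
  whence \<open>b / r j\<close>. The length is left free: it is constant for times that are bounded
  multiples of the height and proportional to \<open>r j\<close> for the larger times below the
  threshold.\<close>

lemma column_sum_le_avg:
  assumes f: "level_fun n f" and j: "j \<ge> n" and m: "H j \<le> m" and b: "b > 0"
    and A: "A \<ge> 0" "\<And>k. k \<ge> 1 \<Longrightarrow> k * H j + h < H j + m \<Longrightarrow> avg f k b \<le> A"
  shows "column_sum f j m \<le> 1 / real (r j) + real b / real (r j) + real h / real (H j) +
    2 * (A + (2 * real m * real b / real (H j) + real (r j)) / real (H j))"
proof -
  note f1 = level_funD(3)[OF f]
  obtain N where N: "N \<le> r j" "\<And>i. i < N \<Longrightarrow> offset (H j) i + H j + m \<le> H (Suc j)"
    and le: "column_sum f j m \<le> 1 / real (r j) + w (Suc j) * (\<Sum>s<H j. \<bar>\<Sum>i<N. shifted_val f j m i s\<bar>)"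
    using column_sum_split[OF f, of j m] by metis
  define C where "C = w j * real h + 2 * (A + w j * (2 * real m * real b / real (H j) + real (r j)))"
  have C0: "C \<ge> 0" using A w_pos[of j] by (simp add: C_def less_imp_le)
  have "w j * (\<Sum>s<H j. \<bar>\<Sum>i<N. shifted_val f j m i s\<bar>)
      \<le> w j * (\<Sum>s<H j. (\<Sum>q<N div b. \<bar>\<Sum>x<b. shifted_val f j m (q * b + x) s\<bar>) + real b)"
    using w_pos[of j] b f1 by (intro mult_left_mono sum_mono sum_windows) (auto simp: less_imp_le)
  also have "\<dots> = (\<Sum>q<N div b. w j * (\<Sum>s<H j. \<bar>\<Sum>x<b. shifted_val f j m (q * b + x) s\<bar>)) + real b * (real (H j) * w j)"
    by (simp add: sum.distrib distrib_left sum_distrib_left sum.swap[of _ "{..<N div b}"])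
  also have "\<dots> \<le> (\<Sum>q<N div b. real b * C) + real b * 1"
  proof (intro add_mono sum_mono mult_left_mono Hw_le_1)
    fix q assume "q \<in> {..<N div b}"
    then have "(q + 1) * b \<le> N div b * b" by (intro mult_le_mono1) auto
    also have "\<dots> \<le> N" by simp
    finally have q: "q * b + b \<le> N" by simp
    show "w j * (\<Sum>s<H j. \<bar>\<Sum>x<b. shifted_val f j m (q * b + x) s\<bar>) \<le> real b * C"
      unfolding C_def
      by (rule window_le[OF f j m b _ A]) (use q in \<open>auto intro!: N(2)\<close>)
  qed auto
  also have "\<dots> \<le> real (r j) * C + real b"
  proof -
    have "real (N div b) * real b \<le> real N"
      by (metis div_times_less_eq_dividend of_nat_le_iff of_nat_mult)
    then have "real (N div b) * real b * C \<le> real (r j) * C"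
      using C0 N(1) by (intro mult_right_mono) auto
    then show ?thesis by (simp add: mult.assoc)
  qed
  finally have "w j * (\<Sum>s<H j. \<bar>\<Sum>i<N. shifted_val f j m i s\<bar>) / real (r j) \<le> (real (r j) * C + real b) / real (r j)"
    by (intro divide_right_mono) auto
  then have "w (Suc j) * (\<Sum>s<H j. \<bar>\<Sum>i<N. shifted_val f j m i s\<bar>) \<le> C + real b / real (r j)"
    using r_pos[of j] by (simp add: w_Suc[of j] add_divide_distrib)
  moreover have "C \<le> real h / real (H j) + 2 * (A + (2 * real m * real b / real (H j) + real (r j)) / real (H j))"
  proof -
    have "w j * u \<le> u / real (H j)" if "u \<ge> 0" for u
      using mult_right_mono[OF w_le[of j] that] by simp
    then show ?thesis unfolding C_def by (intro add_mono mult_left_mono order_refl) auto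
  qed
  ultimately show ?thesis using le by linarith
qed

end

section \<open>Uniform averages\<close>

lemma exists_multiple_between:
  fixes d u :: nat
  assumes "d > 0"
  obtains q where "u \<le> d * q" "d * q < u + d"
proof
  have "d * ((u + d - 1) div d) + (u + d - 1) mod d = u + d - 1" by simp
  moreover have "(u + d - 1) mod d < d" using assms by simp
  ultimately show "u \<le> d * ((u + d - 1) div d)" "d * ((u + d - 1) div d) < u + d"
    using assms by linarith+
qed

context stair_system
begin

lemma exists_stage:
  assumes "H P \<le> k"
  obtains p where "P \<le> p" "H p \<le> k" "k < H (Suc p)"
proof -
  define p where "p = (LEAST p. k < H (Suc p))"
  have "k < H (Suc k)" using H_ge[of "Suc k"] by simp
  then have 1: "k < H (Suc p)" unfolding p_def by (rule LeastI)
  have 2: "P \<le> p"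
  proof (rule ccontr)
    assume "\<not> P \<le> p"
    then have "H (Suc p) \<le> H P" by (simp add: strict_mono_less_eq[OF H_strict_mono])
    then show False using 1 assms by simp
  qed
  have "H p \<le> k"
  proof (cases p)
    case 0
    then show ?thesis using 2 assms by simp
  next
    case (Suc q)
    then have "\<not> k < H (Suc q)" using not_less_Least[of q "\<lambda>p. k < H (Suc p)"] by (simp add: p_def)
    then show ?thesis using Suc by simp
  qed
  then show ?thesis using 1 2 that by blast
qed

lemma H_Suc_le: "r j \<le> H j \<Longrightarrow> H (Suc j) \<le> 2 * r j * H j"
proof -
  assume "r j \<le> H j"
  then have "r j * (H j + r j) \<le> r j * (2 * H j)" by (intro mult_le_mono2) simp
  moreover have "H (Suc j) \<le> r j * (H j + r j)"
    using offset_add_le[of 0 "r j" "r j" "H j"] by (simp add: H_Suc)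
  moreover have "r j * (2 * H j) = 2 * r j * H j" by simp
  ultimately show ?thesis by linarith
qed

lemma r_le_H: "\<forall>\<^sub>F j in sequentially. r j \<le> H j"
proof -
  have "\<forall>\<^sub>F j in sequentially. real (r j) / real (H j) < 1"
    using order_tendstoD(2)[OF r_over_H, of 1] by simp
  then show ?thesis
    by eventually_elim (use H_pos in \<open>auto simp: field_simps\<close>)
qed

lemma inverse_r_tendsto: "(\<lambda>j. c / real (r j)) \<longlonglongrightarrow> 0"
  by (rule filterlim_compose[OF _ r_top]) real_asymp

lemma inverse_H_tendsto: "(\<lambda>j. c / real (H j)) \<longlonglongrightarrow> 0"
  by (rule filterlim_compose[OF _ H_top]) real_asymp

lemma eventually_avg_le:
  assumes "\<And>k. k \<in> K \<Longrightarrow> avg f k \<longlonglongrightarrow> 0" "finite K" "e > 0"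
  shows "\<forall>\<^sub>F b in sequentially. \<forall>k\<in>K. avg f k b \<le> e"
  using assms(2)
proof (rule eventually_ball_finite, intro ballI)
  fix k assume "k \<in> K"
  then have "\<forall>\<^sub>F b in sequentially. avg f k b < e" using assms order_tendstoD(2) by blast
  then show "\<forall>\<^sub>F b in sequentially. avg f k b \<le> e" by (rule eventually_mono) simp
qed

section \<open>Bootstrapping from step 1 to all steps\<close>

context
  fixes n :: nat and f :: "'a \<Rightarrow> real"
  assumes f: "level_fun n f" and f0: "(\<integral>x. f x \<partial>M) = 0"
begin

text \<open>Averages with steps up to \<open>K\<close> control the times whose displacement is at
  most \<open>K\<close> once \<open>h\<close> levels are discarded, which is what the last condition
  on \<open>m\<close> expresses. This serves twice: with \<open>K = 1\<close>, when only ergodicity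
  is known, and later with arbitrary \<open>K\<close>. Since \<open>b\<close> is fixed before
  \<open>p\<close>, all terms carrying \<open>1 / r p\<close>, \<open>1 / H p\<close> or
  \<open>r p / H p\<close> vanish.\<close>

lemma corr_eventually_le:
  assumes K: "\<And>k. 1 \<le> k \<Longrightarrow> k \<le> K \<Longrightarrow> avg f k \<longlonglongrightarrow> 0" and e: "e > 0"
  shows "\<forall>\<^sub>F p in sequentially. \<forall>m. H p \<le> m \<and> m < H (Suc p) \<and> m \<le> C * H p \<and> H p + m \<le> Suc K * H p + h \<longrightarrow> \<bar>corr f f m\<bar> \<le> e"
proof -
  have "\<forall>\<^sub>F b in sequentially. (\<forall>k\<in>{1..K}. avg f k b \<le> e / 8) \<and> b > 0"
    using K e by (intro eventually_conj eventually_avg_le eventually_gt_at_top) auto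
  then obtain b where b: "\<And>k. 1 \<le> k \<Longrightarrow> k \<le> K \<Longrightarrow> avg f k b \<le> e / 8" "b > 0"
    using eventually_happens'[OF sequentially_bot] by (metis (no_types, lifting) atLeastAtMost_iff)
  define E where "E p = stage_error f p + (1 / real (r p) + real b / real (r p) + real h / real (H p) +
    2 * (e / 8 + (2 * real C * real b / real (H p) + real (r p) / real (H p))))" for p
  have "E \<longlonglongrightarrow> 0 + (0 + 0 + 0 + 2 * (e / 8 + (0 + 0)))"
    unfolding E_def by (intro tendsto_intros stage_error_tendsto[OF f f0] inverse_r_tendsto inverse_H_tendsto r_over_H)
  from order_tendstoD(2)[OF this, of e] have "\<forall>\<^sub>F p in sequentially. E p < e" using e by simp
  then show ?thesis
    using eventually_ge_at_top[of n]
  proof eventually_elim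
    case (elim p)
    show ?case
    proof (intro allI impI, elim conjE)
      fix m assume m: "H p \<le> m" "m < H (Suc p)" "m \<le> C * H p" "H p + m \<le> Suc K * H p + h"
      have A: "avg f k b \<le> e / 8" if "k \<ge> 1" "k * H p + h < H p + m" for k
      proof (rule b(1)[OF that(1)])
        have "k * H p < Suc K * H p" using that(2) m(4) by linarith
        then have "k < Suc K" by (simp only: mult_less_cancel2)
        then show "k \<le> K" by simp
      qed
      have "\<bar>corr f f m\<bar> \<le> stage_error f p + column_sum f p m"
        by (rule corr_le_column_sum[OF f f elim(2) m(2)])
      also have "column_sum f p m \<le> 1 / real (r p) + real b / real (r p) + real h / real (H p) +
         2 * (e / 8 + (2 * real m * real b / real (H p) + real (r p)) / real (H p))"
        by (rule column_sum_le_avg[OF f elim(2) m(1) b(2)]) (use e A in auto)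
      also have "stage_error f p + \<dots> \<le> E p"
      proof -
        have "real m \<le> real C * real (H p)" using m(3) by (metis of_nat_le_iff of_nat_mult)
        then have "2 * real m * real b / real (H p) \<le> 2 * real C * real b"
          using H_pos[of p] mult_right_mono[of "real m" "real C * real (H p)" "real b"] by (simp add: field_simps)
        then have "(2 * real m * real b / real (H p) + real (r p)) / real (H p) \<le> (2 * real C * real b + real (r p)) / real (H p)"
          by (intro divide_right_mono) auto
        then show ?thesis unfolding E_def by (simp add: add_divide_distrib)
      qed
      finally show "\<bar>corr f f m\<bar> \<le> e" using elim(1) by simp
    qed
  qed
qed

lemma corr_near_height:
  assumes "e > 0"
  shows "\<forall>\<^sub>F p in sequentially. \<forall>m. H p \<le> m \<and> m \<le> H p + h \<longrightarrow> \<bar>corr f f m\<bar> \<le> e"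
proof -
  have "avg f k \<longlonglongrightarrow> 0" if "1 \<le> k" "k \<le> 1" for k
    using that avg_1_tendsto[OF f f0] by (metis le_antisym)
  then have "\<forall>\<^sub>F p in sequentially. \<forall>m. H p \<le> m \<and> m < H (Suc p) \<and> m \<le> 2 * H p \<and> H p + m \<le> Suc 1 * H p + h \<longrightarrow> \<bar>corr f f m\<bar> \<le> e"
    using assms by (intro corr_eventually_le) auto
  then show ?thesis
    using eventually_gt_at_top[of h]
  proof eventually_elim
    case (elim p)
    then show ?case using H_ge[of p] H_Suc_ge2[of p] by auto
  qed
qed

text \<open>A greedy choice. Given \<open>S\<close> bounded by \<open>u\<close>, the next time
  \<open>q\<close> is placed so far out that every \<open>d * (q - l)\<close> falls between
  \<open>H p\<close> and \<open>H p + d * u + d\<close>. The length of this range depends on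
  \<open>S\<close> and \<open>d\<close> only, so the stage \<open>p\<close> can be chosen after
  it.\<close>

lemma exists_uncorrelated_times:
  assumes d: "d > 0" and e: "e > 0"
  shows "\<exists>S. finite S \<and> card S = c \<and> (\<forall>l\<in>S. \<forall>l'\<in>S. l' < l \<longrightarrow> \<bar>corr f f (d * (l - l'))\<bar> \<le> e)"
proof (induction c)
  case 0
  show ?case by (rule exI[of _ "{}"]) simp
next
  case (Suc c)
  then obtain S where S: "finite S" "card S = c" "\<And>l l'. l \<in> S \<Longrightarrow> l' \<in> S \<Longrightarrow> l' < l \<Longrightarrow> \<bar>corr f f (d * (l - l'))\<bar> \<le> e"
    by blast
  obtain u where u: "\<And>l. l \<in> S \<Longrightarrow> l \<le> u" using S(1) by (meson finite_nat_set_iff_bounded_le)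
  obtain p where p: "\<And>m. H p \<le> m \<Longrightarrow> m \<le> H p + (d * u + d) \<Longrightarrow> \<bar>corr f f m\<bar> \<le> e"
    using eventually_happens'[OF sequentially_bot corr_near_height[OF e, of "d * u + d"]] by blast
  obtain q where q: "H p + d * u \<le> d * q" "d * q < H p + d * u + d" by (rule exists_multiple_between[OF d])
  have "d * u < d * q" using q(1) H_pos[of p] by linarith
  then have uq: "u < q" by simp
  have "\<bar>corr f f (d * (q - l))\<bar> \<le> e" if "l \<in> S" for l
  proof (rule p)
    have "d * l \<le> d * u" using u[OF that] by simp
    then show "H p \<le> d * (q - l)" "d * (q - l) \<le> H p + (d * u + d)"
      unfolding diff_mult_distrib2 using q by linarith+
  qed
  moreover have "q \<notin> S" using u uq leD by blast
  moreover have "\<not> q < l" if "l \<in> S" for l using u[OF that] uq by simp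
  ultimately show ?case using S by (intro exI[of _ "insert q S"]) auto
qed

lemma sqrt_inverse_le:
  assumes e: "e > 0" and c: "real c \<ge> 8 / e\<^sup>2"
  shows "sqrt (1 / real c + e\<^sup>2 / 8) \<le> e / 2"
proof -
  have "real c > 0" using e c by (smt (verit) divide_pos_pos zero_less_power)
  then have "1 / real c \<le> e\<^sup>2 / 8" using e c by (simp add: field_simps)
  then have "sqrt (1 / real c + e\<^sup>2 / 8) \<le> sqrt ((e / 2)\<^sup>2)"
    by (intro real_sqrt_le_mono) (simp add: power_divide)
  then show ?thesis using e by simp
qed

text \<open>Van der Corput with the greedily chosen times; the result is total ergodicity of
  \<open>T\<close>, restricted to level functions.\<close>

lemma avg_tendsto:
  assumes d: "d > 0"
  shows "avg f d \<longlonglongrightarrow> 0"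
proof (rule tendstoI)
  fix e :: real assume e: "e > 0"
  define c where "c = nat \<lceil>8 / e\<^sup>2\<rceil>"
  have c: "real c \<ge> 8 / e\<^sup>2" unfolding c_def by linarith
  have "real c > 0" using e c by (smt (verit) divide_pos_pos zero_less_power)
  obtain S where S: "finite S" "card S = c" "\<And>l l'. l \<in> S \<Longrightarrow> l' \<in> S \<Longrightarrow> l' < l \<Longrightarrow> \<bar>corr f f (d * (l - l'))\<bar> \<le> e\<^sup>2 / 8"
    using exists_uncorrelated_times[OF d, of "e\<^sup>2 / 8" c] e by auto
  obtain u where u: "\<And>l. l \<in> S \<Longrightarrow> l \<le> u" using S(1) by (meson finite_nat_set_iff_bounded_le)
  have "(\<lambda>N. 2 * real u / real N) \<longlonglongrightarrow> 0" by real_asymp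
  then have "\<forall>\<^sub>F N in sequentially. 2 * real u / real N < e / 2"
    using e by (intro order_tendstoD(2)) auto
  then show "\<forall>\<^sub>F N in sequentially. dist (avg f d N) 0 < e"
    using eventually_gt_at_top[of 0]
  proof eventually_elim
    case (elim N)
    have "avg f d N \<le> sqrt (1 / real (card S) + e\<^sup>2 / 8) + 2 * real u / real N"
      using level_funD(1,2)[OF f] S u elim \<open>real c > 0\<close>
      by (intro avg_le_van_der_Corput) auto
    then show ?case using sqrt_inverse_le[OF e c] elim avg_nonneg[of f d N] S(2) by (simp add: dist_real_def)
  qed
qed

text \<open>All steps are now available, so \<open>K = C\<close> is allowed; eventually
  \<open>C < r p\<close>, which places these times below the next height.\<close>

lemma corr_bounded_multiple:
  assumes "e > 0"
  shows "\<forall>\<^sub>F p in sequentially. \<forall>m. H p \<le> m \<and> m \<le> C * H p \<longrightarrow> \<bar>corr f f m\<bar> \<le> e"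
proof -
  have "\<forall>\<^sub>F p in sequentially. \<forall>m. H p \<le> m \<and> m < H (Suc p) \<and> m \<le> C * H p \<and> H p + m \<le> Suc C * H p + 0 \<longrightarrow> \<bar>corr f f m\<bar> \<le> e"
    using avg_tendsto assms by (intro corr_eventually_le) auto
  moreover have "\<forall>\<^sub>F p in sequentially. C < r p"
    by (rule eventually_compose_filterlim[OF eventually_gt_at_top r_top])
  ultimately show ?thesis
  proof eventually_elim
    case (elim p)
    have "C * H p < r p * H p" using elim(2) H_pos[of p] by simp
    then have "C * H p < H (Suc p)" using H_Suc_ge[of p] by linarith
    then show ?case using elim(1) by auto
  qed
qed

text \<open>Passing from \<open>k\<close> to the multiple \<open>k * q\<close> costs shifts of
  length up to \<open>q * c\<close>. Since \<open>q \<le> 4 * r p\<close> while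
  \<open>H p \<le> k \<le> C * N\<close>, this cost divided by \<open>N\<close> is a bounded
  multiple of \<open>r p / H p\<close>, which explains the admissible range of \<open>k\<close>. The
  finitely many \<open>k \<le> H P\<close> are covered by plain convergence.\<close>

lemma avg_uniform:
  assumes e: "e > 0"
  shows "\<forall>\<^sub>F N in sequentially. \<forall>k. 1 \<le> k \<and> k \<le> C * N \<longrightarrow> avg f k N \<le> e"
proof -
  define c where "c = nat \<lceil>8 / e\<^sup>2\<rceil>"
  have c: "real c \<ge> 8 / e\<^sup>2" unfolding c_def by linarith
  then have c0: "real c > 0" using e by (smt (verit) divide_pos_pos zero_less_power)
  have "(\<lambda>p. 8 * real c * real C * (real (r p) / real (H p))) \<longlonglongrightarrow> 0"
    by (rule tendsto_mult_right_zero[OF r_over_H])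
  then have "\<forall>\<^sub>F p in sequentially. 8 * real c * real C * (real (r p) / real (H p)) < e / 2"
    using e by (intro order_tendstoD(2)) auto
  moreover have "\<forall>\<^sub>F p in sequentially. \<forall>m. H p \<le> m \<and> m \<le> 2 * c * H p \<longrightarrow> \<bar>corr f f m\<bar> \<le> e\<^sup>2 / 8"
    using e by (intro corr_bounded_multiple) auto
  ultimately have "\<forall>\<^sub>F p in sequentially. 8 * real c * real C * (real (r p) / real (H p)) < e / 2 \<and> r p \<le> H p \<and>
     (\<forall>m. H p \<le> m \<and> m \<le> 2 * c * H p \<longrightarrow> \<bar>corr f f m\<bar> \<le> e\<^sup>2 / 8)"
    using r_le_H by (intro eventually_conj) auto
  then obtain P where P: "\<And>p. p \<ge> P \<Longrightarrow> 8 * real c * real C * (real (r p) / real (H p)) < e / 2"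
     "\<And>p. p \<ge> P \<Longrightarrow> r p \<le> H p"
     "\<And>p m. p \<ge> P \<Longrightarrow> H p \<le> m \<Longrightarrow> m \<le> 2 * c * H p \<Longrightarrow> \<bar>corr f f m\<bar> \<le> e\<^sup>2 / 8"
    unfolding eventually_sequentially by blast
  have "\<forall>\<^sub>F N in sequentially. \<forall>k\<in>{1..H P}. avg f k N \<le> e"
    using avg_tendsto e by (intro eventually_avg_le) auto
  then show ?thesis
    using eventually_gt_at_top[of 0]
  proof eventually_elim
    case (elim N)
    show ?case
    proof (intro allI impI, elim conjE)
      fix k assume k: "1 \<le> k" "k \<le> C * N"
      show "avg f k N \<le> e"
      proof (cases "k \<le> H P")
        case True
        then show ?thesis using elim(1) k by simp
      next
        case False
        then obtain p where p: "P \<le> p" "H p \<le> k" "k < H (Suc p)" using exists_stage[of P k] by auto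
        obtain q where q: "H (Suc p) \<le> k * q" "k * q < H (Suc p) + k"
          using exists_multiple_between[of k "H (Suc p)"] k(1) by auto
        have q0: "q > 0" using q(1) H_pos[of "Suc p"] by (cases q) auto
        \<comment> \<open>Here \<open>k * q \<le> 2 * H (Suc p)\<close> and
          \<open>H (Suc p) \<le> 2 * r p * H p \<le> 2 * r p * k\<close>.\<close>
        have "k * q \<le> k * (4 * r p)"
        proof -
          have "k * q \<le> 2 * H (Suc p)" using q(2) p(3) by linarith
          also have "\<dots> \<le> 2 * (2 * r p * H p)" using H_Suc_le[OF P(2)[OF p(1)]] by (intro mult_le_mono2)
          also have "\<dots> \<le> 4 * r p * k" using p(2) by simp
          finally show ?thesis by (simp add: ac_simps)
        qed
        then have q4: "q \<le> 4 * r p" using k(1) by simp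
        define S where "S = (\<lambda>l. q * l) ` {..<c}"
        have cardS: "card S = c" using q0 by (simp add: S_def card_image inj_on_def)
        have "avg f k N \<le> sqrt (1 / real (card S) + e\<^sup>2 / 8) + 2 * real (q * c) / real N"
        proof (rule avg_le_van_der_Corput)
          show "S \<noteq> {}" using c0 by (auto simp: S_def)
          show "l \<le> q * c" if "l \<in> S" for l using that by (auto simp: S_def)
          fix a a' assume "a \<in> S" "a' \<in> S" "a' < a"
          then obtain l l' where l: "a = q * l" "a' = q * l'" "l' < l" "l < c" by (auto simp: S_def)
          have eq: "k * (a - a') = (k * q) * (l - l')" using l by (simp add: diff_mult_distrib2)
          \<comment> \<open>Distinct elements of \<open>S\<close> differ by \<open>q\<close> times a
            number between 1 and \<open>c\<close>, so the time lies between \<open>H (Suc p)\<close>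
            and \<open>2 * c * H (Suc p)\<close>, the range provided for in
            \<open>P(3)\<close>.\<close>
          have "H (Suc p) * 1 \<le> (k * q) * (l - l')" using q(1) l(3) by (intro mult_le_mono) auto
          moreover have "(k * q) * (l - l') \<le> (2 * H (Suc p)) * c" 
          proof (rule mult_le_mono)
            show "k * q \<le> 2 * H (Suc p)" using q(2) p(3) by linarith
          qed (use l in simp)
          ultimately show "\<bar>corr f f (k * (a - a'))\<bar> \<le> e\<^sup>2 / 8"
            unfolding eq using p(1) by (intro P(3)[of "Suc p"]) (auto simp: ac_simps)
        qed (use level_funD(1,2)[OF f] elim in \<open>auto simp: S_def\<close>)
        also have "sqrt (1 / real (card S) + e\<^sup>2 / 8) \<le> e / 2" unfolding cardS by (rule sqrt_inverse_le[OF e c])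
        also have "2 * real (q * c) / real N \<le> e / 2"
        proof -
          have "real (H p) \<le> real C * real N" using p(2) k(2) by (metis le_trans of_nat_le_iff of_nat_mult)
          have "2 * real (q * c) \<le> 8 * real c * real (r p)"
            using q4 mult_right_mono[of "real q" "4 * real (r p)" "real c"] by (simp add: ac_simps)
          also have "\<dots> = 8 * real c * (real (r p) / real (H p)) * real (H p)" using H_pos[of p] by simp
          also have "\<dots> \<le> 8 * real c * (real (r p) / real (H p)) * (real C * real N)"
            using \<open>real (H p) \<le> _\<close> by (intro mult_left_mono) auto
          also have "\<dots> = (8 * real c * real C * (real (r p) / real (H p))) * real N" by simp
          also have "\<dots> \<le> e / 2 * real N" using P(1)[OF p(1)] by (intro mult_right_mono) auto
          finally show ?thesis using elim(2) by (simp add: field_simps)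
        qed
        finally show ?thesis by simp
      qed
    qed
  qed
qed

end

end

section \<open>Varying displacement\<close>

lemma sum_interval_shift_diff:
  fixes u :: "nat \<Rightarrow> real"
  assumes u: "\<And>i. \<bar>u i\<bar> \<le> 1"
  shows "\<bar>(\<Sum>i\<in>{lo..<hi}. u (i + t)) - (\<Sum>i\<in>{lo..<hi}. u i)\<bar> \<le> 2 * real t"
proof -
  have "(\<Sum>i\<in>{lo..<hi}. v i) = (\<Sum>i<hi - lo. v (lo + i))" for v :: "nat \<Rightarrow> real"
    by (simp add: sum.atLeastLessThan_shift_0[of v] atLeast0LessThan)
  then show ?thesis
    using sum_shift_diff[of "\<lambda>i. u (lo + i)" "hi - lo" t] u by (simp add: add.assoc abs_minus_commute)
qed

lemma sum_abs_le_sqrt: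
  fixes u :: "'b \<Rightarrow> real"
  shows "(\<Sum>i\<in>A. \<bar>u i\<bar>) \<le> sqrt (real (card A) * (\<Sum>i\<in>A. (u i)\<^sup>2))"
proof (rule real_le_rsqrt)
  show "(\<Sum>i\<in>A. \<bar>u i\<bar>)\<^sup>2 \<le> real (card A) * (\<Sum>i\<in>A. (u i)\<^sup>2)"
    using Cauchy_Schwarz_ineq_sum[of "\<lambda>_. 1" "\<lambda>i. \<bar>u i\<bar>" A] by simp
qed

context stair_system
begin

lemma card_off_columns:
  assumes top: "v + H j \<le> H (Suc j)" and K: "\<And>k. offset (H j) i + k * H j < v + H j \<Longrightarrow> k \<le> K" and i: "offset (H j) i \<le> v"
  shows "card {s. s < H j \<and> (let c = column_of (H j) (v + s) in
      \<not> ((c - i) * b \<le> v + s - offset (H j) c \<and> v + s - offset (H j) c < H j))} \<le> 2 * (K * b + r j)"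
proof -
  define c1 where "c1 = column_of (H j) v"
  let ?S = "\<lambda>c. {s. s < H j \<and> column_of (H j) (v + s) = c \<and>
      \<not> ((c - i) * b \<le> v + s - offset (H j) c \<and> v + s - offset (H j) c < H j)}"
  have S: "card (?S c) \<le> K * b + r j" for c
  proof (cases "?S c = {}")
    case False
    then obtain s where s: "s < H j" "column_of (H j) (v + s) = c" by blast
    have 1: "offset (H j) c \<le> v + s" using column_le[OF H_pos, of j "v + s"] s by simp
    then have "c < r j" using top s by (intro offset_less_H_Suc) linarith
    moreover have "i \<le> c" using column_ge[of j i "v + s"] i s by simp
    then have "offset (H j) i + (c - i) * H j \<le> offset (H j) c"
      using offset_add_ge[of "H j" i "c - i"] by simp
    then have "c - i \<le> K" using 1 s by (intro K) linarith
    then have "(c - i) * b \<le> K * b" by simp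
    ultimately show ?thesis using card_off_column[of c j v "(c - i) * b"] by linarith
  next
    case True
    show ?thesis unfolding True by simp
  qed
  have "{s. s < H j \<and> (let c = column_of (H j) (v + s) in
      \<not> ((c - i) * b \<le> v + s - offset (H j) c \<and> v + s - offset (H j) c < H j))} \<subseteq> ?S c1 \<union> ?S (Suc c1)"
  proof
    fix s assume s: "s \<in> {s. s < H j \<and> (let c = column_of (H j) (v + s) in
      \<not> ((c - i) * b \<le> v + s - offset (H j) c \<and> v + s - offset (H j) c < H j))}"
    then have *: "s \<in> ?S (column_of (H j) (v + s))" and "s < H j" by (simp_all add: Let_def)
    from column_near[OF \<open>s < H j\<close>, of v] show "s \<in> ?S c1 \<union> ?S (Suc c1)"
    proof
      assume eq: "column_of (H j) (v + s) = column_of (H j) v"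
      show ?thesis unfolding c1_def by (rule UnI1) (rule *[unfolded eq])
    next
      assume eq: "column_of (H j) (v + s) = Suc (column_of (H j) v)"
      show ?thesis unfolding c1_def by (rule UnI2) (rule *[unfolded eq])
    qed
  qed
  then have "card {s. s < H j \<and> (let c = column_of (H j) (v + s) in
      \<not> ((c - i) * b \<le> v + s - offset (H j) c \<and> v + s - offset (H j) c < H j))} \<le> card (?S c1 \<union> ?S (Suc c1))"
    by (intro card_mono) auto
  also have "\<dots> \<le> card (?S c1) + card (?S (Suc c1))" by (rule card_Un_le)
  also have "\<dots> \<le> (K * b + r j) + (K * b + r j)" by (intro add_mono S)
  finally show ?thesis by (simp only: mult_2)
qed

text \<open>Both factors move with \<open>x\<close>, one by \<open>k\<close>, the other by
  \<open>k'\<close>. Substituting \<open>s + k * x\<close> for \<open>s\<close> freezes the first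
  and leaves the second moving by \<open>k - k' > 0\<close>, so the sum over \<open>x\<close>
  becomes an average with that step. The substitution is cheap because \<open>s\<close> runs over an
  interval: it changes the sum by at most \<open>2 * k * x\<close>.\<close>

lemma product_class_le:
  assumes f: "level_fun n f" and j: "j \<ge> n" and b: "b > 0" and e: "k' < k" "k - k' \<le> E" "k \<le> K"
    and A: "A \<ge> 0" "avg f (k - k') b \<le> A"
    and z: "\<And>s. s \<in> {lo..<hi} \<Longrightarrow> p \<le> v + s \<and> k * b \<le> v + s - p"
    and z': "\<And>s. s \<in> {lo..<hi} \<Longrightarrow> p' \<le> v' + s \<and> k' * b \<le> v' + s - p' \<and> v' + s - p' < H j"
  shows "w j * \<bar>\<Sum>s\<in>{lo..<hi}. \<Sum>x<b. level_val f j (v + s - p - k * x) * level_val f j (v' + s - p' - k' * x)\<bar>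
    \<le> real b * (A + w j * (2 * real (K * b) + real (E * b)))"
proof -
  note f1 = level_funD(3)[OF f]
  let ?\<phi> = "level_val f j"
  define e where "e = k - k'"
  \<comment> \<open>Levels are measured from the lowest term \<open>x = b - 1\<close>; reversing the
    order of \<open>x\<close> turns the substitution into an upward shift of
    \<open>s\<close>.\<close>
  define y where "y s = v' + s - p' - k' * (b - 1)" for s
  define h where "h x s = ?\<phi> (v + s - p - k * (b - 1)) * ?\<phi> (y s - e * x)" for x s
  have kb: "k * (b - 1) \<le> k * b" "k' * (b - 1) \<le> k' * b" by simp_all
  have rev: "?\<phi> (v + s - p - k * (b - Suc x)) * ?\<phi> (v' + s - p' - k' * (b - Suc x)) = h x (s + k * x)"
    if s: "s \<in> {lo..<hi}" and x: "x < b" for s x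
  proof -
    have split: "k * (b - 1) = k * (b - Suc x) + k * x" "k' * (b - 1) = k' * (b - Suc x) + k' * x"
      using x by (simp_all add: add_mult_distrib2[symmetric])
    have ke: "k * x = k' * x + e * x" using e by (simp add: e_def add_mult_distrib[symmetric])
    have "v + (s + k * x) - p = (v + s - p) + k * x" using z[OF s] by simp
    then have "v + s - p - k * (b - Suc x) = v + (s + k * x) - p - k * (b - 1)"
      unfolding split by simp
    moreover have "v' + (s + k * x) - p' = (v' + s - p') + (k' * x + e * x)" using z'[OF s] ke by simp
    then have "v' + s - p' - k' * (b - Suc x) = y (s + k * x) - e * x"
      unfolding y_def split by (simp only: diff_diff_left)
    ultimately show ?thesis by (simp add: h_def)
  qed
  have "(\<Sum>s\<in>{lo..<hi}. \<Sum>x<b. ?\<phi> (v + s - p - k * x) * ?\<phi> (v' + s - p' - k' * x)) = (\<Sum>s\<in>{lo..<hi}. \<Sum>x<b. h x (s + k * x))"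
  proof (rule sum.cong[OF refl])
    fix s assume s: "s \<in> {lo..<hi}"
    have "(\<Sum>x<b. ?\<phi> (v + s - p - k * x) * ?\<phi> (v' + s - p' - k' * x)) =
       (\<Sum>x<b. ?\<phi> (v + s - p - k * (b - Suc x)) * ?\<phi> (v' + s - p' - k' * (b - Suc x)))"
      by (rule sum.nat_diff_reindex[symmetric])
    also have "\<dots> = (\<Sum>x<b. h x (s + k * x))" using rev[OF s] by (intro sum.cong) auto
    finally show "(\<Sum>x<b. ?\<phi> (v + s - p - k * x) * ?\<phi> (v' + s - p' - k' * x)) = (\<Sum>x<b. h x (s + k * x))" .
  qed
  also have "\<dots> = (\<Sum>x<b. \<Sum>s\<in>{lo..<hi}. h x (s + k * x))" by (rule sum.swap)
  also have "\<dots> = (\<Sum>x<b. (\<Sum>s\<in>{lo..<hi}. h x (s + k * x)) - (\<Sum>s\<in>{lo..<hi}. h x s)) + (\<Sum>x<b. \<Sum>s\<in>{lo..<hi}. h x s)"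
    by (simp add: sum_subtractf)
  finally have main: "\<bar>\<Sum>s\<in>{lo..<hi}. \<Sum>x<b. ?\<phi> (v + s - p - k * x) * ?\<phi> (v' + s - p' - k' * x)\<bar> \<le>
      \<bar>\<Sum>x<b. (\<Sum>s\<in>{lo..<hi}. h x (s + k * x)) - (\<Sum>s\<in>{lo..<hi}. h x s)\<bar> + \<bar>\<Sum>x<b. \<Sum>s\<in>{lo..<hi}. h x s\<bar>"
    by simp
  have shift: "\<bar>\<Sum>x<b. (\<Sum>s\<in>{lo..<hi}. h x (s + k * x)) - (\<Sum>s\<in>{lo..<hi}. h x s)\<bar> \<le> real (card {..<b}) * (2 * real (K * b))"
  proof (rule sum_abs_le_card)
    fix x assume x: "x \<in> {..<b}"
    have "\<bar>(\<Sum>s\<in>{lo..<hi}. h x (s + k * x)) - (\<Sum>s\<in>{lo..<hi}. h x s)\<bar> \<le> 2 * real (k * x)"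
      by (rule sum_interval_shift_diff) (use f1 in \<open>auto simp: h_def intro!: abs_mult_le_1\<close>)
    also have "k * x \<le> K * b" using e x by (intro mult_le_mono) auto
    finally show "\<bar>(\<Sum>s\<in>{lo..<hi}. h x (s + k * x)) - (\<Sum>s\<in>{lo..<hi}. h x s)\<bar> \<le> 2 * real (K * b)"
      by (simp only: of_nat_le_iff mult_le_cancel_left_pos zero_less_numeral)
  qed
  let ?W = "\<lambda>y. \<bar>\<Sum>x<b. ?\<phi> (y - e * x)\<bar>"
  have W_le: "?W y \<le> real b" for y using sum_abs_le_card[of "{..<b}" "\<lambda>x. ?\<phi> (y - e * x)" 1] f1 by simp
  have injy: "inj_on y {lo..<hi}"
  proof (rule inj_onI)
    fix s s' assume "s \<in> {lo..<hi}" "s' \<in> {lo..<hi}" "y s = y s'"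
    then show "s = s'" using z'[of s] z'[of s'] kb unfolding y_def by linarith
  qed
  have yH: "y s < H j" if "s \<in> {lo..<hi}" for s using z'[OF that] unfolding y_def by linarith
  have "\<bar>\<Sum>x<b. \<Sum>s\<in>{lo..<hi}. h x s\<bar> = \<bar>\<Sum>s\<in>{lo..<hi}. ?\<phi> (v + s - p - k * (b - 1)) * (\<Sum>x<b. ?\<phi> (y s - e * x))\<bar>"
    by (subst sum.swap) (simp add: h_def sum_distrib_left)
  also have "\<dots> \<le> (\<Sum>s\<in>{lo..<hi}. ?W (y s))"
    using f1 by (intro order_trans[OF sum_abs sum_mono]) (auto simp: abs_mult intro!: mult_left_le_one_le)
  also have "\<dots> = (\<Sum>y\<in>y ` {lo..<hi}. ?W y)" using injy by (simp add: sum.reindex)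
  \<comment> \<open>From below \<open>e * b\<close> the descending progression may leave the tower,
    so these levels are bounded trivially.\<close>
  also have "\<dots> \<le> (\<Sum>y\<in>{..<e * b} \<union> {e * b..<H j}. ?W y)"
    using yH by (intro sum_mono2) auto
  also have "\<dots> = (\<Sum>y\<in>{..<e * b}. ?W y) + (\<Sum>y\<in>{e * b..<H j}. ?W y)"
    by (intro sum.union_disjoint) auto
  also have "(\<Sum>y\<in>{..<e * b}. ?W y) \<le> real (e * b) * real b"
    using sum_bounded_above[of "{..<e * b}" ?W "real b"] W_le by simp
  also have "real (e * b) * real b \<le> real (E * b) * real b"
    using e by (intro mult_right_mono) (simp_all add: e_def mult_right_mono)
  finally have small: "\<bar>\<Sum>x<b. \<Sum>s\<in>{lo..<hi}. h x s\<bar> \<le> real (E * b) * real b + (\<Sum>y\<in>{e * b..<H j}. ?W y)"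
    by simp
  have "w j * (\<Sum>y\<in>{e * b..<H j}. ?W y) \<le> real b * avg f e b"
  proof (rule sum_level_val_down_le_avg[OF f j _ b])
    fix y assume "y \<in> {e * b..<H j}"
    then have "e * b \<le> y" "y < H j" by auto
    moreover have "e * (b - 1) \<le> e * b" by simp
    ultimately show "e * (b - 1) \<le> y \<and> y < H j" by linarith
  qed
  also have "\<dots> \<le> real b * A" using A by (intro mult_left_mono) (auto simp: e_def)
  finally have avg: "w j * (\<Sum>y\<in>{e * b..<H j}. ?W y) \<le> real b * A" .
  have "w j * \<bar>\<Sum>s\<in>{lo..<hi}. \<Sum>x<b. ?\<phi> (v + s - p - k * x) * ?\<phi> (v' + s - p' - k' * x)\<bar>
     \<le> w j * (real b * (2 * real (K * b)) + (real (E * b) * real b + (\<Sum>y\<in>{e * b..<H j}. ?W y)))"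
    using main shift small w_pos[of j] by (intro mult_left_mono) auto
  also have "\<dots> = w j * (real b * (2 * real (K * b)) + real (E * b) * real b) + w j * (\<Sum>y\<in>{e * b..<H j}. ?W y)"
    by (simp add: distrib_left)
  also have "\<dots> \<le> w j * (real b * (2 * real (K * b)) + real (E * b) * real b) + real b * A"
    using avg by simp
  also have "\<dots> = real b * (A + w j * (2 * real (K * b) + real (E * b)))" by (simp add: algebra_simps)
  finally show ?thesis .
qed

text \<open>Moving from column \<open>i\<close> to \<open>i + \<Delta>\<close> slides the target
  down by \<open>k * \<Delta>\<close>. By \<open>low\<close> this is at least \<open>H j\<close> for
  every displacement that occurs, so the second column has a strictly smaller displacement;
  \<open>up\<close> bounds the difference by \<open>E\<close>. Each of at most four pairs of target
  columns then yields an interval of levels for \<open>product_class_le\<close>.\<close>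

lemma pair_correlation_le:
  assumes f: "level_fun n f" and j: "j \<ge> n" and b: "b > 0" and i': "i' = i + \<Delta>"
    and top: "\<And>x. x < b \<Longrightarrow> offset (H j) (i' + x) + H j + m \<le> H (Suc j)"
    and K: "\<And>k. k * H j < H j + m \<Longrightarrow> k \<le> K"
    and low: "\<And>k. m < Suc k * (H j + r j) \<Longrightarrow> H j \<le> k * \<Delta>"
    and up: "K * \<Delta> \<le> E * H j"
    and A: "A \<ge> 0" "\<And>e. 1 \<le> e \<Longrightarrow> e \<le> E \<Longrightarrow> avg f e b \<le> A"
  shows "w j * \<bar>\<Sum>s<H j. \<Sum>x<b. shifted_val f j m (i + x) s * shifted_val f j m (i' + x) s\<bar>
    \<le> real b * (4 * A + w j * (12 * real (K * b) + 4 * real (E * b) + 4 * real (r j)))"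
proof -
  note f1 = level_funD(3)[OF f]
  define P where "P = offset (H j)"
  define v where "v = P i + m"
  define v' where "v' = P i' + m"
  define G where "G s = (\<Sum>x<b. shifted_val f j m (i + x) s * shifted_val f j m (i' + x) s)" for s
  define bad where "bad i v = {s. s < H j \<and> (let c = column_of (H j) (v + s) in
      \<not> ((c - i) * b \<le> v + s - offset (H j) c \<and> v + s - offset (H j) c < H j))}" for i v
  define S where "S c c' = {s. s < H j \<and> P c \<le> v + s \<and> (c - i) * b \<le> v + s - P c \<and> v + s - P c < H j \<and>
      P c' \<le> v' + s \<and> (c' - i') * b \<le> v' + s - P c' \<and> v' + s - P c' < H j}" for c c'
  define c1 where "c1 = column_of (H j) v"
  define c2 where "c2 = column_of (H j) v'"
  let ?C = "{c1, Suc c1} \<times> {c2, Suc c2}"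
  have top_i: "P (i + x) + H j + m \<le> H (Suc j)" if "x < b" for x
    using top[OF that] offset_mono[of "i + x" "i' + x" "H j"] i' by (simp add: P_def)
  have G1: "\<bar>G s\<bar> \<le> real b" for s
    using sum_abs_le_card[of "{..<b}" "\<lambda>x. shifted_val f j m (i + x) s * shifted_val f j m (i' + x) s" 1] f1
    by (simp add: G_def abs_mult_le_1)
  have card_bad: "card (bad i v) \<le> 2 * (K * b + r j)" "card (bad i' v') \<le> 2 * (K * b + r j)"
  proof -
    show "card (bad i v) \<le> 2 * (K * b + r j)"
      unfolding bad_def
    proof (rule card_off_columns)
      show "v + H j \<le> H (Suc j)" using top_i[OF b] by (simp add: v_def)
      show "k \<le> K" if "offset (H j) i + k * H j < v + H j" for k
        using that by (intro K) (simp add: v_def P_def)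
    qed (simp add: v_def P_def)
    show "card (bad i' v') \<le> 2 * (K * b + r j)"
      unfolding bad_def
    proof (rule card_off_columns)
      show "v' + H j \<le> H (Suc j)" using top[OF b] by (simp add: v'_def P_def)
      show "k \<le> K" if "offset (H j) i' + k * H j < v' + H j" for k
        using that by (intro K) (simp add: v'_def P_def)
    qed (simp add: v'_def P_def)
  qed
  have S_column: "column_of (H j) (v + s) = c" "column_of (H j) (v' + s) = c'" if "s \<in> S c c'" for c c' s
    using that by (auto simp: S_def P_def offset_Suc intro!: column_unique)
  have S_disj: "S c c' \<inter> S d d' = {}" if "(c, c') \<noteq> (d, d')" for c c' d d'
    using S_column[of _ c c'] S_column[of _ d d'] that by blast
  have S_fin: "finite (S c c')" for c c' by (simp add: S_def)
  define U where "U = (\<Union>(c, c')\<in>?C. S c c')"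
  have U_sub: "U \<subseteq> {..<H j}" by (auto simp: U_def S_def)
  have rest: "{..<H j} - U \<subseteq> bad i v \<union> bad i' v'"
  proof
    fix s assume s: "s \<in> {..<H j} - U"
    show "s \<in> bad i v \<union> bad i' v'"
    proof (rule ccontr)
      assume nb: "s \<notin> bad i v \<union> bad i' v'"
      define c where "c = column_of (H j) (v + s)"
      define c' where "c' = column_of (H j) (v' + s)"
      have "(c, c') \<in> ?C" using column_near[of s j v] column_near[of s j v'] s by (auto simp: c_def c'_def c1_def c2_def)
      moreover have "P c \<le> v + s" "P c' \<le> v' + s" using column_le[OF H_pos] by (auto simp: c_def c'_def P_def)
      then have "s \<in> S c c'" using nb s by (auto simp: bad_def S_def Let_def c_def c'_def P_def)
      ultimately show False using s by (auto simp: U_def)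
    qed
  qed
  have "\<bar>\<Sum>s\<in>{..<H j} - U. G s\<bar> \<le> real (card ({..<H j} - U)) * real b" by (rule sum_abs_le_card) (rule G1)
  also have "\<dots> \<le> real (4 * (K * b + r j)) * real b"
  proof (rule mult_right_mono)
    have "card ({..<H j} - U) \<le> card (bad i v \<union> bad i' v')" by (rule card_mono[OF _ rest]) (simp add: bad_def)
    also have "\<dots> \<le> card (bad i v) + card (bad i' v')" by (rule card_Un_le)
    finally have "card ({..<H j} - U) \<le> 4 * (K * b + r j)" using card_bad by linarith
    then show "real (card ({..<H j} - U)) \<le> real (4 * (K * b + r j))" by (simp only: of_nat_le_iff)
  qed simp
  finally have off: "\<bar>\<Sum>s\<in>{..<H j} - U. G s\<bar> \<le> real b * (4 * real (K * b) + 4 * real (r j))" by (simp add: algebra_simps)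
  define B where "B = real b * (A + w j * (2 * real (K * b) + real (E * b)))"
  have in_S: "w j * \<bar>\<Sum>s\<in>S c c'. G s\<bar> \<le> B" for c c'
  proof (cases "S c c' = {}")
    case True
    then show ?thesis using A w_pos[of j] by (simp add: B_def less_imp_le)
  next
    case False
    then obtain s0 where s0: "s0 \<in> S c c'" by blast
    define k where "k = c - i"
    define k' where "k' = c' - i'"
    have s0': "s0 < H j" "P c \<le> v + s0" "v + s0 - P c < H j" "P c' \<le> v' + s0" "v' + s0 - P c' < H j"
      using s0 by (auto simp: S_def)
    have ic: "i \<le> c" using column_ge[of j i "v + s0"] S_column(1)[OF s0] by (simp add: v_def P_def)
    have ic': "i' \<le> c'" using column_ge[of j i' "v' + s0"] S_column(2)[OF s0] by (simp add: v'_def P_def)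
    have c_r: "c < r j"
      using s0' top_i[OF b] by (intro offset_less_H_Suc) (simp add: P_def[symmetric] v_def)
    have "P i + k * H j \<le> P c" using offset_add_ge[of "H j" i k] ic by (simp add: P_def k_def)
    then have kK: "k \<le> K" using s0' by (intro K) (simp add: v_def)
    have "P (Suc c) \<le> P i + Suc k * (H j + r j)"
      using offset_add_le[of i "Suc k" "r j" "H j"] ic c_r by (simp add: P_def k_def)
    moreover have "P i + m < P (Suc c)" using s0' by (simp add: v_def P_def offset_Suc)
    ultimately have "m < Suc k * (H j + r j)" by linarith
    then have k\<Delta>: "H j \<le> k * \<Delta>" by (rule low)
    have slide: "P (c + \<Delta>) + P i = P i' + P c + k * \<Delta>"
      using offset_add[of "H j" i k \<Delta>] ic by (simp add: P_def i' k_def)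
    \<comment> \<open>Column \<open>c + \<Delta>\<close> is what the second point would reach with
      unchanged displacement \<open>k\<close>; sliding by \<open>H j\<close> or more puts the true
      target below it.\<close>
    have "P c' < P (c + \<Delta>)" using slide s0' k\<Delta> by (simp add: v_def v'_def)
    then have "c' < c + \<Delta>" 
      using offset_mono[of "c + \<Delta>" c' "H j"] unfolding P_def by (metis leD not_le_imp_less)
    then have k'k: "k' < k" using ic ic' i' by (simp add: k_def k'_def)
    define e where "e = k - k'"
    have "c' + e = c + \<Delta>" using k'k ic ic' i' by (simp add: e_def k_def k'_def)
    then have "P c' + e * H j \<le> P (c + \<Delta>)" using offset_add_ge[of "H j" c' e] by (simp add: P_def)
    then have "e * H j < k * \<Delta> + H j" using slide s0' by (simp add: v_def v'_def)
    also have "k * \<Delta> \<le> E * H j" using kK up by (meson le_trans mult_le_mono1)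
    finally have "e * H j < Suc E * H j" by simp
    then have "e < Suc E" by (simp only: mult_less_cancel2)
    then have eE: "e \<le> E" by simp
    define lo where "lo = max (P c + k * b - v) (P c' + k' * b - v')"
    define hi where "hi = min (H j) (min (P c + H j - v) (P c' + H j - v'))"
    \<comment> \<open>All conditions on \<open>s\<close> are linear inequalities, so the class is an
      interval, as the substitution in \<open>product_class_le\<close> requires.\<close>
    have S_eq: "S c c' = {lo..<hi}"
    proof (rule set_eqI)
      fix s
      have "(P c \<le> v + s \<and> k * b \<le> v + s - P c) \<longleftrightarrow> P c + k * b - v \<le> s" "P c \<le> v + s \<Longrightarrow> v + s - P c < H j \<longleftrightarrow> s < P c + H j - v"
         "(P c' \<le> v' + s \<and> k' * b \<le> v' + s - P c') \<longleftrightarrow> P c' + k' * b - v' \<le> s" "P c' \<le> v' + s \<Longrightarrow> v' + s - P c' < H j \<longleftrightarrow> s < P c' + H j - v'"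
        by linarith+
      then show "s \<in> S c c' \<longleftrightarrow> s \<in> {lo..<hi}"
        unfolding S_def lo_def hi_def k_def[symmetric] k'_def[symmetric] by auto
    qed
    have G_eq: "G s = (\<Sum>x<b. level_val f j (v + s - P c - k * x) * level_val f j (v' + s - P c' - k' * x))" if s: "s \<in> S c c'" for s
      unfolding G_def
    proof (rule sum.cong[OF refl])
      fix x assume x: "x \<in> {..<b}"
      have s': "s < H j" "P c \<le> v + s" "k * b \<le> v + s - P c" "v + s - P c < H j"
         "P c' \<le> v' + s" "k' * b \<le> v' + s - P c'" "v' + s - P c' < H j"
        using s by (auto simp: S_def k_def k'_def)
      have kx: "k * x \<le> k * b" "k' * x \<le> k' * b" using x by auto
      have "shifted_val f j m (i + x) s = level_val f j (v + s - P c - k * x)"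
        unfolding k_def
      proof (rule level_val_slide[OF f j ic])
        show "(c - i) * x \<le> v + s - P c" using s' kx unfolding k_def by linarith
        show "offset (H j) (i + x) + (s + m) < H (Suc j)" using s' top_i[of x] x by (simp add: P_def)
      qed (use s' in \<open>auto simp: v_def P_def ac_simps\<close>)
      moreover have "shifted_val f j m (i' + x) s = level_val f j (v' + s - P c' - k' * x)"
        unfolding k'_def
      proof (rule level_val_slide[OF f j ic'])
        show "(c' - i') * x \<le> v' + s - P c'" using s' kx unfolding k'_def by linarith
        show "offset (H j) (i' + x) + (s + m) < H (Suc j)" using s' top[of x] x by (simp add: P_def)
      qed (use s' in \<open>auto simp: v'_def P_def ac_simps\<close>)
      ultimately show "shifted_val f j m (i + x) s * shifted_val f j m (i' + x) s =
         level_val f j (v + s - P c - k * x) * level_val f j (v' + s - P c' - k' * x)" by simp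
    qed
    have "w j * \<bar>\<Sum>s\<in>{lo..<hi}. \<Sum>x<b. level_val f j (v + s - P c - k * x) * level_val f j (v' + s - P c' - k' * x)\<bar> \<le> B"
      unfolding B_def
    proof (rule product_class_le[OF f j b k'k _ kK A(1)])
      show "k - k' \<le> E" using eE by (simp add: e_def)
      show "avg f (k - k') b \<le> A" using eE k'k by (intro A(2)) (auto simp: e_def)
    qed (unfold S_eq[symmetric], auto simp: S_def k_def k'_def)
    then show ?thesis using G_eq by (simp add: S_eq)
  qed
  have "(\<Sum>s\<in>U. G s) = (\<Sum>(c, c')\<in>?C. \<Sum>s\<in>S c c'. G s)"
    unfolding U_def using S_fin S_disj by (subst sum.UNION_disjoint) (auto simp: split_def)
  then have "w j * \<bar>\<Sum>s\<in>U. G s\<bar> \<le> w j * (\<Sum>(c, c')\<in>?C. \<bar>\<Sum>s\<in>S c c'. G s\<bar>)"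
    using w_pos[of j] by (auto intro!: mult_left_mono simp: split_def)
  also have "\<dots> = (\<Sum>(c, c')\<in>?C. w j * \<bar>\<Sum>s\<in>S c c'. G s\<bar>)" by (simp add: sum_distrib_left distrib_left split_def)
  also have "\<dots> \<le> real (card ?C) * B" using in_S by (intro sum_bounded_above) auto
  also have "\<dots> = 4 * B" by simp
  finally have on: "w j * \<bar>\<Sum>s\<in>U. G s\<bar> \<le> 4 * B" .
  have "(\<Sum>s<H j. G s) = (\<Sum>s\<in>{..<H j} - U. G s) + (\<Sum>s\<in>U. G s)"
    by (rule sum.subset_diff[OF U_sub]) simp
  then have "w j * \<bar>\<Sum>s<H j. G s\<bar> \<le> w j * (\<bar>\<Sum>s\<in>{..<H j} - U. G s\<bar> + \<bar>\<Sum>s\<in>U. G s\<bar>)"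
    using w_pos[of j] by (intro mult_left_mono) auto
  also have "\<dots> \<le> w j * (real b * (4 * real (K * b) + 4 * real (r j))) + 4 * B"
    using on mult_left_mono[OF off, of "w j"] w_pos[of j] by (simp add: distrib_left)
  \<comment> \<open>The 12 is \<open>4 * 2\<close> from the four classes plus 4 from the levels
    outside all classes.\<close>
  also have "\<dots> = real b * (4 * A + w j * (12 * real (K * b) + 4 * real (E * b) + 4 * real (r j)))"
    by (simp add: B_def algebra_simps)
  finally show ?thesis by (simp add: G_def)
qed

end

section \<open>Decay of correlations\<close>

context stair_system
begin

text \<open>These are the off-diagonal entries of the expansion that follows. The separation
  \<open>(\<beta>' - \<beta>) * D\<close> lies between \<open>D\<close> and \<open>R * D\<close>, so
  \<open>low\<close> for \<open>D\<close> and \<open>up\<close> for \<open>R * D\<close> serve every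
  pair at once.\<close>

lemma column_correlation_le:
  assumes f: "level_fun n f" and j: "j \<ge> n" and b: "b > 0" and \<beta>: "\<beta> < \<beta>'" "\<beta>' < R"
    and top: "\<And>i. i < N \<Longrightarrow> offset (H j) i + H j + m \<le> H (Suc j)"
    and K: "\<And>k. k * H j < H j + m \<Longrightarrow> k \<le> K"
    and low: "\<And>k. m < Suc k * (H j + r j) \<Longrightarrow> H j \<le> k * D"
    and up: "K * (R * D) \<le> E * H j"
    and A: "A \<ge> 0" "\<And>e. 1 \<le> e \<Longrightarrow> e \<le> E \<Longrightarrow> avg f e b \<le> A"
  shows "w j * \<bar>\<Sum>i<N - R * D. \<Sum>s<H j. shifted_val f j m (i + \<beta> * D) s * shifted_val f j m (i + \<beta>' * D) s\<bar>
    \<le> real (N - R * D) * (4 * A + (12 * real (K * b) + 4 * real (E * b) + 4 * real (r j)) / real (H j)) + real b"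
proof -
  note f1 = level_funD(3)[OF f]
  define N' where "N' = N - R * D"
  define B where "B = 4 * A + (12 * real (K * b) + 4 * real (E * b) + 4 * real (r j)) / real (H j)"
  have B0: "B \<ge> 0" using A by (simp add: B_def)
  define p where "p i s = shifted_val f j m (i + \<beta> * D) s * shifted_val f j m (i + \<beta>' * D) s" for i s
  \<comment> \<open>Dividing by \<open>H j\<close> makes the terms bounded by 1, as
    \<open>sum_windows\<close> demands.\<close>
  define u where "u i = (\<Sum>s<H j. p i s) / real (H j)" for i
  have p1: "\<bar>p i s\<bar> \<le> 1" for i s unfolding p_def using f1 by (intro abs_mult_le_1)
  have u1: "\<bar>u i\<bar> \<le> 1" for i
    using sum_abs_le_card[of "{..<H j}" "p i" 1] p1 H_pos[of j] by (simp add: u_def)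
  have window: "w j * (real (H j) * \<bar>\<Sum>x<b. u (q * b + x)\<bar>) \<le> real b * B" if q: "q < N' div b" for q
  proof -
    have "(q + 1) * b \<le> N' div b * b" using q by (intro mult_le_mono1) auto
    also have "\<dots> \<le> N'" by simp
    finally have qN: "q * b + b \<le> N'" by simp
    have \<Delta>: "q * b + \<beta>' * D = (q * b + \<beta> * D) + (\<beta>' - \<beta>) * D"
      using \<beta> by (simp add: add_mult_distrib[symmetric])
    have \<Delta>1: "D \<le> (\<beta>' - \<beta>) * D" "(\<beta>' - \<beta>) * D \<le> R * D" "\<beta>' * D \<le> R * D"
      using \<beta> by (auto intro!: mult_le_mono1)
    have "w j * \<bar>\<Sum>s<H j. \<Sum>x<b. shifted_val f j m ((q * b + \<beta> * D) + x) s * shifted_val f j m ((q * b + \<beta>' * D) + x) s\<bar>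
        \<le> real b * (4 * A + w j * (12 * real (K * b) + 4 * real (E * b) + 4 * real (r j)))"
    proof (rule pair_correlation_le[OF f j b \<Delta> _ K _ _ A])
      fix x assume x: "x < b"
      show "offset (H j) (q * b + \<beta>' * D + x) + H j + m \<le> H (Suc j)"
      proof (rule top)
        show "q * b + \<beta>' * D + x < N" using x qN \<Delta>1(3) unfolding N'_def by linarith
      qed
    next
      fix k assume "m < Suc k * (H j + r j)"
      then have "H j \<le> k * D" by (rule low)
      also have "\<dots> \<le> k * ((\<beta>' - \<beta>) * D)" using \<Delta>1(1) by (rule mult_le_mono2)
      finally show "H j \<le> k * ((\<beta>' - \<beta>) * D)" .
    next
      show "K * ((\<beta>' - \<beta>) * D) \<le> E * H j"
        using mult_le_mono2[OF \<Delta>1(2), of K] up by linarith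
    qed
    also have "(\<Sum>s<H j. \<Sum>x<b. shifted_val f j m ((q * b + \<beta> * D) + x) s * shifted_val f j m ((q * b + \<beta>' * D) + x) s) =
       real (H j) * (\<Sum>x<b. u (q * b + x))"
      using H_pos[of j] by (subst sum.swap) (simp add: u_def p_def sum_distrib_left sum_divide_distrib ac_simps)
    also have "real b * (4 * A + w j * (12 * real (K * b) + 4 * real (E * b) + 4 * real (r j))) \<le> real b * B"
      using mult_right_mono[OF w_le[of j], of "12 * real (K * b) + 4 * real (E * b) + 4 * real (r j)"]
      unfolding B_def by (intro mult_left_mono add_left_mono) auto
    finally show ?thesis by (simp add: abs_mult)
  qed
  have Hw: "w j * real (H j) \<le> 1" using Hw_le_1[of j] by (simp add: mult.commute)
  have Hw0: "w j * real (H j) \<ge> 0" using w_pos[of j] by simp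
  have "w j * \<bar>\<Sum>i<N'. \<Sum>s<H j. p i s\<bar> = w j * real (H j) * \<bar>\<Sum>i<N'. u i\<bar>"
    using H_pos[of j] by (simp add: u_def sum_divide_distrib[symmetric] abs_divide)
  also have "\<dots> \<le> w j * real (H j) * ((\<Sum>q<N' div b. \<bar>\<Sum>x<b. u (q * b + x)\<bar>) + real b)"
    using sum_windows[OF u1 b, where N = N'] Hw0 by (rule mult_left_mono)
  also have "\<dots> = (\<Sum>q<N' div b. w j * (real (H j) * \<bar>\<Sum>x<b. u (q * b + x)\<bar>)) + (w j * real (H j)) * real b"
    by (simp add: distrib_left sum_distrib_left mult.assoc)
  also have "\<dots> \<le> (\<Sum>q<N' div b. real b * B) + 1 * real b"
    using window Hw by (intro add_mono sum_mono mult_right_mono) auto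
  also have "(\<Sum>q<N' div b. real b * B) = real (N' div b * b) * B" by simp
  also have "\<dots> \<le> real N' * B"
    using B0 by (intro mult_right_mono) (simp_all only: of_nat_le_iff div_times_less_eq_dividend)
  finally show ?thesis by (simp add: N'_def B_def p_def)
qed

text \<open>Van der Corput once more, now in the column index: the sum over columns is compared with
  its average over the \<open>R\<close> shifts \<open>\<beta> * D\<close>, and Cauchy-Schwarz is
  applied over columns and levels jointly. Among the \<open>R^2\<close> entries only the
  \<open>R\<close> diagonal ones lack cancellation, and they contribute
  \<open>1 / R\<close>.\<close>

lemma column_sum_le_separated:
  assumes f: "level_fun n f" and j: "j \<ge> n" and b: "b > 0" and R: "R > 0"
    and K: "\<And>k. k * H j < H j + m \<Longrightarrow> k \<le> K"
    and low: "\<And>k. m < Suc k * (H j + r j) \<Longrightarrow> H j \<le> k * D"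
    and up: "K * (R * D) \<le> E * H j"
    and A: "A \<ge> 0" "\<And>e. 1 \<le> e \<Longrightarrow> e \<le> E \<Longrightarrow> avg f e b \<le> A"
  shows "column_sum f j m \<le> 1 / real (r j) + real (R * D) / real (r j) +
    sqrt (1 / real R + (4 * A + (12 * real (K * b) + 4 * real (E * b) + 4 * real (r j)) / real (H j)) + real b / real (r j))"
proof -
  note f1 = level_funD(3)[OF f]
  obtain N where N: "N \<le> r j" "\<And>i. i < N \<Longrightarrow> offset (H j) i + H j + m \<le> H (Suc j)"
    and le: "column_sum f j m \<le> 1 / real (r j) + w (Suc j) * (\<Sum>s<H j. \<bar>\<Sum>i<N. shifted_val f j m i s\<bar>)"
    using column_sum_split[OF f, of j m] by metis
  define N' where "N' = N - R * D"
  define B where "B = 4 * A + (12 * real (K * b) + 4 * real (E * b) + 4 * real (r j)) / real (H j)"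
  have B0: "B \<ge> 0" using A by (simp add: B_def)
  define F where "F i s = shifted_val f j m i s" for i s
  have F1: "\<bar>F i s\<bar> \<le> 1" for i s by (simp add: F_def f1)
  define U where "U i s = (\<Sum>\<beta><R. F (i + \<beta> * D) s)" for i s
  have step1: "\<bar>\<Sum>i<N. F i s\<bar> \<le> real (R * D) + (\<Sum>i<N'. \<bar>U i s\<bar>) / real R" for s
  proof -
    have err: "\<bar>(\<Sum>i<N. F i s) - (\<Sum>i<N'. F (i + \<beta> * D) s)\<bar> \<le> real (R * D)" if "\<beta> \<in> {..<R}" for \<beta>
    proof -
      define J where "J = (\<lambda>i. i + \<beta> * D) ` {..<N'}"
      have "\<beta> * D \<le> R * D" using that by auto
      then have "i + \<beta> * D < N" if "i < N'" for i using that unfolding N'_def by linarith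
      then have J: "J \<subseteq> {..<N}" by (auto simp: J_def)
      have "(\<Sum>i<N. F i s) = (\<Sum>i\<in>{..<N} - J. F i s) + (\<Sum>i\<in>J. F i s)"
        by (rule sum.subset_diff[OF J]) simp
      moreover have "(\<Sum>i\<in>J. F i s) = (\<Sum>i<N'. F (i + \<beta> * D) s)"
        by (simp add: J_def sum.reindex)
      moreover have "\<bar>\<Sum>i\<in>{..<N} - J. F i s\<bar> \<le> real (card ({..<N} - J)) * 1"
        using F1 by (intro sum_abs_le_card)
      moreover have "card ({..<N} - J) \<le> R * D"
        using J by (subst card_Diff_subset) (auto simp: J_def card_image N'_def)
      then have "real (card ({..<N} - J)) \<le> real (R * D)" by (simp only: of_nat_le_iff)
      ultimately show ?thesis by linarith
    qed
    have "real R * (\<Sum>i<N. F i s) = (\<Sum>\<beta><R. (\<Sum>i<N. F i s) - (\<Sum>i<N'. F (i + \<beta> * D) s)) + (\<Sum>i<N'. U i s)"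
    proof -
      have "(\<Sum>i<N'. U i s) = (\<Sum>\<beta><R. \<Sum>i<N'. F (i + \<beta> * D) s)" unfolding U_def by (rule sum.swap)
      then show ?thesis by (simp add: sum_subtractf)
    qed
    moreover have "\<bar>\<Sum>\<beta><R. (\<Sum>i<N. F i s) - (\<Sum>i<N'. F (i + \<beta> * D) s)\<bar> \<le> real (card {..<R}) * real (R * D)"
      by (rule sum_abs_le_card) (rule err)
    moreover have "\<bar>\<Sum>i<N'. U i s\<bar> \<le> (\<Sum>i<N'. \<bar>U i s\<bar>)" by (rule sum_abs)
    ultimately have "\<bar>real R * (\<Sum>i<N. F i s)\<bar> \<le> real R * real (R * D) + (\<Sum>i<N'. \<bar>U i s\<bar>)"
      unfolding card_lessThan by linarith
    then show ?thesis using R by (simp add: abs_mult field_simps)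
  qed
  define Q where "Q = (\<Sum>i<N'. \<Sum>s<H j. (U i s)\<^sup>2)"
  define C where "C \<beta> \<beta>' = (\<Sum>i<N'. \<Sum>s<H j. F (i + \<beta> * D) s * F (i + \<beta>' * D) s)" for \<beta> \<beta>'
  have Q_eq: "Q = (\<Sum>\<beta><R. \<Sum>\<beta>'<R. C \<beta> \<beta>')"
  proof -
    have "Q = (\<Sum>i<N'. \<Sum>s<H j. \<Sum>\<beta><R. \<Sum>\<beta>'<R. F (i + \<beta> * D) s * F (i + \<beta>' * D) s)"
      by (simp add: Q_def U_def power2_eq_square sum_product)
    also have "\<dots> = (\<Sum>i<N'. \<Sum>\<beta><R. \<Sum>s<H j. \<Sum>\<beta>'<R. F (i + \<beta> * D) s * F (i + \<beta>' * D) s)"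
      by (intro sum.cong refl sum.swap)
    also have "\<dots> = (\<Sum>\<beta><R. \<Sum>i<N'. \<Sum>s<H j. \<Sum>\<beta>'<R. F (i + \<beta> * D) s * F (i + \<beta>' * D) s)"
      by (rule sum.swap)
    also have "\<dots> = (\<Sum>\<beta><R. \<Sum>i<N'. \<Sum>\<beta>'<R. \<Sum>s<H j. F (i + \<beta> * D) s * F (i + \<beta>' * D) s)"
      by (intro sum.cong refl sum.swap)
    also have "\<dots> = (\<Sum>\<beta><R. \<Sum>\<beta>'<R. \<Sum>i<N'. \<Sum>s<H j. F (i + \<beta> * D) s * F (i + \<beta>' * D) s)"
      by (intro sum.cong refl sum.swap)
    finally show ?thesis by (simp add: C_def)
  qed
  have w0: "w j \<ge> 0" using w_pos[of j] by simp
  have Hw: "w j * real (H j) \<le> 1" using Hw_le_1[of j] by (simp add: mult.commute)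
  have off: "w j * C \<beta> \<beta>' \<le> real N' * B + real b" if "\<beta> < \<beta>'" "\<beta>' < R" for \<beta> \<beta>'
  proof -
    have "w j * C \<beta> \<beta>' \<le> w j * \<bar>C \<beta> \<beta>'\<bar>" using w0 by (intro mult_left_mono) auto
    also have "\<dots> \<le> real N' * B + real b"
      using column_correlation_le[OF f j b that N(2) K low up A] by (simp add: C_def F_def N'_def B_def)
    finally show ?thesis .
  qed
  have C_sym: "C \<beta> \<beta>' = C \<beta>' \<beta>" for \<beta> \<beta>' by (simp add: C_def mult.commute)
  have diag: "w j * C \<beta> \<beta> \<le> real N'" for \<beta>
  proof -
    have "C \<beta> \<beta> \<le> (\<Sum>i<N'. \<Sum>s<H j. 1)"
      unfolding C_def using F1 by (intro sum_mono order_trans[OF abs_ge_self abs_mult_le_1])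
    then have "C \<beta> \<beta> \<le> real N' * real (H j)" by simp
    from mult_left_mono[OF this w0] have "w j * C \<beta> \<beta> \<le> real N' * (w j * real (H j))" by (simp add: ac_simps)
    also have "\<dots> \<le> real N' * 1" using Hw by (intro mult_left_mono) auto
    finally show ?thesis by simp
  qed
  have entry: "w j * C \<beta> \<beta>' \<le> (if \<beta>' = \<beta> then real N' else 0) + (real N' * B + real b)"
    if "\<beta> < R" "\<beta>' < R" for \<beta> \<beta>'
  proof (cases \<beta> \<beta>' rule: linorder_cases)
    case equal
    then show ?thesis using diag[of \<beta>] B0 by (simp add: add_increasing2)
  qed (use off[of \<beta> \<beta>'] off[of \<beta>' \<beta>] that C_sym in auto)
  have "w j * Q = (\<Sum>\<beta><R. \<Sum>\<beta>'<R. w j * C \<beta> \<beta>')" by (simp add: Q_eq sum_distrib_left)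
  also have "\<dots> \<le> (\<Sum>\<beta><R. \<Sum>\<beta>'<R. (if \<beta>' = \<beta> then real N' else 0) + (real N' * B + real b))"
    using entry by (intro sum_mono) auto
  also have "\<dots> = real R * real N' + real R * (real R * (real N' * B + real b))"
    by (simp add: sum.distrib distrib_left)
  finally have Q_le: "w j * Q \<le> real R * real N' + real R * (real R * (real N' * B + real b))" .
  have N'r: "real N' \<le> real (r j)" using N(1) by (simp add: N'_def)
  have "(\<Sum>s<H j. \<Sum>i<N'. \<bar>U i s\<bar>) = (\<Sum>(i, s)\<in>{..<N'} \<times> {..<H j}. \<bar>U i s\<bar>)"
    by (subst sum.swap) (simp add: sum.cartesian_product)
  also have "\<dots> \<le> sqrt (real (card ({..<N'} \<times> {..<H j})) * (\<Sum>(i, s)\<in>{..<N'} \<times> {..<H j}. (U i s)\<^sup>2))"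
    using sum_abs_le_sqrt[of "\<lambda>(i, s). U i s" "{..<N'} \<times> {..<H j}"] by (simp add: split_def)
  also have "\<dots> = sqrt (real N' * real (H j) * Q)"
    by (simp add: Q_def sum.cartesian_product)
  finally have CS: "(\<Sum>s<H j. \<Sum>i<N'. \<bar>U i s\<bar>) \<le> sqrt (real N' * real (H j) * Q)" .
  have Q0: "Q \<ge> 0" by (simp add: Q_def sum_nonneg)
  have "w j * (\<Sum>s<H j. \<Sum>i<N'. \<bar>U i s\<bar>) \<le> w j * sqrt (real N' * real (H j) * Q)"
    using CS w0 by (rule mult_left_mono)
  also have "\<dots> = sqrt ((w j)\<^sup>2 * (real N' * real (H j) * Q))" using w0 by (simp add: real_sqrt_mult)
  also have "(w j)\<^sup>2 * (real N' * real (H j) * Q) = (w j * real (H j)) * (real N' * (w j * Q))"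
    by (simp add: power2_eq_square)
  also have "sqrt \<dots> \<le> sqrt (1 * (real (r j) * (real R * real (r j) + real R * (real R * (real (r j) * B + real b)))))"
  proof (intro real_sqrt_le_mono mult_mono)
    show "w j * Q \<le> real R * real (r j) + real R * (real R * (real (r j) * B + real b))"
    proof (rule order_trans[OF Q_le], intro add_mono mult_left_mono)
      show "real N' * B \<le> real (r j) * B" using N'r B0 by (rule mult_right_mono)
    qed (use N'r in auto)
  qed (use Hw N'r Q0 w0 in auto)
  also have "1 * (real (r j) * (real R * real (r j) + real R * (real R * (real (r j) * B + real b)))) =
      (real R * real (r j))\<^sup>2 * (1 / real R + B + real b / real (r j))"
    using R r_pos[of j] by (simp add: power2_eq_square field_simps)
  also have "sqrt \<dots> = real R * real (r j) * sqrt (1 / real R + B + real b / real (r j))"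
    by (simp add: real_sqrt_mult)
  finally have main: "w j * (\<Sum>s<H j. \<Sum>i<N'. \<bar>U i s\<bar>) \<le> real R * real (r j) * sqrt (1 / real R + B + real b / real (r j))" .
  have "w j * (\<Sum>s<H j. \<bar>\<Sum>i<N. F i s\<bar>) \<le> w j * (\<Sum>s<H j. real (R * D) + (\<Sum>i<N'. \<bar>U i s\<bar>) / real R)"
    using step1 w0 by (intro mult_left_mono sum_mono)
  also have "\<dots> = (w j * real (H j)) * real (R * D) + w j * (\<Sum>s<H j. \<Sum>i<N'. \<bar>U i s\<bar>) / real R"
    by (simp add: sum.distrib distrib_left sum_divide_distrib[symmetric])
  also have "\<dots> \<le> 1 * real (R * D) + real R * real (r j) * sqrt (1 / real R + B + real b / real (r j)) / real R"
    using Hw main by (intro add_mono mult_right_mono divide_right_mono) auto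
  also have "\<dots> = real (R * D) + real (r j) * sqrt (1 / real R + B + real b / real (r j))" using R by simp
  finally have "w j * (\<Sum>s<H j. \<bar>\<Sum>i<N. F i s\<bar>) / real (r j) \<le>
      (real (R * D) + real (r j) * sqrt (1 / real R + B + real b / real (r j))) / real (r j)"
    by (intro divide_right_mono) auto
  then have "w (Suc j) * (\<Sum>s<H j. \<bar>\<Sum>i<N. F i s\<bar>) \<le> real (R * D) / real (r j) + sqrt (1 / real R + B + real b / real (r j))"
    using r_pos[of j] by (simp add: w_Suc[of j] add_divide_distrib)
  then show ?thesis using le by (simp add: F_def B_def)
qed

section \<open>The two ranges of times within a stage\<close>

context
  fixes n :: nat and f :: "'a \<Rightarrow> real"
  assumes f: "level_fun n f" and f0: "(\<integral>x. f x \<partial>M) = 0"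
begin

text \<open>\<open>D\<close> columns suffice to slide by a tower height. This number must be small
  against \<open>r j\<close>, and \<open>D / r j\<close> is at most
  \<open>4 * (H j)^2 / (m * r j) + 1 / r j \<le> 4 / Kc + 1 / r j\<close>, which is what the
  threshold provides. The differences of displacements stay below \<open>E = 12 * R\<close>
  independently of \<open>j\<close>, so \<open>b\<close> can be fixed in advance.\<close>

lemma column_sum_eventually_le_far:
  assumes e: "e > 0"
  obtains Kc :: nat where "\<forall>\<^sub>F j in sequentially. \<forall>m. m < H (Suc j) \<and> Kc * (H j)\<^sup>2 \<le> m * r j \<longrightarrow> column_sum f j m \<le> e"
proof -
  \<comment> \<open>This gives \<open>1 / R \<le> e^2 / 32\<close>; with
    \<open>4 * A = e^2 / 32\<close> below, the square root has a limit of at most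
    \<open>e / 4\<close>.\<close>
  define R where "R = nat \<lceil>32 / e\<^sup>2\<rceil>"
  have R: "real R \<ge> 32 / e\<^sup>2" unfolding R_def by linarith
  then have R0: "real R > 0" using e by (smt (verit) divide_pos_pos zero_less_power)
  then have R_inv: "1 / real R \<le> e\<^sup>2 / 32" using R e by (simp add: field_simps)
  \<comment> \<open>The part \<open>16 * R / e\<close> yields \<open>4 * R / Kc \<le> e / 4\<close>;
    the part 4 ensures \<open>m \<ge> 4 * H j\<close>.\<close>
  define Kc where "Kc = 4 + nat \<lceil>16 * real R / e\<rceil>"
  have Kc: "real Kc \<ge> 16 * real R / e" "Kc \<ge> 4" unfolding Kc_def by linarith+
  have Kc_inv: "4 * real R / real Kc \<le> e / 4"
  proof -
    have "real Kc > 0" using Kc(2) by simp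
    then show ?thesis using Kc(1) e by (simp add: field_simps)
  qed
  define A where "A = e\<^sup>2 / 128"
  have A0: "A > 0" using e by (simp add: A_def)
  have "\<forall>\<^sub>F b in sequentially. (\<forall>k\<in>{1..12 * R}. avg f k b \<le> A) \<and> b > 0"
    using A0 avg_tendsto[OF f f0] by (intro eventually_conj eventually_avg_le eventually_gt_at_top) auto
  then obtain b where "(\<forall>k\<in>{1..12 * R}. avg f k b \<le> A) \<and> b > 0"
    using eventually_happens'[OF sequentially_bot] by blast
  then have b: "b > 0" "\<And>k. 1 \<le> k \<Longrightarrow> k \<le> 12 * R \<Longrightarrow> avg f k b \<le> A" by auto
  define V where "V j = 1 / real (r j) + (4 * real R / real Kc + real R / real (r j)) +
     sqrt (1 / real R + (4 * A + ((48 * real b + 4) * (real (r j) / real (H j)) + 48 * real R * real b / real (H j))) + real b / real (r j))" for j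
  have "V \<longlonglongrightarrow> 0 + (4 * real R / real Kc + 0) + sqrt (1 / real R + (4 * A + ((48 * real b + 4) * 0 + 0)) + 0)"
    unfolding V_def by (intro tendsto_intros inverse_r_tendsto inverse_H_tendsto r_over_H)
  then have V: "V \<longlonglongrightarrow> 4 * real R / real Kc + sqrt (1 / real R + 4 * A)" by simp
  have "sqrt (1 / real R + 4 * A) \<le> e / 4"
  proof -
    have "sqrt (1 / real R + 4 * A) \<le> sqrt ((e / 4)\<^sup>2)"
      using R_inv by (intro real_sqrt_le_mono) (simp add: A_def power_divide)
    then show ?thesis using e by simp
  qed
  then have "\<forall>\<^sub>F j in sequentially. V j < e"
    using Kc_inv e by (intro order_tendstoD(2)[OF V]) linarith
  then have "\<forall>\<^sub>F j in sequentially. \<forall>m. m < H (Suc j) \<and> Kc * (H j)\<^sup>2 \<le> m * r j \<longrightarrow> column_sum f j m \<le> e"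
    using r_le_H eventually_ge_at_top[of n]
  proof eventually_elim
    case (elim j)
    show ?case
    proof (intro allI impI, elim conjE)
      fix m assume m: "m < H (Suc j)" "Kc * (H j)\<^sup>2 \<le> m * r j"
      have "4 * H j * r j \<le> 4 * H j * H j" using elim(2) by simp
      also have "\<dots> \<le> Kc * (H j)\<^sup>2" using Kc(2) by (simp add: power2_eq_square)
      finally have "4 * H j * r j \<le> m * r j" using m(2) by linarith
      then have m4: "4 * H j \<le> m" using r_pos[of j] by simp
      have m2: "m < 2 * r j * H j" using m(1) H_Suc_le[OF elim(2)] by linarith
      have m_pos: "m > 0" using m4 H_pos[of j] by linarith
      \<comment> \<open>The 4 is what \<open>low\<close> needs: every possible displacement
        satisfies \<open>m \<le> 4 * k * H j\<close>, so \<open>4 * (H j)^2 \<le> m * D\<close>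
        gives \<open>H j \<le> k * D\<close>.\<close>
      obtain D where D: "4 * (H j)\<^sup>2 \<le> m * D" "m * D < 4 * (H j)\<^sup>2 + m"
        using exists_multiple_between[OF m_pos] by blast
      define K where "K = m div H j + 1"
      have KH: "K * H j \<le> 2 * m"
      proof -
        have "m div H j * H j \<le> m" by simp
        then show ?thesis using m4 unfolding K_def add_mult_distrib by linarith
      qed
      have K: "k \<le> K" if "k * H j < H j + m" for k
      proof -
        have "m < Suc (m div H j) * H j" using dividend_less_div_times[OF H_pos[of j], of m] by (simp add: add.commute)
        then have "k * H j < (K + 1) * H j" using that by (simp add: K_def)
        then have "k < K + 1" by (simp only: mult_less_cancel2)
        then show ?thesis by simp
      qed
      have low: "H j \<le> k * D" if "m < Suc k * (H j + r j)" for k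
      proof -
        have "Suc k * (H j + r j) \<le> Suc k * (2 * H j)" using elim(2) by (intro mult_le_mono2) simp
        then have mk: "m < Suc k * (2 * H j)" using that by linarith
        have "k \<noteq> 0"
        proof
          assume "k = 0"
          then show False using mk m4 by simp
        qed
        then have "Suc k * (2 * H j) \<le> (2 * k) * (2 * H j)" by (intro mult_le_mono1) simp
        moreover have "(2 * k) * (2 * H j) = 4 * k * H j" by simp
        ultimately have "m \<le> 4 * k * H j" using mk by linarith
        then have "m * D \<le> (4 * k * H j) * D" by (rule mult_le_mono1)
        moreover have "(4 * k * H j) * D = (4 * H j) * (k * D)" by simp
        moreover have "4 * (H j)\<^sup>2 = (4 * H j) * H j" by (simp add: power2_eq_square)
        ultimately have "(4 * H j) * H j \<le> (4 * H j) * (k * D)" using D(1) by linarith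
        then show ?thesis using H_pos[of j] by simp
      qed
      \<comment> \<open>The 12 is \<open>8 + 4\<close>: twice \<open>4 * (H j)^2\<close> from the
        choice of \<open>D\<close>, and \<open>2 * m\<close> with
        \<open>m < 2 * r j * H j \<le> 2 * (H j)^2\<close>.\<close>
      have up: "K * (R * D) \<le> (12 * R) * H j"
      proof -
        have "(K * D) * H j \<le> 2 * (m * D)" using mult_le_mono1[OF KH, of D] by (simp add: ac_simps)
        also have "\<dots> \<le> 8 * (H j)\<^sup>2 + 2 * m" using D(2) by linarith
        also have "\<dots> \<le> 8 * (H j)\<^sup>2 + 2 * (2 * H j * H j)"
        proof -
          have "2 * r j * H j \<le> 2 * H j * H j" using elim(2) by simp
          then show ?thesis using m2 by linarith
        qed
        also have "\<dots> = (12 * H j) * H j" by (simp add: power2_eq_square)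
        finally have "K * D \<le> 12 * H j" using H_pos[of j] by (simp only: mult_le_cancel2)
        then have "R * (K * D) \<le> R * (12 * H j)" by (rule mult_le_mono2)
        then show ?thesis by (simp add: ac_simps)
      qed
      have "K * H j < (4 * r j) * H j" using KH m2 by linarith
      then have "K < 4 * r j" by (simp only: mult_less_cancel2)
      then have K4: "K \<le> 4 * r j" by simp
      have "column_sum f j m \<le> 1 / real (r j) + real (R * D) / real (r j) +
         sqrt (1 / real R + (4 * A + (12 * real (K * b) + 4 * real (12 * R * b) + 4 * real (r j)) / real (H j)) + real b / real (r j))"
        using R0 A0 by (intro column_sum_le_separated[OF f elim(3) b(1) _ K low up _ b(2)]) auto
      also have "\<dots> \<le> V j"
        unfolding V_def
      proof (intro add_mono order_refl real_sqrt_le_mono)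
        have div: "4 * x / a \<le> 4 / k" if "k * x \<le> a" "a > 0" "k > 0" for x a k :: real
          using that by (simp add: field_simps)
        have "real (Kc * (H j)\<^sup>2) \<le> real (m * r j)" using m(2) by (rule of_nat_mono)
        then have "4 * (real (H j))\<^sup>2 / (real m * real (r j)) \<le> 4 / real Kc"
          using m_pos r_pos[of j] Kc(2) by (intro div) auto
        moreover have "real m * real D \<le> 4 * (real (H j))\<^sup>2 + real m"
          using of_nat_mono[OF less_imp_le[OF D(2)], where 'a = real] by simp
        then have "real D \<le> (4 * (real (H j))\<^sup>2 + real m) / real m"
          using m_pos by (simp add: field_simps)
        then have "real D / real (r j) \<le> (4 * (real (H j))\<^sup>2 + real m) / real m / real (r j)"
          by (rule divide_right_mono) simp
        then have "real D / real (r j) \<le> 4 * (real (H j))\<^sup>2 / (real m * real (r j)) + 1 / real (r j)"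
          using m_pos by (simp add: add_divide_distrib)
        ultimately have "real D / real (r j) \<le> 4 / real Kc + 1 / real (r j)" by linarith
        then have "real R * (real D / real (r j)) \<le> real R * (4 / real Kc + 1 / real (r j))"
          by (rule mult_left_mono) simp
        then show "real (R * D) / real (r j) \<le> 4 * real R / real Kc + real R / real (r j)"
          by (simp add: distrib_left ac_simps)
        have "K * b \<le> (4 * r j) * b" using K4 by (rule mult_le_mono1)
        from of_nat_mono[OF this, where 'a = real] have "real (K * b) \<le> 4 * real (r j) * real b"
          by simp
        then have "12 * real (K * b) + 4 * real (12 * R * b) + 4 * real (r j) \<le>
            (48 * real b + 4) * real (r j) + 48 * real R * real b" by (simp add: algebra_simps)
        then have "(12 * real (K * b) + 4 * real (12 * R * b) + 4 * real (r j)) / real (H j) \<le>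
            ((48 * real b + 4) * real (r j) + 48 * real R * real b) / real (H j)"
          by (rule divide_right_mono) simp
        then show "(12 * real (K * b) + 4 * real (12 * R * b) + 4 * real (r j)) / real (H j) \<le>
            (48 * real b + 4) * (real (r j) / real (H j)) + 48 * real R * real b / real (H j)"
          by (simp add: add_divide_distrib)
      qed
      finally show "column_sum f j m \<le> e" using elim(1) by simp
    qed
  qed
  then show ?thesis by (rule that)
qed

text \<open>The window is a fixed fraction \<open>b = r j div Q\<close> of the columns. Sliding over
  it moves a level by about \<open>m * b / H j\<close>, at most a small fraction of
  \<open>H j\<close> by the bound on \<open>m * r j\<close>. Displacements stay below
  \<open>4 * r j \<le> 8 * Q * b\<close>, a fixed multiple of the window, as
  \<open>avg_uniform\<close> permits.\<close>

lemma column_sum_eventually_le_near: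
  assumes e: "e > 0"
  shows "\<forall>\<^sub>F j in sequentially. \<forall>m. H j \<le> m \<and> m < H (Suc j) \<and> m * r j \<le> Kc * (H j)\<^sup>2 \<longrightarrow> column_sum f j m \<le> e"
proof -
  \<comment> \<open>The numerator collects \<open>1 / Q\<close> from the incomplete window and
    \<open>4 * Kc / Q\<close> from the levels lost at the bottom of columns.\<close>
  define Q where "Q = nat \<lceil>4 * (1 + 4 * real Kc) / e\<rceil>"
  have Q: "real Q \<ge> 4 * (1 + 4 * real Kc) / e" unfolding Q_def by linarith
  have "4 * (1 + 4 * real Kc) / e > 0" using e by (intro divide_pos_pos) auto
  then have Q0: "real Q > 0" using Q by linarith
  have Q_inv: "(1 + 4 * real Kc) / real Q \<le> e / 4" using Q Q0 e by (simp add: field_simps)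
  have bQ: "filterlim (\<lambda>j. r j div Q) at_top sequentially"
  proof (rule filterlim_compose[OF _ r_top])
    show "filterlim (\<lambda>x. x div Q) at_top sequentially"
      unfolding filterlim_at_top
    proof
      fix Z show "\<forall>\<^sub>F x in sequentially. Z \<le> x div Q"
        using eventually_ge_at_top[of "Z * Q"]
        by eventually_elim (use Q0 in \<open>simp add: less_eq_div_iff_mult_less_eq\<close>)
    qed
  qed
  have "\<forall>\<^sub>F b in sequentially. (\<forall>k. 1 \<le> k \<and> k \<le> (8 * Q) * b \<longrightarrow> avg f k b \<le> e / 8) \<and> b > 0"
    using e by (intro eventually_conj avg_uniform[OF f f0] eventually_gt_at_top) auto
  then have "\<forall>\<^sub>F j in sequentially. (\<forall>k. 1 \<le> k \<and> k \<le> (8 * Q) * (r j div Q) \<longrightarrow> avg f k (r j div Q) \<le> e / 8) \<and> r j div Q > 0"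
    by (rule eventually_compose_filterlim[OF _ bQ])
  moreover have "\<forall>\<^sub>F j in sequentially. 1 / real (r j) + 2 * (real (r j) / real (H j)) < e / 4"
  proof -
    have "(\<lambda>j. 1 / real (r j) + 2 * (real (r j) / real (H j))) \<longlonglongrightarrow> 0 + 2 * 0"
      by (intro tendsto_intros inverse_r_tendsto r_over_H)
    from order_tendstoD(2)[OF this, of "e / 4"] show ?thesis using e by simp
  qed
  ultimately show ?thesis
    using r_le_H eventually_ge_at_top[of n]
  proof eventually_elim
    case (elim j)
    define b where "b = r j div Q"
    have b: "b > 0" and avg: "\<And>k. 1 \<le> k \<Longrightarrow> k \<le> (8 * Q) * b \<Longrightarrow> avg f k b \<le> e / 8"
      using elim(1) by (auto simp: b_def)
    have bQ: "b * Q \<le> r j" by (simp add: b_def)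
    have rb: "r j \<le> 2 * Q * b"
    proof -
      have "r j < Suc b * Q" using dividend_less_div_times[of Q "r j"] Q0 by (simp add: b_def add.commute)
      also have "\<dots> \<le> (2 * b) * Q" using b by (intro mult_le_mono1) simp
      finally show ?thesis by (simp add: ac_simps)
    qed
    show ?case
    proof (intro allI impI, elim conjE)
      fix m assume m: "H j \<le> m" "m < H (Suc j)" "m * r j \<le> Kc * (H j)\<^sup>2"
      have m2: "m < 2 * r j * H j" using m(2) H_Suc_le[OF elim(3)] by linarith
      have "column_sum f j m \<le> 1 / real (r j) + real b / real (r j) + real 0 / real (H j) +
         2 * (e / 8 + (2 * real m * real b / real (H j) + real (r j)) / real (H j))"
      proof (rule column_sum_le_avg[OF f elim(4) m(1) b])
        fix k assume k: "1 \<le> k" "k * H j + 0 < H j + m"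
        have "k * H j < (4 * r j) * H j" using k(2) m(1) m2 by linarith
        then have "k < 4 * r j" by (simp only: mult_less_cancel2)
        then have "k \<le> (8 * Q) * b" using rb by linarith
        then show "avg f k b \<le> e / 8" by (rule avg[OF k(1)])
      qed (use e in simp)
      also have "real b / real (r j) \<le> 1 / real Q"
        using bQ Q0 r_pos[of j] by (simp add: field_simps flip: of_nat_mult)
      also have "(2 * real m * real b / real (H j) + real (r j)) / real (H j) \<le> 2 * real Kc / real Q + real (r j) / real (H j)"
      proof -
        have "real m * real b * real Q \<le> real m * real (r j)"
          using mult_left_mono[OF of_nat_mono[OF bQ, where 'a = real], of "real m"] by (simp add: mult.assoc)
        also have "\<dots> \<le> real Kc * (real (H j))\<^sup>2"
          using m(3) by (metis of_nat_le_iff of_nat_mult of_nat_power)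
        finally have "real m * real b / (real (H j))\<^sup>2 \<le> real Kc / real Q"
          using Q0 H_pos[of j] by (simp add: field_simps)
        then show ?thesis by (simp add: add_divide_distrib power2_eq_square)
      qed
      finally have "column_sum f j m \<le> (1 / real (r j) + 2 * (real (r j) / real (H j))) + (1 + 4 * real Kc) / real Q + e / 4"
        by (simp add: add_divide_distrib)
      then show "column_sum f j m \<le> e" using elim(2) Q_inv e by linarith
    qed
  qed
qed

text \<open>Every large \<open>m\<close> lies in some \<open>H j ..< H (Suc j)\<close>, and the two
  ranges of \<open>m * r j\<close> overlap. The function \<open>g\<close> is not centred, since the
  column sums involve \<open>f\<close> alone.\<close>

lemma corr_tendsto:
  assumes g: "level_fun n g"
  shows "corr f g \<longlonglongrightarrow> 0"
proof (rule tendstoI)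
  fix e :: real assume e: "e > 0"
  obtain Kc where "\<forall>\<^sub>F j in sequentially. \<forall>m. m < H (Suc j) \<and> Kc * (H j)\<^sup>2 \<le> m * r j \<longrightarrow> column_sum f j m \<le> e / 2"
    using column_sum_eventually_le_far[of "e / 2"] e by auto
  moreover have "\<forall>\<^sub>F j in sequentially. \<forall>m. H j \<le> m \<and> m < H (Suc j) \<and> m * r j \<le> Kc * (H j)\<^sup>2 \<longrightarrow> column_sum f j m \<le> e / 2"
    using e by (intro column_sum_eventually_le_near) auto
  moreover have "\<forall>\<^sub>F j in sequentially. stage_error f j < e / 2"
    using order_tendstoD(2)[OF stage_error_tendsto[OF f f0], of "e / 2"] e by simp
  ultimately have "\<forall>\<^sub>F j in sequentially. \<forall>m. H j \<le> m \<and> m < H (Suc j) \<longrightarrow> \<bar>corr f g m\<bar> < e"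
    using eventually_ge_at_top[of n]
  proof eventually_elim
    case (elim j)
    show ?case
    proof (intro allI impI, elim conjE)
      fix m assume m: "H j \<le> m" "m < H (Suc j)"
      then have "column_sum f j m \<le> e / 2" using elim(1,2) by (meson nat_le_linear)
      then show "\<bar>corr f g m\<bar> < e" using corr_le_column_sum[OF f g elim(4) m(2)] elim(3) by linarith
    qed
  qed
  then obtain P where P: "\<And>j m. j \<ge> P \<Longrightarrow> H j \<le> m \<Longrightarrow> m < H (Suc j) \<Longrightarrow> \<bar>corr f g m\<bar> < e"
    unfolding eventually_sequentially by blast
  show "\<forall>\<^sub>F m in sequentially. dist (corr f g m) 0 < e"
    using eventually_ge_at_top[of "H P"]
  proof eventually_elim
    case (elim m)
    obtain j where "P \<le> j" "H j \<le> m" "m < H (Suc j)" by (rule exists_stage[OF elim])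
    then show ?case using P by (simp add: dist_real_def)
  qed
qed

end

end

section \<open>From levels to measurable sets\<close>

context stair_system
begin

definition level_union :: "nat \<Rightarrow> nat set \<Rightarrow> 'a set" where
  "level_union j Y = (\<Union>y\<in>Y. L j y)"

text \<open>A level of the next stage is either a piece of a level of the present one or a spacer,
  and a spacer is disjoint from all earlier towers.\<close>

lemma level_subset_or_disjoint:
  assumes Y: "Y \<subseteq> {..<H n}" and "n \<le> j" "y < H j"
  shows "L j y \<subseteq> level_union n Y \<or> L j y \<inter> level_union n Y = {}"
  using assms(2,3)
proof (induction j arbitrary: y rule: dec_induct)
  case base
  show ?case
  proof (cases "y \<in> Y")
    case False
    then have "L n y \<inter> L n y' = {}" if "y' \<in> Y" for y' using L_disjoint[of y n y'] base Y that by auto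
    then show ?thesis by (auto simp: level_union_def)
  qed (auto simp: level_union_def)
next
  case (step j)
  show ?case
  proof (cases "\<exists>i<r j. \<exists>s<H j. y = offset (H j) i + s")
    case True
    then obtain i s where "i < r j" "s < H j" "y = offset (H j) i + s" by blast
    then show ?thesis using step.IH[of s] L_refine_subset[of s j i] by blast
  next
    case False
    have tower: "level_union n Y \<subseteq> (\<Union>s<H j. L j s)"
      using \<open>n \<le> j\<close>
    proof (induction j rule: dec_induct)
      case base
      then show ?case using Y by (auto simp: level_union_def)
    next
      case (step k)
      have "(\<Union>s<H k. L k s) \<subseteq> (\<Union>s<H (Suc k). L (Suc k) s)"
        using L_refine[of _ k] offset_less[of _ k] by fastforce
      then show ?case using step.IH by blast
    qed
    have "L (Suc j) y \<inter> L j s = {}" if s: "s < H j" for s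
    proof -
      have "L (Suc j) y \<inter> L (Suc j) (offset (H j) i + s) = {}" if "i < r j" for i
        using False s that by (intro L_disjoint step.prems offset_less) auto
      then show ?thesis using L_refine[OF s] by auto
    qed
    then show ?thesis using tower by blast
  qed
qed

lemma level_union_sets: "Y \<subseteq> {..<H n} \<Longrightarrow> level_union n Y \<in> sets M"
  unfolding level_union_def by (rule levels_union_measure)

text \<open>The constant \<open>c\<close> is the measure of the union for the centred factor and 0
  for the other one.\<close>

lemma level_fun_indicator:
  assumes Y: "Y \<subseteq> {..<H n}" and c: "0 \<le> c" "c \<le> 1"
  shows "level_fun n (\<lambda>x. indicator (level_union n Y) x - c)"
  unfolding level_fun_def
proof (intro conjI allI impI ballI)
  show "(\<lambda>x. indicator (level_union n Y) x - c) \<in> borel_measurable M"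
    using level_union_sets[OF Y] by measurable
  show "\<bar>indicator (level_union n Y) x - c\<bar> \<le> 1" for x
    using c by (auto simp: indicator_def)
  fix j y x x' assume "n \<le> j" "y < H j" "x \<in> L j y" "x' \<in> L j y"
  then have "x \<in> level_union n Y \<longleftrightarrow> x' \<in> level_union n Y"
    using level_subset_or_disjoint[OF Y, of j y] by blast
  then show "indicator (level_union n Y) x - c = indicator (level_union n Y) x' - c"
    by (simp add: indicator_def)
qed

lemma measure_vimage_Int_eq_corr:
  assumes A: "A \<in> sets M" and B: "B \<in> sets M"
  shows "measure M ((T ^^ m) -` A \<inter> space M \<inter> B) - measure M A * measure M B
    = corr (\<lambda>x. indicator A x - measure M A) (indicator B) m"
proof -
  note [measurable] = A B
  have TA: "(T ^^ m) -` A \<inter> space M \<in> sets M" using measurable_sets[OF Tn_measurable A] .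
  have "corr (\<lambda>x. indicator A x - measure M A) (indicator B) m =
     (\<integral>x. indicator ((T ^^ m) -` A \<inter> space M \<inter> B) x - measure M A * indicator B x \<partial>M)"
    unfolding corr_def by (intro Bochner_Integration.integral_cong) (auto simp: indicator_def)
  also have "\<dots> = (\<integral>x. indicator ((T ^^ m) -` A \<inter> space M \<inter> B) x \<partial>M) - (\<integral>x. measure M A * indicator B x \<partial>M)"
  proof (rule Bochner_Integration.integral_diff)
    show "integrable M (indicator ((T ^^ m) -` A \<inter> space M \<inter> B) :: 'a \<Rightarrow> real)"
      using TA B by (intro integrable_bounded[of _ 1]) auto
    show "integrable M (\<lambda>x. measure M A * indicator B x)"
      by (intro integrable_bounded[of _ "measure M A"]) (auto simp: indicator_def)
  qed
  also have "\<dots> = measure M ((T ^^ m) -` A \<inter> space M \<inter> B) - measure M A * measure M B"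
    using TA B sets.sets_into_space[OF B] by (simp add: Int_absorb2 Int_assoc)
  finally show ?thesis by simp
qed

lemma mixing_level_unions:
  assumes Y: "Y \<subseteq> {..<H n}" and Z: "Z \<subseteq> {..<H n}"
  shows "(\<lambda>m. measure M ((T ^^ m) -` level_union n Y \<inter> space M \<inter> level_union n Z))
    \<longlonglongrightarrow> measure M (level_union n Y) * measure M (level_union n Z)"
proof -
  let ?A = "level_union n Y" and ?B = "level_union n Z"
  have A: "?A \<in> sets M" and B: "?B \<in> sets M" using level_union_sets Y Z by auto
  have f: "level_fun n (\<lambda>x. indicator ?A x - measure M ?A)"
    using Y by (intro level_fun_indicator) auto
  have g: "level_fun n (indicator ?B)" using level_fun_indicator[OF Z, of 0] by simp
  have "(\<integral>x. indicator ?A x - measure M ?A \<partial>M) = 0"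
    using A sets.sets_into_space[OF A]
    by (subst Bochner_Integration.integral_diff) (auto simp: prob_space Int_absorb2 less_top[symmetric])
  from corr_tendsto[OF f this g]
  have "(\<lambda>m. measure M ((T ^^ m) -` ?A \<inter> space M \<inter> ?B) - measure M ?A * measure M ?B) \<longlonglongrightarrow> 0"
    unfolding measure_vimage_Int_eq_corr[OF A B] by simp
  then show ?thesis by (simp only: LIM_zero_iff)
qed

lemma measure_diff_le_sym_diff:
  assumes "A \<in> sets M" "B \<in> sets M"
  shows "\<bar>measure M A - measure M B\<bar> \<le> measure M (sym_diff A B)"
proof -
  have "measure M A \<le> measure M (B \<union> sym_diff A B)" "measure M B \<le> measure M (A \<union> sym_diff A B)"
    using assms by (auto intro!: finite_measure_mono)
  moreover have "measure M (B \<union> sym_diff A B) \<le> measure M B + measure M (sym_diff A B)"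
     "measure M (A \<union> sym_diff A B) \<le> measure M A + measure M (sym_diff A B)"
    using assms by (auto intro!: measure_Un_le)
  ultimately show ?thesis by linarith
qed

text \<open>Approximability depends on the geometry of the levels and is therefore a premise here;
  its eventual form lets \<open>A\<close> and \<open>B\<close> be approximated at one common stage.
  Two approximations enter the correlation, two the product of measures, and the fifth part of
  \<open>e\<close> is for the convergence.\<close>

lemma mixing_measurable_sets:
  assumes approx: "\<And>A e. A \<in> sets M \<Longrightarrow> e > 0 \<Longrightarrow>
      \<forall>\<^sub>F n in sequentially. \<exists>Y\<subseteq>{..<H n}. measure M (sym_diff A (level_union n Y)) < e"
    and A: "A \<in> sets M" and B: "B \<in> sets M"
  shows "(\<lambda>m. measure M ((T ^^ m) -` A \<inter> space M \<inter> B)) \<longlonglongrightarrow> measure M A * measure M B"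
proof (rule tendstoI)
  fix e :: real assume e: "e > 0"
  have "\<forall>\<^sub>F n in sequentially. (\<exists>Y\<subseteq>{..<H n}. measure M (sym_diff A (level_union n Y)) < e / 5) \<and>
      (\<exists>Y\<subseteq>{..<H n}. measure M (sym_diff B (level_union n Y)) < e / 5)"
    using e by (intro eventually_conj approx A B) auto
  then obtain n Y Z where YZ: "Y \<subseteq> {..<H n}" "Z \<subseteq> {..<H n}"
     "measure M (sym_diff A (level_union n Y)) < e / 5" "measure M (sym_diff B (level_union n Z)) < e / 5"
    using eventually_happens'[OF sequentially_bot] by blast
  define A' where "A' = level_union n Y"
  define B' where "B' = level_union n Z"
  have A': "A' \<in> sets M" and B': "B' \<in> sets M" using level_union_sets YZ by (auto simp: A'_def B'_def)
  let ?V = "\<lambda>m C. (T ^^ m) -` C \<inter> space M"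
  have V: "C \<in> sets M \<Longrightarrow> ?V m C \<in> sets M" for m C by (rule measurable_sets[OF Tn_measurable])
  have V_measure: "measure M (?V m C) = measure M C" if "C \<in> sets M" for m C
    using measure_distr[OF Tn_measurable that, of m] by (simp add: Tn_preserves)
  have near: "\<bar>measure M (?V m A \<inter> B) - measure M (?V m A' \<inter> B')\<bar> \<le> 2 * e / 5" for m
  proof -
    have "\<bar>measure M (?V m A \<inter> B) - measure M (?V m A' \<inter> B')\<bar> \<le> measure M (sym_diff (?V m A \<inter> B) (?V m A' \<inter> B'))"
      using V A A' B B' by (intro measure_diff_le_sym_diff) auto
    also have "\<dots> \<le> measure M (?V m (sym_diff A A') \<union> sym_diff B B')"
      using V[of "sym_diff A A'" m] A A' B B' by (intro finite_measure_mono) auto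
    also have "\<dots> \<le> measure M (?V m (sym_diff A A')) + measure M (sym_diff B B')"
      using V[of "sym_diff A A'" m] A A' B B' by (intro measure_Un_le) auto
    also have "measure M (?V m (sym_diff A A')) = measure M (sym_diff A A')"
      using A A' by (intro V_measure) auto
    finally show ?thesis using YZ(3,4) by (simp add: A'_def B'_def)
  qed
  have "\<bar>measure M A * measure M B - measure M A' * measure M B'\<bar> \<le> 2 * e / 5"
  proof -
    have "measure M A * measure M B - measure M A' * measure M B' =
       (measure M A - measure M A') * measure M B + measure M A' * (measure M B - measure M B')"
      by (simp add: algebra_simps)
    also have "\<bar>\<dots>\<bar> \<le> \<bar>measure M A - measure M A'\<bar> * measure M B + measure M A' * \<bar>measure M B - measure M B'\<bar>"
      by (rule order_trans[OF abs_triangle_ineq]) (simp add: abs_mult)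
    also have "\<dots> \<le> \<bar>measure M A - measure M A'\<bar> * 1 + 1 * \<bar>measure M B - measure M B'\<bar>"
      by (intro add_mono mult_left_mono mult_right_mono) auto
    finally show ?thesis
      using measure_diff_le_sym_diff[OF A A'] measure_diff_le_sym_diff[OF B B'] YZ(3,4) by (simp add: A'_def B'_def)
  qed
  moreover have "\<forall>\<^sub>F m in sequentially. dist (measure M (?V m A' \<inter> B')) (measure M A' * measure M B') < e / 5"
    using e mixing_level_unions[OF YZ(1,2)] by (intro tendstoD) (auto simp: A'_def B'_def)
  ultimately show "\<forall>\<^sub>F m in sequentially. dist (measure M (?V m A \<inter> B)) (measure M A * measure M B) < e"
  proof (elim eventually_mono)
    fix m assume "\<bar>measure M A * measure M B - measure M A' * measure M B'\<bar> \<le> 2 * e / 5"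
      "dist (measure M (?V m A' \<inter> B')) (measure M A' * measure M B') < e / 5"
    then show "dist (measure M (?V m A \<inter> B)) (measure M A * measure M B) < e"
      using near[of m] unfolding dist_real_def by linarith
  qed
qed

end

section \<open>The staircase transformation\<close>

text \<open>Stages and columns are renumbered from 0 here: \<open>height j\<close>, \<open>cuts_of j\<close>, \<open>width j\<close>
  belong to the paper's stage \<open>j + 1\<close>, and \<open>height\<close> counts levels.\<close>

context staircase
begin

definition height :: "nat \<Rightarrow> nat" where
  "height j = stair_height h1 r (Suc j) + 1"

definition cuts_of :: "nat \<Rightarrow> nat" where
  "cuts_of j = r (Suc j)"

definition width :: "nat \<Rightarrow> real" where
  "width j = stair_width r w (Suc j)"

definition base :: "nat \<Rightarrow> real set" where
  "base j = stair_base r a w (Suc j)"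

definition level :: "nat \<Rightarrow> nat \<Rightarrow> real set" where
  "level j y = (T ^^ y) ` base j"

abbreviation X :: "real set" where
  "X \<equiv> stair_space h1 r a w T"

lemma cuts_of_ge: "cuts_of j \<ge> 2"
  unfolding cuts_of_def by (rule cuts) simp

lemma height_pos: "height j > 0"
  by (simp add: height_def)

lemma height_Suc: "height (Suc j) = offset (height j) (cuts_of j)"
proof -
  have "(\<Sum>i = 1..r (Suc j) - 1. i) = (\<Sum>i<r (Suc j). i)"
    by (rule sum.mono_neutral_left) auto
  moreover have "(stair_height h1 r (Suc j) + 1) * r (Suc j) > 0"
    using cuts[of "Suc j"] by simp
  moreover have "offset h R = h * R + (\<Sum>i<R. i)" for h R
    by (simp add: offset_def sum.distrib)
  ultimately show ?thesis
    unfolding height_def cuts_of_def by simp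
qed

lemma width_pos': "width j > 0"
proof -
  have "(\<Prod>i = 1..<Suc j. real (r i)) > 0"
    by (rule prod_pos) (use cuts in \<open>auto intro: less_le_trans[of 0 "2::nat"]\<close>)
  then show ?thesis unfolding width_def stair_width_def using width_pos by (rule divide_pos_pos[rotated])
qed

lemma width_Suc: "width j = real (cuts_of j) * width (Suc j)"
  using cuts_of_ge[of j] by (simp add: width_def stair_width_def cuts_of_def prod.atLeastLessThan_Suc)

lemma cut_eq: "stair_cut r a w (Suc j) (Suc i) = {a + real i * width (Suc j) ..< a + real (Suc i) * width (Suc j)}"
  by (simp add: stair_cut_def width_def)

lemma base_eq: "base j = {a ..< a + width j}"
  by (simp add: base_def stair_base_def width_def)

lemma base_Suc: "base (Suc j) = stair_cut r a w (Suc j) (Suc 0)"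
  by (simp add: base_eq cut_eq)

lemma base_cuts: "base j = (\<Union>i<cuts_of j. stair_cut r a w (Suc j) (Suc i))"
proof (intro set_eqI iffI)
  fix x assume x: "x \<in> base j"
  define W where "W = width (Suc j)"
  have W: "W > 0" using width_pos' by (simp add: W_def)
  define i where "i = nat \<lfloor>(x - a) / W\<rfloor>"
  have x0: "(x - a) / W \<ge> 0" using x W by (simp add: base_eq)
  have i: "real i \<le> (x - a) / W" "(x - a) / W < real i + 1"
    unfolding i_def using x0 by (simp_all add: of_nat_nat)
  have "(x - a) / W < real (cuts_of j)" using x W by (simp add: base_eq width_Suc[of j] W_def field_simps)
  then have "i < cuts_of j" using i by linarith
  moreover have "x \<in> stair_cut r a w (Suc j) (Suc i)"
    using i W by (simp add: cut_eq W_def field_simps)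
  ultimately show "x \<in> (\<Union>i<cuts_of j. stair_cut r a w (Suc j) (Suc i))" by blast
next
  fix x assume "x \<in> (\<Union>i<cuts_of j. stair_cut r a w (Suc j) (Suc i))"
  then obtain i where i: "i < cuts_of j" and x: "x \<in> stair_cut r a w (Suc j) (Suc i)" by blast
  have W: "width (Suc j) > 0" by (rule width_pos')
  have "real (Suc i) * width (Suc j) \<le> real (cuts_of j) * width (Suc j)"
    using i W by (intro mult_right_mono) auto
  moreover have "real i * width (Suc j) \<ge> 0" using W by simp
  ultimately show "x \<in> base j" using x by (simp add: base_eq cut_eq width_Suc[of j])
qed

text \<open>The stacking rule reaches the next cut in \<open>height j + i\<close> steps, the number
  of levels of column \<open>i\<close> counted from 0; these numbers add up to the offset.\<close>

lemma cut_eq_image: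
  "i < cuts_of j \<Longrightarrow> stair_cut r a w (Suc j) (Suc i) = (T ^^ offset (height j) i) ` base (Suc j)"
proof (induction i)
  case 0
  then show ?case by (simp add: base_Suc)
next
  case (Suc i)
  have "stair_cut r a w (Suc j) (Suc i + 1) = (T ^^ (stair_height h1 r (Suc j) + Suc i)) ` stair_cut r a w (Suc j) (Suc i)"
    using Suc.prems by (intro stack_onto[symmetric]) (auto simp: cuts_of_def)
  also have "stair_height h1 r (Suc j) + Suc i = height j + i" by (simp add: height_def)
  also have "(T ^^ (height j + i)) ` stair_cut r a w (Suc j) (Suc i) = (T ^^ (height j + i)) ` (T ^^ offset (height j) i) ` base (Suc j)"
    using Suc by simp
  also have "\<dots> = (T ^^ ((height j + i) + offset (height j) i)) ` base (Suc j)"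
    by (simp only: funpow_add image_comp)
  finally show ?case by (simp add: offset_Suc ac_simps)
qed

lemma level_refine: "level j y = (\<Union>i<cuts_of j. level (Suc j) (offset (height j) i + y))"
proof -
  have "level j y = (\<Union>i<cuts_of j. (T ^^ y) ` (T ^^ offset (height j) i) ` base (Suc j))"
    unfolding level_def base_cuts[of j] image_UN using cut_eq_image[of _ j]
    by (intro SUP_cong refl) (simp only: lessThan_iff)
  also have "\<dots> = (\<Union>i<cuts_of j. level (Suc j) (offset (height j) i + y))"
    unfolding level_def image_comp funpow_add[symmetric] by (simp add: add.commute)
  finally show ?thesis .
qed

section \<open>Levels as translated intervals\<close>

lemma level_disjoint: "y < height j \<Longrightarrow> y' < height j \<Longrightarrow> y \<noteq> y' \<Longrightarrow> level j y \<inter> level j y' = {}"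
  using tower_disjoint[of "Suc j"] unfolding disjoint_family_on_def level_def base_def height_def by simp

lemma level_translation: "y < height j \<Longrightarrow> \<exists>c. \<forall>x\<in>base j. (T ^^ y) x = x + c"
proof (induction y)
  case 0
  show ?case by (rule exI[of _ 0]) simp
next
  case (Suc y)
  then obtain c where c: "\<forall>x\<in>base j. (T ^^ y) x = x + c" by auto
  have "translates_on T (level j y)"
    unfolding level_def base_def using Suc.prems by (intro tower_translates) (auto simp: height_def)
  then obtain d where "\<forall>x\<in>level j y. T x = x + d" by (auto simp: translates_on_def)
  then have "\<forall>x\<in>base j. (T ^^ Suc y) x = x + (c + d)" using c by (auto simp: level_def)
  then show ?case by blast
qed

lemma T_translates_level: "Suc y < height j \<Longrightarrow> \<exists>c. \<forall>x\<in>level j y. T x = x + c"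
  using tower_translates[of "Suc j" y] by (simp add: height_def translates_on_def level_def base_def)

lemma level_interval: "y < height j \<Longrightarrow> \<exists>c. level j y = {c ..< c + width j}"
proof -
  assume "y < height j"
  then obtain c where "\<forall>x\<in>base j. (T ^^ y) x = x + c" using level_translation by blast
  then have "level j y = (\<lambda>x. x + c) ` base j" unfolding level_def by (intro image_cong) auto
  also have "\<dots> = {a + c ..< a + c + width j}"
    by (simp add: base_eq image_add_atLeastLessThan' ac_simps)
  finally show ?thesis by blast
qed

lemma level_lebesgue: "y < height j \<Longrightarrow> level j y \<in> sets lebesgue"
  using level_interval[of y j] by auto

lemma level_lebesgue_measure: "y < height j \<Longrightarrow> measure lebesgue (level j y) = width j"
  using level_interval[of y j] width_pos'[of j] by (auto simp: less_imp_le)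

lemma X_eq: "X = (\<Union>j. \<Union>y<height j. level j y)"
proof -
  have "{1..} = range Suc" by (auto simp: image_iff dest: Suc_le_D)
  moreover have "{0..stair_height h1 r (Suc j)} = {..<height j}" for j by (auto simp: height_def)
  ultimately show ?thesis
    unfolding stair_space_def level_def base_def by (simp add: image_image)
qed

lemma level_subset_X: "y < height j \<Longrightarrow> level j y \<subseteq> X"
  unfolding X_eq by blast

lemma X_lebesgue: "X \<in> sets lebesgue"
  unfolding X_eq using level_lebesgue by (intro sets.countable_UN sets.finite_UN) auto

lemma level_step: "x \<in> level j y \<Longrightarrow> T x \<in> level j (Suc y)"
  unfolding level_def by auto

text \<open>The top level of a tower is a spacer of the previous stage, so a point lies below the top
  from the stage after its first appearance on.\<close>

lemma below_top_Suc:
  assumes "y < height j" "x \<in> level j y"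
  obtains y' where "Suc y' < height (Suc j)" "x \<in> level (Suc j) y'"
proof -
  obtain i where i: "i < cuts_of j" and x: "x \<in> level (Suc j) (offset (height j) i + y)"
    using assms level_refine[of j y] by blast
  have "Suc (offset (height j) i + y) < height (Suc j)"
  \<comment> \<open>Column 0 has no spacer but is not the last column; every other column has a
    spacer on top. Either way something lies above level \<open>y\<close>.\<close>
  proof (cases i)
    case 0
    have "offset (height j) 2 \<le> height (Suc j)"
      unfolding height_Suc using cuts_of_ge by (rule offset_mono)
    then show ?thesis using 0 assms(1) by (simp add: numeral_2_eq_2 offset_Suc)
  next
    case (Suc k)
    have "offset (height j) (Suc i) \<le> height (Suc j)"
      unfolding height_Suc using i by (intro offset_mono) simp
    then show ?thesis using Suc assms(1) by (simp add: offset_Suc)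
  qed
  then show ?thesis using x that by blast
qed

lemma below_top_mono:
  assumes "Suc y < height j" "x \<in> level j y" "j \<le> j'"
  shows "\<exists>y'. Suc y' < height j' \<and> x \<in> level j' y'"
  using assms(3)
proof (induction j' rule: dec_induct)
  case (step k)
  from step.IH obtain y' where "Suc y' < height k" "x \<in> level k y'" by blast
  then have y': "y' < height k" "x \<in> level k y'" by simp_all
  obtain y'' where "Suc y'' < height (Suc k)" "x \<in> level (Suc k) y''" by (rule below_top_Suc[OF y'])
  then show ?case by blast
qed (use assms in blast)

lemma below_top:
  assumes "x \<in> X"
  shows "\<exists>J. \<forall>j\<ge>J. \<exists>y. Suc y < height j \<and> x \<in> level j y"
proof -
  obtain j y where y: "y < height j" "x \<in> level j y" using assms by (auto simp: X_eq)
  obtain y' where y': "Suc y' < height (Suc j)" "x \<in> level (Suc j) y'" by (rule below_top_Suc[OF y])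
  show ?thesis using below_top_mono[OF y'] by blast
qed

lemma T_in_X: "x \<in> X \<Longrightarrow> T x \<in> X"
proof -
  assume "x \<in> X"
  then obtain J y where "Suc y < height J" "x \<in> level J y" using below_top[of x] by blast
  then show "T x \<in> X" using level_step[of x J y] level_subset_X[of "Suc y" J] by blast
qed

text \<open>Two points lie below the top of one common tower, where \<open>T\<close> carries
  distinct levels to disjoint levels and acts on each as a translation.\<close>

lemma T_inj: "inj_on T X"
proof (rule inj_onI)
  fix x x' assume x: "x \<in> X" and x': "x' \<in> X" and eq: "T x = T x'"
  obtain J where J: "\<forall>j\<ge>J. \<exists>y. Suc y < height j \<and> x \<in> level j y" using below_top[OF x] by blast
  obtain J' where J': "\<forall>j\<ge>J'. \<exists>y. Suc y < height j \<and> x' \<in> level j y" using below_top[OF x'] by blast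
  define j where "j = max J J'"
  have "J \<le> j" "J' \<le> j" by (simp_all add: j_def)
  obtain y where y: "Suc y < height j" "x \<in> level j y" using J \<open>J \<le> j\<close> by blast
  obtain y' where y': "Suc y' < height j" "x' \<in> level j y'" using J' \<open>J' \<le> j\<close> by blast
  have "T x \<in> level j (Suc y) \<inter> level j (Suc y')" using level_step[OF y(2)] level_step[OF y'(2)] eq by auto
  then have "y = y'" using level_disjoint[of "Suc y" j "Suc y'"] y y' by auto
  then show "x = x'" using T_translates_level[OF y(1)] y y' eq by auto
qed

lemma X_below_top: "X = (\<Union>j. \<Union>y\<in>{y. Suc y < height j}. level j y)"
proof
  show "X \<subseteq> (\<Union>j. \<Union>y\<in>{y. Suc y < height j}. level j y)"
  proof
    fix x assume "x \<in> X"
    then obtain J y where "Suc y < height J" "x \<in> level J y" using below_top[of x] by blast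
    then show "x \<in> (\<Union>j. \<Union>y\<in>{y. Suc y < height j}. level j y)" by blast
  qed
  show "(\<Union>j. \<Union>y\<in>{y. Suc y < height j}. level j y) \<subseteq> X"
    using level_subset_X by (intro UN_least) auto
qed

lemma translate_vimage:
  fixes c :: real
  assumes "B \<in> sets lebesgue"
  shows "(\<lambda>x. x + c) -` B \<in> sets lebesgue" "measure lebesgue ((\<lambda>x. x + c) -` B) = measure lebesgue B"
    "(\<lambda>x. x + c) ` B \<in> sets lebesgue"
proof -
  have eq: "(\<lambda>x. x + c) -` B = (+) (- c) ` B"
  proof (intro set_eqI iffI)
    fix x assume "x \<in> (\<lambda>x. x + c) -` B"
    then show "x \<in> (+) (- c) ` B" by (intro image_eqI[of _ _ "x + c"]) simp_all
  qed auto
  show "(\<lambda>x. x + c) -` B \<in> sets lebesgue"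
    unfolding eq using lebesgue_sets_translation[OF assms, of "- c"] by simp
  show "measure lebesgue ((\<lambda>x. x + c) -` B) = measure lebesgue B"
    unfolding eq by (rule measure_translation)
  show "(\<lambda>x. x + c) ` B \<in> sets lebesgue"
    using lebesgue_sets_translation[OF assms, of c] by (simp add: add.commute)
qed

lemma T_vimage_level:
  assumes y: "Suc y < height j" and B: "B \<in> sets lebesgue"
  shows "T -` B \<inter> level j y \<in> sets lebesgue"
    "measure lebesgue (T -` B \<inter> level j y) = measure lebesgue (B \<inter> level j (Suc y))"
proof -
  obtain c where c: "\<forall>x\<in>level j y. T x = x + c" using T_translates_level[OF y] by blast
  have level_Suc: "level j (Suc y) = (\<lambda>x. x + c) ` level j y"
    using c unfolding level_def by (auto simp: image_image image_iff)
  have eq: "T -` B \<inter> level j y = (\<lambda>x. x + c) -` (B \<inter> level j (Suc y))"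
    unfolding level_Suc using c by auto
  have "B \<inter> level j (Suc y) \<in> sets lebesgue" using B level_lebesgue[OF y] by auto
  then show "T -` B \<inter> level j y \<in> sets lebesgue"
    "measure lebesgue (T -` B \<inter> level j y) = measure lebesgue (B \<inter> level j (Suc y))"
    unfolding eq by (rule translate_vimage)+
qed

text \<open>\<open>mixing\<close> speaks of forward images, so their measurability has to be
  secured; \<open>T\<close> is a translation on each of countably many levels covering the
  space.\<close>

lemma T_image_lebesgue:
  assumes B: "B \<in> sets lebesgue" "B \<subseteq> X"
  shows "T ` B \<in> sets lebesgue"
proof -
  have "T ` B = (\<Union>j. \<Union>y\<in>{y. Suc y < height j}. T ` (B \<inter> level j y))"
  proof -
    have "T ` B = T ` (B \<inter> X)" using B(2) by (simp add: Int_absorb2)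
    then show ?thesis by (simp only: X_below_top Int_UN_distrib image_UN)
  qed
  moreover have "T ` (B \<inter> level j y) \<in> sets lebesgue" if y: "Suc y < height j" for j y
  proof -
    obtain c where c: "\<forall>x\<in>level j y. T x = x + c" using T_translates_level[OF y] by blast
    then have "T ` (B \<inter> level j y) = (\<lambda>x. x + c) ` (B \<inter> level j y)" by (intro image_cong) auto
    also have "\<dots> \<in> sets lebesgue" using B level_lebesgue[of y j] y by (intro translate_vimage) auto
    finally show ?thesis .
  qed
  moreover have "finite {y. Suc y < height j}" for j by (rule finite_subset[of _ "{..<height j}"]) auto
  ultimately show ?thesis by (auto intro!: sets.countable_UN sets.finite_UN)
qed

section \<open>Invariance of the measure and approximation by levels\<close>

context
  assumes r_top: "filterlim r at_top sequentially"
    and X_measure: "emeasure lebesgue X = 1"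
begin

abbreviation M :: "real measure" where
  "M \<equiv> lebesgue_on X"

lemma space_M: "space M = X"
  by simp

lemma sets_M: "B \<in> sets M \<longleftrightarrow> B \<in> sets lebesgue \<and> B \<subseteq> X"
  by (subst sets_restrict_space_iff) (auto simp: X_lebesgue)

lemma measure_M: "B \<subseteq> X \<Longrightarrow> measure M B = measure lebesgue B"
  by (rule measure_restrict_space) (simp_all add: X_lebesgue)

lemma prob_space_M: "prob_space M"
  by (rule prob_spaceI) (simp add: emeasure_restrict_space X_lebesgue X_measure)

lemma level_M: "y < height j \<Longrightarrow> level j y \<in> sets M"
  using level_lebesgue level_subset_X by (simp add: sets_M)

lemma measure_level: "y < height j \<Longrightarrow> measure M (level j y) = width j"
  using measure_M[OF level_subset_X] level_lebesgue_measure by simp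

lemma T_measurable: "T \<in> M \<rightarrow>\<^sub>M M"
proof (rule measurableI)
  fix B assume B: "B \<in> sets M"
  have eq: "T -` B \<inter> X = (\<Union>j. \<Union>y\<in>{y. Suc y < height j}. T -` B \<inter> level j y)"
    by (simp only: X_below_top Int_UN_distrib)
  have fin: "finite {y. Suc y < height j}" for j by (rule finite_subset[of _ "{..<height j}"]) auto
  have "(\<Union>j. \<Union>y\<in>{y. Suc y < height j}. T -` B \<inter> level j y) \<in> sets lebesgue"
    using B T_vimage_level(1) fin
    by (intro sets.countable_UN image_subsetI sets.finite_UN) (auto simp: sets_M)
  then have "T -` B \<inter> X \<in> sets lebesgue" unfolding eq .
  then show "T -` B \<inter> space M \<in> sets M" by (simp add: sets_M)
qed (simp add: T_in_X)

lemma measure_below_top: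
  assumes "Y \<subseteq> {..<height j}"
  shows "measure M (\<Union>y\<in>Y. level j y) = real (card Y) * width j"
proof -
  interpret prob_space M by (rule prob_space_M)
  have "finite Y" using assms finite_subset by blast
  then have "measure M (\<Union>y\<in>Y. level j y) = (\<Sum>y\<in>Y. measure M (level j y))"
    using assms level_M level_disjoint
    by (intro finite_measure_finite_Union) (auto simp: disjoint_family_on_def subset_iff)
  also have "\<dots> = (\<Sum>y\<in>Y. width j)" using assms measure_level by (intro sum.cong) auto
  finally show ?thesis by simp
qed

lemma towers_full: "(\<lambda>j. real (height j) * width j) \<longlonglongrightarrow> 1"
proof -
  interpret prob_space M by (rule prob_space_M)
  have "(\<lambda>j. measure M (\<Union>y<height j. level j y)) \<longlonglongrightarrow> measure M (\<Union>j. \<Union>y<height j. level j y)"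
  proof (rule finite_Lim_measure_incseq)
    show "range (\<lambda>j. \<Union>y<height j. level j y) \<subseteq> sets M"
      using level_M by (auto intro!: sets.finite_UN)
    show "incseq (\<lambda>j. \<Union>y<height j. level j y)"
    proof (rule incseq_SucI, rule subsetI)
      fix j x assume "x \<in> (\<Union>y<height j. level j y)"
      then obtain y where y: "y < height j" "x \<in> level j y" by blast
      obtain y' where "Suc y' < height (Suc j)" "x \<in> level (Suc j) y'" by (rule below_top_Suc[OF y])
      then show "x \<in> (\<Union>y<height (Suc j). level (Suc j) y)" by (auto intro!: bexI[of _ y'])
    qed
  qed
  moreover have "measure M (\<Union>j. \<Union>y<height j. level j y) = 1"
    using prob_space unfolding space_M X_eq[symmetric] .
  ultimately show ?thesis using measure_below_top by simp
qed

lemma width_tendsto: "width \<longlonglongrightarrow> 0"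
proof (rule tendsto_sandwich[OF _ _ tendsto_const])
  interpret prob_space M by (rule prob_space_M)
  have "j \<le> height j" for j
  proof (induction j)
    case (Suc j)
    have "offset (height j) 2 \<le> height (Suc j)" unfolding height_Suc using cuts_of_ge by (rule offset_mono)
    then show ?case using Suc height_pos[of j] by (simp add: numeral_2_eq_2 offset_Suc)
  qed simp
  moreover have "real (height j) * width j \<le> 1" for j
    using measure_below_top[of "{..<height j}" j] prob_le_1[of "\<Union>y<height j. level j y"] by simp
  ultimately have "real j * width j \<le> 1" for j
    using width_pos'[of j] by (meson less_imp_le mult_right_mono of_nat_mono order_trans)
  then show "\<forall>\<^sub>F j in sequentially. width j \<le> 1 / real j"
    by (intro eventually_mono[OF eventually_gt_at_top[of 0]]) (simp add: field_simps)
  show "\<forall>\<^sub>F j in sequentially. 0 \<le> width j" using width_pos' by (simp add: less_imp_le)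
  show "(\<lambda>j. 1 / real j) \<longlonglongrightarrow> 0" by (rule lim_1_over_n)
qed

text \<open>\<open>T\<close> is known to be a translation only below the top of a tower. The
  preimage is therefore measured on all levels but the top and the set itself on all levels but the
  bottom; these match level by level, and the neglected measure tends to 0.\<close>

lemma T_preserves: "distr M M T = M"
proof (rule measure_eqI)
  interpret prob_space M by (rule prob_space_M)
  fix B assume "B \<in> sets (distr M M T)"
  then have B: "B \<in> sets M" by simp
  define V where "V = T -` B \<inter> X"
  have V: "V \<in> sets M" unfolding V_def using measurable_sets[OF T_measurable B] by simp
  define \<epsilon> where "\<epsilon> j = 1 - real (height j - 1) * width j" for j
  have approx: "\<bar>measure M C - (\<Sum>y\<in>Y. measure M (C \<inter> level j y))\<bar> \<le> \<epsilon> j"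
    if C: "C \<in> sets M" and Y: "Y \<subseteq> {..<height j}" "card Y = height j - 1" for C Y j
  proof -
    let ?U = "\<Union>y\<in>Y. level j y"
    have fin: "finite Y" using Y finite_subset by blast
    have U: "?U \<in> sets M" using Y level_M fin by (intro sets.finite_UN) auto
    have "measure M (\<Union>y\<in>Y. C \<inter> level j y) = (\<Sum>y\<in>Y. measure M (C \<inter> level j y))"
    proof (rule finite_measure_finite_Union[OF fin])
      show "(\<lambda>y. C \<inter> level j y) ` Y \<subseteq> sets M" using C Y level_M by auto
      show "disjoint_family_on (\<lambda>y. C \<inter> level j y) Y"
        using Y level_disjoint unfolding disjoint_family_on_def by (metis Int_empty_right inf_assoc inf_left_commute lessThan_iff subsetD)
    qed
    moreover have "(\<Union>y\<in>Y. C \<inter> level j y) = C \<inter> ?U" by blast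
    moreover have "measure M C = measure M (C \<inter> ?U) + measure M (C - ?U)"
      using C U by (subst finite_measure_Union[symmetric]) (auto intro!: arg_cong[of _ _ "measure M"])
    moreover have "measure M (C - ?U) \<le> measure M (space M - ?U)"
      using C U sets.sets_into_space[OF C] by (intro finite_measure_mono) auto
    moreover have "measure M (space M - ?U) = \<epsilon> j"
      using prob_compl[OF U] measure_below_top[OF Y(1)] Y(2) by (simp add: \<epsilon>_def)
    ultimately show ?thesis by simp
  qed
  have diff: "\<bar>measure M V - measure M B\<bar> \<le> 2 * \<epsilon> j" for j
  proof -
    let ?Y = "{..<height j - 1}"
    have "\<bar>measure M V - (\<Sum>y\<in>?Y. measure M (V \<inter> level j y))\<bar> \<le> \<epsilon> j"
      by (rule approx[OF V]) auto
    moreover have "\<bar>measure M B - (\<Sum>y\<in>Suc ` ?Y. measure M (B \<inter> level j y))\<bar> \<le> \<epsilon> j"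
      by (rule approx[OF B]) (auto simp: card_image)
    moreover have "(\<Sum>y\<in>Suc ` ?Y. measure M (B \<inter> level j y)) = (\<Sum>y\<in>?Y. measure M (V \<inter> level j y))"
    proof (subst sum.reindex, simp, unfold comp_def, rule sum.cong[OF refl])
      fix y assume "y \<in> ?Y"
      then have y: "Suc y < height j" by auto
      have "V \<inter> level j y = T -` B \<inter> level j y" using level_subset_X[of y j] y by (auto simp: V_def)
      then show "measure M (B \<inter> level j (Suc y)) = measure M (V \<inter> level j y)"
        using T_vimage_level(2)[OF y, of B] B y level_subset_X[of y j] level_subset_X[of "Suc y" j]
        by (subst (1 2) measure_M) (auto simp: sets_M)
    qed
    ultimately show ?thesis by linarith
  qed
  have "(\<lambda>j. 2 * (1 - (real (height j) * width j - width j))) \<longlonglongrightarrow> 2 * (1 - (1 - 0))"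
    by (intro tendsto_intros towers_full width_tendsto)
  moreover have "\<epsilon> j = 1 - (real (height j) * width j - width j)" for j
    using height_pos[of j] by (simp add: \<epsilon>_def of_nat_diff algebra_simps)
  ultimately have "(\<lambda>j. 2 * \<epsilon> j) \<longlonglongrightarrow> 0" by simp
  then have "\<bar>measure M V - measure M B\<bar> \<le> 0"
    by (rule LIMSEQ_le_const) (use diff in blast)
  then have "measure M V = measure M B" by simp
  then show "emeasure (distr M M T) B = emeasure M B"
    using emeasure_distr[OF T_measurable B] by (simp add: V_def emeasure_eq_measure)
qed simp

lemma stair_system_M: "stair_system M T level cuts_of height width"
proof -
  interpret prob_space M by (rule prob_space_M)
  have top: "filterlim cuts_of at_top sequentially"
    unfolding cuts_of_def using r_top by (rule filterlim_compose) (rule filterlim_Suc)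
  show ?thesis
  proof
    show "T \<in> M \<rightarrow>\<^sub>M M" by (rule T_measurable)
    show "distr M M T = M" by (rule T_preserves)
    show "level j y \<in> sets M" if "y < height j" for j y using that by (rule level_M)
    show "level j y \<inter> level j y' = {}" if "y < height j" "y' < height j" "y \<noteq> y'" for j y y'
      using that by (rule level_disjoint)
    show "measure M (level j y) = width j" if "y < height j" for j y using that by (rule measure_level)
    show "T x \<in> level j (Suc y)" if "x \<in> level j y" for j y x using that by (rule level_step)
    show "level j y = (\<Union>i<cuts_of j. level (Suc j) (offset (height j) i + y))" for j y by (rule level_refine)
    show "height (Suc j) = offset (height j) (cuts_of j)" for j by (rule height_Suc)
    show "width j = real (cuts_of j) * width (Suc j)" for j by (rule width_Suc)
  qed (rule height_pos width_pos' cuts_of_ge top towers_full)+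
qed

interpretation stair_system M T level cuts_of height width
  by (rule stair_system_M)

text \<open>Outer regularity gives an open \<open>U\<close> around \<open>A\<close>. Levels are
  intervals whose length tends to 0, so the levels contained in \<open>U\<close> increase to
  \<open>U \<inter> X\<close>.\<close>

lemma level_union_approximates:
  assumes A: "A \<in> sets M" and e: "e > 0"
  shows "\<forall>\<^sub>F n in sequentially. \<exists>Y\<subseteq>{..<height n}. measure M (sym_diff A (level_union n Y)) < e"
proof -
  have A': "A \<in> sets lebesgue" "A \<subseteq> X" using A by (auto simp: sets_M)
  obtain U where U: "open U" "A \<subseteq> U" "U - A \<in> lmeasurable" "emeasure lebesgue (U - A) < ennreal (e / 2)"
    using sets_lebesgue_outer_open[OF A'(1), of "e / 2"] e by auto
  have UX: "U \<inter> X \<in> sets M" using U(1) X_lebesgue by (auto simp: sets_M intro!: sets.Int intro: sets_completionI_sets)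
  define Y where "Y n = {y. y < height n \<and> level n y \<subseteq> U}" for n
  define V where "V n = level_union n (Y n)" for n
  have Y: "Y n \<subseteq> {..<height n}" for n by (auto simp: Y_def)
  have V: "V n \<in> sets M" for n unfolding V_def using Y by (rule level_union_sets)
  have V_sub: "V n \<subseteq> U \<inter> X" for n
    using level_subset_X by (auto simp: V_def level_union_def Y_def)
  have inc: "incseq V"
  proof (rule incseq_SucI, rule subsetI)
    fix n x assume "x \<in> V n"
    then obtain y where y: "y < height n" "level n y \<subseteq> U" "x \<in> level n y" by (auto simp: V_def level_union_def Y_def)
    then obtain i where i: "i < cuts_of n" "x \<in> level (Suc n) (offset (height n) i + y)" using level_refine[of n y] by blast
    moreover have "level (Suc n) (offset (height n) i + y) \<subseteq> level n y" using i y by (intro L_refine_subset)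
    ultimately have "offset (height n) i + y \<in> Y (Suc n)" using y offset_less[of i n y] by (auto simp: Y_def)
    then show "x \<in> V (Suc n)" using i by (auto simp: V_def level_union_def)
  qed
  have "(\<Union>n. V n) = U \<inter> X"
  proof
    show "U \<inter> X \<subseteq> (\<Union>n. V n)"
    proof
      fix x assume x: "x \<in> U \<inter> X"
      obtain \<delta> where \<delta>: "\<delta> > 0" "ball x \<delta> \<subseteq> U" using U(1) x openE by blast
      obtain J where J: "\<forall>j\<ge>J. \<exists>y. Suc y < height j \<and> x \<in> level j y" using below_top[of x] x by blast
      have "\<forall>\<^sub>F n in sequentially. width n < \<delta> \<and> n \<ge> J"
        using order_tendstoD(2)[OF width_tendsto \<delta>(1)] eventually_ge_at_top[of J] by (rule eventually_conj)
      then obtain n where n: "width n < \<delta>" "n \<ge> J" using eventually_happens'[OF sequentially_bot] by blast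
      obtain y where y: "Suc y < height n" "x \<in> level n y" using J n(2) by blast
      obtain c where c: "level n y = {c ..< c + width n}" using level_interval[of y n] y by auto
      have "level n y \<subseteq> ball x \<delta>" using y(2) n(1) by (auto simp: c dist_real_def)
      then have "y \<in> Y n" using y \<delta> by (auto simp: Y_def)
      then show "x \<in> (\<Union>n. V n)" using y by (auto simp: V_def level_union_def)
    qed
  qed (use V_sub in blast)
  then have "(\<lambda>n. measure M (V n)) \<longlonglongrightarrow> measure M (U \<inter> X)"
    using finite_Lim_measure_incseq[of V] V inc by auto
  then have "\<forall>\<^sub>F n in sequentially. measure M (V n) > measure M (U \<inter> X) - e / 2"
    using e by (intro order_tendstoD(1)) auto
  then show ?thesis
  proof (rule eventually_mono)
    fix n assume n: "measure M (V n) > measure M (U \<inter> X) - e / 2"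
    have UA: "U \<inter> X - A \<in> sets M" using UX A by auto
    have "measure M (sym_diff A (V n)) \<le> measure M ((U \<inter> X - A) \<union> (U \<inter> X - V n))"
      using UX A V[of n] V_sub[of n] U(2) A'(2) by (intro finite_measure_mono) auto
    also have "\<dots> \<le> measure M (U \<inter> X - A) + measure M (U \<inter> X - V n)"
      using UX A V[of n] by (intro measure_Un_le) auto
    also have "measure M (U \<inter> X - V n) = measure M (U \<inter> X) - measure M (V n)"
      using UX V[of n] V_sub[of n] by (intro finite_measure_Diff) auto
    also have "measure M (U \<inter> X - A) < e / 2"
    proof -
      have "measure M (U \<inter> X - A) = measure lebesgue (U \<inter> X - A)" by (rule measure_M) auto
      also have "\<dots> \<le> measure lebesgue (U - A)"
        using UA U(3) by (intro measure_mono_fmeasurable) (auto simp: sets_M)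
      also have "\<dots> < e / 2"
        using U(3,4) e by (simp add: emeasure_eq_measure2 fmeasurableD2 ennreal_less_iff emeasure_eq_ennreal_measure)
      finally show ?thesis .
    qed
    finally have "measure M (sym_diff A (V n)) < e" using n by simp
    then show "\<exists>Y\<subseteq>{..<height n}. measure M (sym_diff A (level_union n Y)) < e"
      using Y by (auto simp: V_def)
  qed
qed

lemma Tn_image_sets: "B \<in> sets M \<Longrightarrow> (T ^^ m) ` B \<in> sets M"
proof (induction m)
  case (Suc m)
  then have "(T ^^ m) ` B \<in> sets lebesgue" "(T ^^ m) ` B \<subseteq> X" by (auto simp: sets_M)
  then have "T ` (T ^^ m) ` B \<in> sets M" using T_image_lebesgue T_in_X by (auto simp: sets_M)
  then show ?case by (simp add: image_comp)
qed simp

lemma Tn_inj: "inj_on (T ^^ m) X"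
proof (induction m)
  case (Suc m)
  have "(T ^^ m) ` X \<subseteq> X" using measurable_space[OF Tn_measurable, of _ m] by auto
  then have "inj_on (T \<circ> T ^^ m) X" by (intro comp_inj_on Suc inj_on_subset[OF T_inj])
  then show ?case by (simp only: funpow.simps)
qed simp

text \<open>The estimates concern preimages, \<open>mixing\<close> concerns images. By injectivity,
  pulling back the intersection of \<open>A\<close> with the image of \<open>B\<close> under
  \<open>T ^^ m\<close> gives \<open>B\<close> intersected with the preimage of \<open>A\<close>,
  and invariance keeps the measure.\<close>

lemma mixing_T: "mixing M T"
  unfolding mixing_def
proof (intro ballI)
  fix A B assume A: "A \<in> sets M" and B: "B \<in> sets M"
  have "measure M (A \<inter> (T ^^ m) ` B) = measure M ((T ^^ m) -` A \<inter> space M \<inter> B)" for m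
  proof -
    have "A \<inter> (T ^^ m) ` B \<in> sets M" using A Tn_image_sets[OF B] by auto
    then have "measure M (A \<inter> (T ^^ m) ` B) = measure M ((T ^^ m) -` (A \<inter> (T ^^ m) ` B) \<inter> space M)"
      using measure_distr[OF Tn_measurable, of "A \<inter> (T ^^ m) ` B" m] by (simp add: Tn_preserves)
    also have "(T ^^ m) -` (A \<inter> (T ^^ m) ` B) \<inter> space M = (T ^^ m) -` A \<inter> space M \<inter> B"
      using sets.sets_into_space[OF B] inj_onD[OF Tn_inj[of m]] by (auto simp: subset_iff)
    finally show ?thesis .
  qed
  then show "(\<lambda>m. measure M (A \<inter> (T ^^ m) ` B)) \<longlonglongrightarrow> measure M A * measure M B"
    using mixing_measurable_sets[OF level_union_approximates A B] by simp
qed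

end

end

theorem mainTheorem1:
  fixes h1 :: nat and r :: "nat \<Rightarrow> nat" and a w :: real and T :: "real \<Rightarrow> real"
  assumes "staircase h1 r a w T"
    and "filterlim r at_top sequentially"
    and "emeasure lebesgue (stair_space h1 r a w T) = 1"
  shows "mixing (lebesgue_on (stair_space h1 r a w T)) T"
  using staircase.mixing_T[OF assms] .

end
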